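(* Let $X$ and $Y$ be uniformly locally finite metric spaces and assume that $Y$ has property A. Let $\Phi\colon\mathrm{C}^*(X)\to\mathrm{C}^*(Y)$ be an isomorphism. Let $\bar\xi=(\xi_n)_n$ and $\bar\zeta=(\zeta_n)_n$ be orthonormal bases of $H$. Then there exists a unitary $v\in\mathrm{BD}(Y)$ such that $\mathrm{Ad}(v)\circ\Phi\colon\mathrm{C}^*(X)\to\mathrm{C}^*(Y)$ is strongly coarse-like and \[ \mathrm{Ad}(v)\circ\Phi\big(\ell_\infty(X,\bar\xi)\big)=\ell_\infty(Y,\bar\zeta). \]
   Context: A metric space $(X,d)$ is uniformly locally finite (u.l.f.) if $\sup_{x\in X}|B_r(x)|<\infty$ for all $r>0$, where $B_r(x)$ is the closed ball of radius $r$ centered at $x$. $H$ is a separable infinite-dimensional Hilbert space. $\ell_2(X,H)$ is the Hilbert space of square-summable functions $X\to H$, and $\delta_x\otimes\eta$ is the function with value $\eta$ at $x$ and $0$ elsewhere. For $a\in\mathcal B(\ell_2(X,H))$ and $x,y\in X$, $a_{xy}\in\mathcal B(H)$ is determined by $\langle a_{xy}\xi,\eta\rangle=\langle a(\delta_x\otimes\xi),\delta_y\otimes\eta\rangle$, and $\mathrm{prop}(a)=\sup\{d(x,y)\mid a_{xy}\neq 0\}$. $\mathrm{BD}(X)$ is the norm closure of $\{a\in\mathcal B(\ell_2(X,H))\mid\mathrm{prop}(a)<\infty\}$, and the Roe algebra is $\mathrm{C}^*(X)=\{a\in \mathrm{BD}(X)\mid a_{xy}\text{ is compact for all }x,y\in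 X\}$. For a unitary $v$, $\mathrm{Ad}(v)(a)=vav^*$. A map $\Phi\colon\mathrm{C}^*(X)\to\mathrm{C}^*(Y)$ is strongly coarse-like if for all $r>0$ there is $s>0$ so that $\mathrm{prop}(\Phi(a))\leq s$ for all $a\in\mathrm{C}^*(X)$ with $\mathrm{prop}(a)\leq r$. For an orthonormal basis $\bar\xi=(\xi_n)_n$ of $H$, $\ell_\infty(X,\bar\xi)$ is the algebra of all $a\in\mathcal B(\ell_2(X,H))$ such that for every $x\in X$ there is $(\lambda_n)_n\in c_0$ with $a(\delta_x\otimes\xi_n)=\lambda_n(\delta_x\otimes\xi_n)$ for all $n\in\mathbb N$. Property A is Yu's property A. For u.l.f. metric spaces it is equivalent to the operator norm localisation property (ONL), which may be taken as the definition: for all $s>0$ and $\rho\in(0,1)$ there is $r>0$ so that for every $a\in \mathcal B(\ell_2(X,H))$ with $\mathrm{prop}(a)\leq s$ there is a unit vector $\xi\in\ell_2(X,H)$ with $\mathrm{diam}(\{x\in X\mid \xi(x)\neq 0\})\leq r$ and $\|a\xi\|\geq\rho\|a\|$. *)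

theory Defs
  imports "HOL-Analysis.Analysis"
begin

section \<open>Complex Hilbert spaces\<close>

text \<open>
  The inner product is linear in the first and conjugate linear in the second argument. The
  norm, topology and real vector space structure are those of \<^class>\<open>real_normed_vector\<close>, so
  that the library's operator type applies; operators of that type are only real linear, and
  complex linearity is imposed separately below.
\<close>

class complex_inner = real_normed_vector +
  fixes scaleC :: "complex \<Rightarrow> 'a \<Rightarrow> 'a"  (infixr "*\<^sub>C" 75)
    and cinner :: "'a \<Rightarrow> 'a \<Rightarrow> complex"
  assumes scaleC_add_right: "c *\<^sub>C (x + y) = c *\<^sub>C x + c *\<^sub>C y"
    and scaleC_add_left: "(c + d) *\<^sub>C x = c *\<^sub>C x + d *\<^sub>C x"
    and scaleC_scaleC: "c *\<^sub>C (d *\<^sub>C x) = (c * d) *\<^sub>C x"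
    and scaleR_scaleC: "r *\<^sub>R x = complex_of_real r *\<^sub>C x"
    and cinner_add_left: "cinner (x + y) z = cinner x z + cinner y z"
    and cinner_scaleC_left: "cinner (c *\<^sub>C x) y = c * cinner x y"
    and cinner_commute: "cinner x y = cnj (cinner y x)"
    and cinner_self: "cinner x x = complex_of_real ((norm x)\<^sup>2)"

class complex_hilbert = complex_inner + complete_space

instantiation complex :: complex_hilbert
begin

definition scaleC_complex :: "complex \<Rightarrow> complex \<Rightarrow> complex"
  where "scaleC_complex c x = c * x"

definition cinner_complex :: "complex \<Rightarrow> complex \<Rightarrow> complex"
  where "cinner_complex x y = x * cnj y"

instance
proof
  fix x :: complex
  show "cinner x x = complex_of_real ((norm x)\<^sup>2)"
    unfolding cinner_complex_def by (rule complex_norm_square[symmetric])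
qed (simp_all add: scaleC_complex_def cinner_complex_def algebra_simps scaleR_conv_of_real)

end

global_interpretation complex_vector:
  vector_space "scaleC :: complex \<Rightarrow> 'a \<Rightarrow> 'a::complex_inner"
  defines cspan = complex_vector.span
proof
  fix c d :: complex and x y :: 'a
  show "c *\<^sub>C (x + y) = c *\<^sub>C x + c *\<^sub>C y" by (rule scaleC_add_right)
  show "(c + d) *\<^sub>C x = c *\<^sub>C x + d *\<^sub>C x" by (rule scaleC_add_left)
  show "c *\<^sub>C (d *\<^sub>C x) = (c * d) *\<^sub>C x" by (rule scaleC_scaleC)
  show "1 *\<^sub>C x = x" using scaleR_scaleC[of 1 x] by simp
qed

lemma cinner_add_right: "cinner x (y + z) = cinner x y + cinner x (z::'a::complex_inner)"
  by (metis cinner_add_left cinner_commute complex_cnj_add)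

lemma cinner_scaleC_right: "cinner x (c *\<^sub>C y) = cnj c * cinner x (y::'a::complex_inner)"
  by (metis cinner_scaleC_left cinner_commute complex_cnj_mult)

lemma cinner_zero_left [simp]: "cinner 0 (y::'a::complex_inner) = 0"
  using cinner_add_left[of 0 0 y] by simp

lemma cinner_zero_right [simp]: "cinner (y::'a::complex_inner) 0 = 0"
  using cinner_add_right[of y 0 0] by simp

lemma cinner_minus_left: "cinner (- x) y = - cinner x (y::'a::complex_inner)"
  using cinner_add_left[of x "- x" y] by (simp add: eq_neg_iff_add_eq_0 add.commute)

lemma cinner_diff_left: "cinner (x - y) z = cinner x z - cinner y (z::'a::complex_inner)"
  using cinner_add_left[of x "- y" z] by (simp add: cinner_minus_left)

lemma norm_scaleC: "norm (c *\<^sub>C (x::'a::complex_inner)) = cmod c * norm x"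
proof -
  have "complex_of_real ((norm (c *\<^sub>C x))\<^sup>2) = complex_of_real ((cmod c * norm x)\<^sup>2)"
    unfolding cinner_self[symmetric] cinner_scaleC_left cinner_scaleC_right
    by (simp add: cinner_self power_mult_distrib complex_norm_square[of c, simplified of_real_power] mult_ac)
  then have "(norm (c *\<^sub>C x))\<^sup>2 = (cmod c * norm x)\<^sup>2"
    using of_real_eq_iff by blast
  then show ?thesis by (simp add: power2_eq_iff_nonneg)
qed

lemma Cauchy_Schwarz_complex: "cmod (cinner x y) \<le> norm x * norm (y::'a::complex_inner)"
proof (cases "y = 0")
  case False
  define n where "n = (norm y)\<^sup>2"
  have n: "n > 0" using False by (simp add: n_def)
  define c where "c = cinner x y / complex_of_real n"
  let ?z = "x + (- c) *\<^sub>C y"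
  have yy: "cinner y y = complex_of_real n" by (simp add: cinner_self n_def)
  have "cinner (x + d *\<^sub>C y) (x + d *\<^sub>C y)
      = cinner x x + cnj d * cinner x y + d * cnj (cinner x y) + d * cnj d * complex_of_real n" for d
    by (simp add: cinner_add_left cinner_add_right cinner_scaleC_left cinner_scaleC_right yy
        cinner_commute[of y x] algebra_simps)
  from this[of "- c"]
  have "cinner ?z ?z = cinner x x - cinner x y * cnj (cinner x y) / complex_of_real n"
    using n by (simp add: c_def del: complex_vector.scale_minus_left)
  then have "complex_of_real ((norm ?z)\<^sup>2)
      = complex_of_real ((norm x)\<^sup>2 - (cmod (cinner x y))\<^sup>2 / n)"
    by (simp add: cinner_self complex_norm_square[of "cinner x y", simplified of_real_power])
  then have "(norm ?z)\<^sup>2 = (norm x)\<^sup>2 - (cmod (cinner x y))\<^sup>2 / n"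
    using of_real_eq_iff by blast
  then have "(cmod (cinner x y))\<^sup>2 / n \<le> (norm x)\<^sup>2"
    by (metis diff_ge_0_iff_ge zero_le_power2)
  then have "(cmod (cinner x y))\<^sup>2 \<le> (norm x * norm y)\<^sup>2"
    using n by (simp add: n_def field_simps power_mult_distrib)
  then show ?thesis by (rule power2_le_imp_le) simp
qed simp

definition infinite_dimensional :: "'h::complex_inner itself \<Rightarrow> bool" where
  "infinite_dimensional _ \<longleftrightarrow> (\<forall>B::'h set. finite B \<longrightarrow> cspan B \<noteq> UNIV)"

definition orthonormal_basis :: "(nat \<Rightarrow> 'h::complex_inner) \<Rightarrow> bool" where
  "orthonormal_basis \<xi> \<longleftrightarrow>
     (\<forall>m n. cinner (\<xi> m) (\<xi> n) = (if m = n then 1 else 0)) \<and> closure (cspan (range \<xi>)) = UNIV"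


section \<open>Square-summable functions\<close>

typedef (overloaded) ('x, 'h::complex_inner) ell2 =
  "{f :: 'x \<Rightarrow> 'h. (\<lambda>x. (norm (f x))\<^sup>2) summable_on UNIV}"
  morphisms ell2_apply Abs_ell2
  by (rule exI[of _ "\<lambda>_. 0"]) simp

setup_lifting type_definition_ell2

lemma ell2_boundI:
  fixes f :: "'x \<Rightarrow> 'h::complex_inner"
  assumes "\<And>F. finite F \<Longrightarrow> L2_set (\<lambda>x. norm (f x)) F \<le> b"
  shows "(\<lambda>x. (norm (f x))\<^sup>2) summable_on UNIV"
    and "sqrt (\<Sum>\<^sub>\<infinity>x. (norm (f x))\<^sup>2) \<le> b"
proof -
  have b: "b \<ge> 0" using assms[of "{}"] by simp
  have le: "(\<Sum>x\<in>F. (norm (f x))\<^sup>2) \<le> b\<^sup>2" if "finite F" for F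
    using assms[OF that] unfolding L2_set_def by (metis real_sqrt_le_iff real_sqrt_abs abs_of_nonneg b)
  show s: "(\<lambda>x. (norm (f x))\<^sup>2) summable_on UNIV"
    by (rule nonneg_bdd_above_summable_on) (auto intro!: bdd_aboveI2[where M = "b\<^sup>2"] le)
  have "(\<Sum>\<^sub>\<infinity>x. (norm (f x))\<^sup>2) \<le> b\<^sup>2"
    using s by (rule infsum_le_finite_sums) (use le in auto)
  then show "sqrt (\<Sum>\<^sub>\<infinity>x. (norm (f x))\<^sup>2) \<le> b"
    by (intro real_le_lsqrt) (simp_all add: infsum_nonneg b)
qed

lemma L2_set_le_infsum:
  fixes f :: "'x \<Rightarrow> 'h::complex_inner"
  assumes "(\<lambda>x. (norm (f x))\<^sup>2) summable_on UNIV" "finite F"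
  shows "L2_set (\<lambda>x. norm (f x)) F \<le> sqrt (\<Sum>\<^sub>\<infinity>x. (norm (f x))\<^sup>2)"
  unfolding L2_set_def using assms by (intro real_sqrt_le_mono finite_sum_le_infsum) auto

lemma L2_set_norm_add:
  fixes f g :: "'x \<Rightarrow> 'h::complex_inner"
  assumes f: "(\<lambda>x. (norm (f x))\<^sup>2) summable_on UNIV" and g: "(\<lambda>x. (norm (g x))\<^sup>2) summable_on UNIV"
    and F: "finite F"
  shows "L2_set (\<lambda>x. norm (f x + g x)) F
    \<le> sqrt (\<Sum>\<^sub>\<infinity>x. (norm (f x))\<^sup>2) + sqrt (\<Sum>\<^sub>\<infinity>x. (norm (g x))\<^sup>2)"
proof -
  have "L2_set (\<lambda>x. norm (f x + g x)) F \<le> L2_set (\<lambda>x. norm (f x) + norm (g x)) F"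
    by (rule L2_set_mono) (auto intro: norm_triangle_ineq)
  also have "\<dots> \<le> L2_set (\<lambda>x. norm (f x)) F + L2_set (\<lambda>x. norm (g x)) F"
    by (rule L2_set_triangle_ineq)
  also have "\<dots> \<le> sqrt (\<Sum>\<^sub>\<infinity>x. (norm (f x))\<^sup>2) + sqrt (\<Sum>\<^sub>\<infinity>x. (norm (g x))\<^sup>2)"
    by (intro add_mono L2_set_le_infsum f g F)
  finally show ?thesis .
qed

lemma summable_norm_scaleC:
  fixes f :: "'x \<Rightarrow> 'h::complex_inner"
  assumes "(\<lambda>x. (norm (f x))\<^sup>2) summable_on UNIV"
  shows "(\<lambda>x. (norm (c *\<^sub>C f x))\<^sup>2) summable_on UNIV"
  unfolding norm_scaleC power_mult_distrib by (intro summable_on_cmult_right assms)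

lemma ell2_summable_cinner:
  fixes f g :: "'x \<Rightarrow> 'h::complex_inner"
  assumes "(\<lambda>x. (norm (f x))\<^sup>2) summable_on UNIV" and "(\<lambda>x. (norm (g x))\<^sup>2) summable_on UNIV"
  shows "(\<lambda>x. cinner (f x) (g x)) summable_on UNIV"
proof (rule abs_summable_summable,
    rule Infinite_Sum.abs_summable_on_comparison_test'[where g = "\<lambda>x. (norm (f x))\<^sup>2 + (norm (g x))\<^sup>2"])
  show "(\<lambda>x. (norm (f x))\<^sup>2 + (norm (g x))\<^sup>2) summable_on UNIV"
    by (rule summable_on_add[OF assms])
  fix x
  have "cmod (cinner (f x) (g x)) \<le> norm (f x) * norm (g x)" by (rule Cauchy_Schwarz_complex)
  also have "\<dots> \<le> (norm (f x))\<^sup>2 + (norm (g x))\<^sup>2"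
    using sum_squares_bound[of "norm (f x)" "norm (g x)"]
      mult_nonneg_nonneg[OF norm_ge_zero[of "f x"] norm_ge_zero[of "g x"]] by linarith
  finally show "norm (cinner (f x) (g x)) \<le> (norm (f x))\<^sup>2 + (norm (g x))\<^sup>2" .
qed

instantiation ell2 :: (type, complex_inner) complex_inner
begin

lift_definition zero_ell2 :: "('a, 'b) ell2" is "\<lambda>_. 0" by simp

lift_definition plus_ell2 :: "('a, 'b) ell2 \<Rightarrow> ('a, 'b) ell2 \<Rightarrow> ('a, 'b) ell2"
  is "\<lambda>f g x. f x + g x"
  by (rule ell2_boundI(1)[OF L2_set_norm_add])

lift_definition uminus_ell2 :: "('a, 'b) ell2 \<Rightarrow> ('a, 'b) ell2" is "\<lambda>f x. - f x" by simp

definition minus_ell2 :: "('a, 'b) ell2 \<Rightarrow> ('a, 'b) ell2 \<Rightarrow> ('a, 'b) ell2"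
  where "minus_ell2 f g = f + (- g)"

lift_definition scaleC_ell2 :: "complex \<Rightarrow> ('a, 'b) ell2 \<Rightarrow> ('a, 'b) ell2"
  is "\<lambda>c f x. c *\<^sub>C f x"
  by (rule summable_norm_scaleC)

definition scaleR_ell2 :: "real \<Rightarrow> ('a, 'b) ell2 \<Rightarrow> ('a, 'b) ell2"
  where "scaleR_ell2 r f = complex_of_real r *\<^sub>C f"

lift_definition norm_ell2 :: "('a, 'b) ell2 \<Rightarrow> real"
  is "\<lambda>f. sqrt (\<Sum>\<^sub>\<infinity>x. (norm (f x))\<^sup>2)" .

lift_definition cinner_ell2 :: "('a, 'b) ell2 \<Rightarrow> ('a, 'b) ell2 \<Rightarrow> complex"
  is "\<lambda>f g. \<Sum>\<^sub>\<infinity>x. cinner (f x) (g x)" .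

definition sgn_ell2 :: "('a, 'b) ell2 \<Rightarrow> ('a, 'b) ell2"
  where "sgn_ell2 f = scaleR (inverse (norm f)) f"

definition dist_ell2 :: "('a, 'b) ell2 \<Rightarrow> ('a, 'b) ell2 \<Rightarrow> real"
  where "dist_ell2 f g = norm (f - g)"

definition uniformity_ell2 :: "(('a, 'b) ell2 \<times> ('a, 'b) ell2) filter"
  where "uniformity_ell2 = (INF e\<in>{0 <..}. principal {(f, g). dist f g < e})"

definition open_ell2 :: "('a, 'b) ell2 set \<Rightarrow> bool"
  where "open_ell2 U \<longleftrightarrow> (\<forall>f\<in>U. \<forall>\<^sub>F (f', g) in uniformity. f' = f \<longrightarrow> g \<in> U)"

instance
proof
  fix f g h :: "('a, 'b) ell2" and c d :: complex and r s :: real and U :: "('a, 'b) ell2 set"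
  show "f + g + h = f + (g + h)" by transfer (simp add: add.assoc)
  show "f + g = g + f" by transfer (simp add: add.commute)
  show "0 + f = f" by transfer simp
  show "- f + f = 0" by transfer simp
  show "f - g = f + - g" by (rule minus_ell2_def)
  show cr: "c *\<^sub>C (f + g) = c *\<^sub>C f + c *\<^sub>C g" for c and f g :: "('a, 'b) ell2"
    by transfer (simp add: scaleC_add_right)
  show cl: "(c + d) *\<^sub>C f = c *\<^sub>C f + d *\<^sub>C f" for c d by transfer (simp add: scaleC_add_left)
  show cc: "c *\<^sub>C (d *\<^sub>C f) = (c * d) *\<^sub>C f" for c d by transfer (simp add: scaleC_scaleC)
  show "r *\<^sub>R f = complex_of_real r *\<^sub>C f" by (rule scaleR_ell2_def)
  show "r *\<^sub>R (f + g) = r *\<^sub>R f + r *\<^sub>R g" by (simp add: scaleR_ell2_def cr)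
  show "(r + s) *\<^sub>R f = r *\<^sub>R f + s *\<^sub>R f" by (simp add: scaleR_ell2_def cl)
  show "r *\<^sub>R (s *\<^sub>R f) = (r * s) *\<^sub>R f" by (simp add: scaleR_ell2_def cc)
  show "1 *\<^sub>R f = f" unfolding scaleR_ell2_def by transfer simp
  show "sgn f = inverse (norm f) *\<^sub>R f" by (rule sgn_ell2_def)
  show "dist f g = norm (f - g)" by (rule dist_ell2_def)
  show "uniformity = (INF e\<in>{0 <..}. principal {(f :: ('a, 'b) ell2, g). dist f g < e})"
    by (rule uniformity_ell2_def)
  show "open U \<longleftrightarrow> (\<forall>f\<in>U. \<forall>\<^sub>F (f', g) in uniformity. f' = f \<longrightarrow> g \<in> U)" by (rule open_ell2_def)
  show "norm f = 0 \<longleftrightarrow> f = 0"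
  proof transfer
    fix f :: "'a \<Rightarrow> 'b"
    assume f: "(\<lambda>x. (norm (f x))\<^sup>2) summable_on UNIV"
    show "sqrt (\<Sum>\<^sub>\<infinity>x. (norm (f x))\<^sup>2) = 0 \<longleftrightarrow> f = (\<lambda>_. 0)"
    proof
      assume "sqrt (\<Sum>\<^sub>\<infinity>x. (norm (f x))\<^sup>2) = 0"
      then have "(norm (f x))\<^sup>2 = 0" for x
        using nonneg_infsum_le_0D[OF _ f, of x] by simp
      then show "f = (\<lambda>_. 0)" by auto
    qed simp
  qed
  show "norm (f + g) \<le> norm f + norm g"
    by transfer (rule ell2_boundI(2)[OF L2_set_norm_add])
  show "norm (r *\<^sub>R f) = \<bar>r\<bar> * norm f"
    unfolding scaleR_ell2_def
    by transfer (simp add: norm_scaleC power_mult_distrib infsum_cmult_right' real_sqrt_mult)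
  show "cinner (f + g) h = cinner f h + cinner g h"
    by transfer (simp add: cinner_add_left infsum_add ell2_summable_cinner)
  show "cinner (c *\<^sub>C f) g = c * cinner f g"
    by transfer (simp add: cinner_scaleC_left infsum_cmult_right')
  show "cinner f g = cnj (cinner g f)"
    by transfer (simp flip: infsum_cnj cinner_commute)
  show "cinner f f = complex_of_real ((norm f)\<^sup>2)"
  proof transfer
    fix f :: "'a \<Rightarrow> 'b"
    assume "(\<lambda>x. (norm (f x))\<^sup>2) summable_on UNIV"
    then have "((\<lambda>x. complex_of_real ((norm (f x))\<^sup>2)) has_sum
        complex_of_real (\<Sum>\<^sub>\<infinity>x. (norm (f x))\<^sup>2)) UNIV"
      by (intro has_sum_of_real has_sum_infsum)
    then show "(\<Sum>\<^sub>\<infinity>x. cinner (f x) (f x)) = complex_of_real ((sqrt (\<Sum>\<^sub>\<infinity>x. (norm (f x))\<^sup>2))\<^sup>2)"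
      unfolding cinner_self by (simp add: infsumI infsum_nonneg)
  qed
qed

end

lemma ell2_apply_add: "ell2_apply (f + g) x = ell2_apply f x + ell2_apply g x"
  by transfer simp

lemma ell2_apply_diff: "ell2_apply (f - g) x = ell2_apply f x - ell2_apply g x"
  unfolding minus_ell2_def by transfer simp

lemma ell2_apply_scaleC: "ell2_apply (c *\<^sub>C f) x = c *\<^sub>C ell2_apply f x"
  by transfer simp

lemma ell2_apply_scaleR: "ell2_apply (r *\<^sub>R f) x = r *\<^sub>R ell2_apply f x"
  by (simp add: scaleR_scaleC ell2_apply_scaleC)

lemma L2_set_le_norm_ell2:
  "finite F \<Longrightarrow> L2_set (\<lambda>x. norm (ell2_apply f x)) F \<le> norm f"
  by transfer (rule L2_set_le_infsum)

lemma norm_ell2_apply_le: "norm (ell2_apply f x) \<le> norm f"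
  using L2_set_le_norm_ell2[of "{x}" f] by (simp add: L2_set_def)

instance ell2 :: (type, complex_hilbert) complex_hilbert
proof
  fix f :: "nat \<Rightarrow> ('a, 'b) ell2"
  assume C: "Cauchy f"
  have "Cauchy (\<lambda>n. ell2_apply (f n) x)" for x
  proof (rule CauchyI)
    fix e :: real
    assume "e > 0"
    then obtain M where "\<And>m n. m \<ge> M \<Longrightarrow> n \<ge> M \<Longrightarrow> norm (f m - f n) < e"
      using CauchyD[OF C] by blast
    then show "\<exists>M. \<forall>m\<ge>M. \<forall>n\<ge>M. norm (ell2_apply (f m) x - ell2_apply (f n) x) < e"
      by (metis ell2_apply_diff norm_ell2_apply_le order.strict_trans1)
  qed
  then have "convergent (\<lambda>n. ell2_apply (f n) x)" for x
    by (rule Cauchy_convergent)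
  then obtain g where g: "\<And>x. (\<lambda>n. ell2_apply (f n) x) \<longlonglongrightarrow> g x"
    unfolding convergent_LIMSEQ_iff by (rule that)
  have key: "\<exists>M. \<forall>m\<ge>M. \<forall>F. finite F \<longrightarrow> L2_set (\<lambda>x. norm (ell2_apply (f m) x - g x)) F \<le> e"
    if e: "e > 0" for e
  proof -
    obtain M where M: "\<And>m n. m \<ge> M \<Longrightarrow> n \<ge> M \<Longrightarrow> norm (f m - f n) < e"
      using CauchyD[OF C e] by blast
    have "L2_set (\<lambda>x. norm (ell2_apply (f m) x - g x)) F \<le> e" if m: "m \<ge> M" and F: "finite F" for m F
    proof (rule tendsto_upperbound)
      show "(\<lambda>n. L2_set (\<lambda>x. norm (ell2_apply (f m) x - ell2_apply (f n) x)) F)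
          \<longlonglongrightarrow> L2_set (\<lambda>x. norm (ell2_apply (f m) x - g x)) F"
        unfolding L2_set_def by (intro tendsto_intros g)
      show "\<forall>\<^sub>F n in sequentially. L2_set (\<lambda>x. norm (ell2_apply (f m) x - ell2_apply (f n) x)) F \<le> e"
        using eventually_ge_at_top[of M]
      proof eventually_elim
        case (elim n)
        then show ?case
          using L2_set_le_norm_ell2[OF F, of "f m - f n"] M[OF m elim] by (simp add: ell2_apply_diff)
      qed
    qed simp
    then show ?thesis by blast
  qed
  obtain M where M: "\<And>F. finite F \<Longrightarrow> L2_set (\<lambda>x. norm (ell2_apply (f M) x - g x)) F \<le> 1"
    using key[of 1] by auto
  define k where "k = f M - Abs_ell2 (\<lambda>x. ell2_apply (f M) x - g x)"
  have k: "ell2_apply k = g"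
  proof
    fix x
    have "ell2_apply (Abs_ell2 (\<lambda>x. ell2_apply (f M) x - g x)) x = ell2_apply (f M) x - g x"
      by (subst Abs_ell2_inverse) (use ell2_boundI(1)[OF M] in auto)
    then show "ell2_apply k x = g x" by (simp add: k_def ell2_apply_diff)
  qed
  have "f \<longlonglongrightarrow> k"
  proof (rule LIMSEQ_I)
    fix e :: real
    assume e: "e > 0"
    then obtain N where N: "\<And>m F. m \<ge> N \<Longrightarrow> finite F \<Longrightarrow>
        L2_set (\<lambda>x. norm (ell2_apply (f m) x - g x)) F \<le> e / 2"
      using key[of "e / 2"] by auto
    have "norm (f m - k) < e" if "m \<ge> N" for m
    proof -
      have "norm (f m - k) = sqrt (\<Sum>\<^sub>\<infinity>x. (norm (ell2_apply (f m - k) x))\<^sup>2)"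
        by (rule norm_ell2.rep_eq)
      also have "\<dots> \<le> e / 2"
        by (rule ell2_boundI(2)) (use N[OF that] in \<open>simp add: ell2_apply_diff k\<close>)
      also have "\<dots> < e" using e by simp
      finally show ?thesis .
    qed
    then show "\<exists>N. \<forall>m\<ge>N. norm (f m - k) < e" by blast
  qed
  then show "convergent f" by (auto simp: convergent_def)
qed

lift_definition delta :: "'x \<Rightarrow> 'h::complex_inner \<Rightarrow> ('x, 'h) ell2"
  is "\<lambda>x \<eta> y. if y = x then \<eta> else 0"
proof -
  fix x :: 'x and \<eta> :: 'h
  show "(\<lambda>y. (norm (if y = x then \<eta> else 0))\<^sup>2) summable_on UNIV"
    by (rule finite_nonzero_values_imp_summable_on) (rule finite_subset[of _ "{x}"], auto)
qed


section \<open>Bounded operators\<close>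

definition bounded_ops :: "('a::complex_inner \<Rightarrow>\<^sub>L 'b::complex_inner) set" where
  "bounded_ops = {a. \<forall>c x. blinfun_apply a (c *\<^sub>C x) = c *\<^sub>C blinfun_apply a x}"

lift_definition op_scaleC :: "complex \<Rightarrow> ('a::complex_inner \<Rightarrow>\<^sub>L 'b::complex_inner) \<Rightarrow> ('a \<Rightarrow>\<^sub>L 'b)"
  is "\<lambda>c a x. c *\<^sub>C a x"
proof -
  fix c :: complex and a :: "'a \<Rightarrow> 'b"
  assume "bounded_linear a"
  then interpret bounded_linear a .
  obtain K where K: "\<And>x. norm (a x) \<le> norm x * K" using bounded by blast
  show "bounded_linear (\<lambda>x. c *\<^sub>C a x)"
  proof (rule bounded_linear_intro[where K = "cmod c * K"])
    show "norm (c *\<^sub>C a x) \<le> norm x * (cmod c * K)" for x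
      using mult_left_mono[OF K, of "cmod c" x] by (simp add: norm_scaleC mult_ac)
    show "c *\<^sub>C a (r *\<^sub>R x) = r *\<^sub>R (c *\<^sub>C a x)" for r x
      unfolding scaleR by (simp add: scaleR_scaleC mult.commute)
  qed (simp add: add scaleC_add_right)
qed

text \<open>
  The description determines the adjoint of a complex linear operator, by Riesz representation;
  \<open>adj\<close> is only meaningful on \<^const>\<open>bounded_ops\<close>.
\<close>

definition adj :: "('a::complex_hilbert \<Rightarrow>\<^sub>L 'b::complex_hilbert) \<Rightarrow> ('b \<Rightarrow>\<^sub>L 'a)" where
  "adj a = (THE b. \<forall>x y. cinner (blinfun_apply a x) y = cinner x (blinfun_apply b y))"

definition unitary :: "('a::complex_hilbert \<Rightarrow>\<^sub>L 'a) \<Rightarrow> bool" where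
  "unitary v \<longleftrightarrow> v \<in> bounded_ops \<and> adj v o\<^sub>L v = id_blinfun \<and> v o\<^sub>L adj v = id_blinfun"

definition Ad :: "('a::complex_hilbert \<Rightarrow>\<^sub>L 'a) \<Rightarrow> ('a \<Rightarrow>\<^sub>L 'a) \<Rightarrow> ('a \<Rightarrow>\<^sub>L 'a)" where
  "Ad v a = v o\<^sub>L a o\<^sub>L adj v"

definition compact_operator :: "('a::complex_inner \<Rightarrow>\<^sub>L 'b::complex_inner) \<Rightarrow> bool" where
  "compact_operator a \<longleftrightarrow> compact (closure (blinfun_apply a ` cball 0 1))"

definition star_isomorphism ::
  "(('a::complex_hilbert \<Rightarrow>\<^sub>L 'a) \<Rightarrow> ('b::complex_hilbert \<Rightarrow>\<^sub>L 'b))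
    \<Rightarrow> ('a \<Rightarrow>\<^sub>L 'a) set \<Rightarrow> ('b \<Rightarrow>\<^sub>L 'b) set \<Rightarrow> bool" where
  "star_isomorphism \<Phi> A B \<longleftrightarrow>
     bij_betw \<Phi> A B \<and>
     (\<forall>a\<in>A. \<forall>b\<in>A. \<Phi> (a + b) = \<Phi> a + \<Phi> b \<and> \<Phi> (a o\<^sub>L b) = \<Phi> a o\<^sub>L \<Phi> b) \<and>
     (\<forall>c. \<forall>a\<in>A. \<Phi> (op_scaleC c a) = op_scaleC c (\<Phi> a)) \<and>
     (\<forall>a\<in>A. \<Phi> (adj a) = adj (\<Phi> a))"


section \<open>Roe algebras\<close>

definition uniformly_locally_finite :: "'x::metric_space itself \<Rightarrow> bool" where
  "uniformly_locally_finite _ \<longleftrightarrow>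
     (\<forall>r>0. \<exists>N. \<forall>x::'x. finite (cball x r) \<and> card (cball x r) \<le> N)"

definition entry :: "(('x, 'h::complex_hilbert) ell2 \<Rightarrow>\<^sub>L ('x, 'h) ell2) \<Rightarrow> 'x \<Rightarrow> 'x \<Rightarrow> ('h \<Rightarrow>\<^sub>L 'h)" where
  "entry a x y =
     (THE b. \<forall>\<xi> \<eta>. cinner (blinfun_apply b \<xi>) \<eta> = cinner (blinfun_apply a (delta x \<xi>)) (delta y \<eta>))"

lemma cinner_eqI:
  fixes x y :: "'a::complex_inner"
  assumes "\<And>z. cinner x z = cinner y z"
  shows "x = y"
proof -
  have "cinner (x - y) (x - y) = 0" using assms by (simp add: cinner_diff_left)
  then show ?thesis by (simp add: cinner_self)
qed

lemma cinner_delta_right: "cinner f (delta y \<eta>) = cinner (ell2_apply f y) \<eta>"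
proof transfer
  fix f :: "'a \<Rightarrow> 'b" and y and \<eta> :: 'b
  have "(\<Sum>\<^sub>\<infinity>x. cinner (f x) (if x = y then \<eta> else 0)) = (\<Sum>\<^sub>\<infinity>x\<in>{y}. cinner (f x) \<eta>)"
    by (rule infsum_cong_neutral) auto
  then show "(\<Sum>\<^sub>\<infinity>x. cinner (f x) (if x = y then \<eta> else 0)) = cinner (f y) \<eta>" by simp
qed

lemma norm_delta: "norm (delta x \<eta>) = norm \<eta>"
proof -
  have "complex_of_real ((norm (delta x \<eta>))\<^sup>2) = complex_of_real ((norm \<eta>)\<^sup>2)"
    unfolding cinner_self[symmetric] cinner_delta_right by transfer simp
  then have "(norm (delta x \<eta>))\<^sup>2 = (norm \<eta>)\<^sup>2" using of_real_eq_iff by blast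
  then show ?thesis by (simp add: power2_eq_iff_nonneg)
qed

lemma delta_add: "delta x (\<xi> + \<eta>) = delta x \<xi> + delta x \<eta>"
  by transfer auto

lemma delta_scaleC: "delta x (c *\<^sub>C \<xi>) = c *\<^sub>C delta x \<xi>"
  by transfer auto

lemma blinfun_apply_entry: "blinfun_apply (entry a x y) \<xi> = ell2_apply (a (delta x \<xi>)) y"
proof -
  let ?b = "\<lambda>\<xi>. ell2_apply (a (delta x \<xi>)) y"
  have "bounded_linear ?b"
  proof (rule bounded_linear_intro[where K = "norm a"])
    show "norm (?b \<xi>) \<le> norm \<xi> * norm a" for \<xi>
      using norm_ell2_apply_le[of "a (delta x \<xi>)" y] norm_blinfun[of a "delta x \<xi>"]
      by (simp add: norm_delta mult.commute)
    show "?b (\<xi> + \<eta>) = ?b \<xi> + ?b \<eta>" for \<xi> \<eta>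
      by (simp add: delta_add blinfun.add_right ell2_apply_add)
    show "?b (r *\<^sub>R \<xi>) = r *\<^sub>R ?b \<xi>" for r \<xi>
      by (simp add: scaleR_scaleC[of r \<xi>] delta_scaleC blinfun.scaleR_right ell2_apply_scaleR
          flip: scaleR_scaleC[of r "delta x \<xi>"])
  qed
  then have b: "blinfun_apply (Blinfun ?b) = ?b" by (rule bounded_linear_Blinfun_apply)
  have "entry a x y = Blinfun ?b"
    unfolding entry_def
  proof (rule the_equality)
    show "\<forall>\<xi> \<eta>. cinner (blinfun_apply (Blinfun ?b) \<xi>) \<eta> = cinner (a (delta x \<xi>)) (delta y \<eta>)"
      by (simp add: b cinner_delta_right)
    show "b' = Blinfun ?b"
      if "\<forall>\<xi> \<eta>. cinner (blinfun_apply b' \<xi>) \<eta> = cinner (a (delta x \<xi>)) (delta y \<eta>)" for b'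
      by (rule blinfun_eqI, rule cinner_eqI) (simp add: that b cinner_delta_right)
  qed
  then show ?thesis by (simp add: b)
qed

text \<open>
  Suprema of distances are taken in \<^typ>\<open>ennreal\<close>; in particular the supremum over the empty set
  is 0, so the zero operator has propagation 0.
\<close>

definition propagation ::
  "(('x::metric_space, 'h::complex_hilbert) ell2 \<Rightarrow>\<^sub>L ('x, 'h) ell2) \<Rightarrow> ennreal" where
  "propagation a = (SUP (x, y) \<in> {(x, y). entry a x y \<noteq> 0}. ennreal (dist x y))"

definition ediam :: "'x::metric_space set \<Rightarrow> ennreal" where
  "ediam S = (SUP (x, y) \<in> S \<times> S. ennreal (dist x y))"

definition band_dominated ::
  "(('x::metric_space, 'h::complex_hilbert) ell2 \<Rightarrow>\<^sub>L ('x, 'h) ell2) set" where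
  "band_dominated = closure {a \<in> bounded_ops. propagation a < \<infinity>}"

definition roe_algebra ::
  "(('x::metric_space, 'h::complex_hilbert) ell2 \<Rightarrow>\<^sub>L ('x, 'h) ell2) set" where
  "roe_algebra = {a \<in> band_dominated. \<forall>x y. compact_operator (entry a x y)}"

definition strongly_coarse_like ::
  "((('x::metric_space, 'h::complex_hilbert) ell2 \<Rightarrow>\<^sub>L ('x, 'h) ell2)
    \<Rightarrow> (('y::metric_space, 'h) ell2 \<Rightarrow>\<^sub>L ('y, 'h) ell2)) \<Rightarrow> bool" where
  "strongly_coarse_like \<Phi> \<longleftrightarrow>
     (\<forall>r>0. \<exists>s>0. \<forall>a\<in>roe_algebra. propagation a \<le> ennreal r \<longrightarrow> propagation (\<Phi> a) \<le> ennreal s)"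

definition ell_infty ::
  "(nat \<Rightarrow> 'h::complex_hilbert) \<Rightarrow> (('x::metric_space, 'h) ell2 \<Rightarrow>\<^sub>L ('x, 'h) ell2) set" where
  "ell_infty \<xi> =
     {a \<in> bounded_ops. \<forall>x. \<exists>l::nat \<Rightarrow> complex. l \<longlonglongrightarrow> 0 \<and>
        (\<forall>n. a (delta x (\<xi> n)) = l n *\<^sub>C delta x (\<xi> n))}"

text \<open>
  For uniformly locally finite spaces, Yu's property A is equivalent to the operator norm
  localisation property, which is taken as its definition here. The operators act on
  \<open>('y, 'h) ell2\<close>, whence the second type argument.
\<close>

definition property_A :: "'y::metric_space itself \<Rightarrow> 'h::complex_hilbert itself \<Rightarrow> bool" where
  "property_A _ _ \<longleftrightarrow>
     (\<forall>s>0. \<forall>\<rho>. 0 < \<rho> \<and> \<rho> < 1 \<longrightarrow>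
       (\<exists>r>0. \<forall>a \<in> (bounded_ops :: (('y, 'h) ell2 \<Rightarrow>\<^sub>L ('y, 'h) ell2) set).
          propagation a \<le> ennreal s \<longrightarrow>
            (\<exists>\<xi>. norm \<xi> = 1 \<and> ediam {x. ell2_apply \<xi> x \<noteq> 0} \<le> ennreal r \<and>
                 norm (a \<xi>) \<ge> \<rho> * norm a)))"

end

theory Submission
  imports Defs
begin

text \<open>
  The isomorphism \<open>\<Phi>\<close> is conjugation by a unitary \<open>u\<close> between the two Hilbert spaces, because it preserves
  rank-one projections (\<open>star_isomorphism_spatial\<close>). Multipliers of the Roe algebra are band-dominated
  (\<open>multiplier_band_dominated\<close>), so conjugation by \<open>u\<close> and by \<open>u\<^sup>*\<close> also preserves the band-dominated
  operators, among them the projections \<open>\<chi>\<^sub>x\<close> onto the fibre over a point. By a Baire category argument it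
  does so uniformly: for all \<open>r\<close> and \<open>e\<close>, the conjugates of all contractions of propagation at most \<open>r\<close> are
  within \<open>e\<close> of operators of one common propagation (\<open>equi_approximable_conjugate\<close>). The rest of the proof
  rests on this uniformity.

  The points \<open>x\<close> and \<open>y\<close> overlap if \<open>\<chi>\<^sub>y u \<chi>\<^sub>x\<close> has norm at least \<open>\<delta>\<close>. Uniformity for rank-one operators between
  nearby fibres shows that overlapping is a coarse relation in both directions (\<open>overlap_coarse\<close>), and that
  \<open>u\<close> maps the whole fibre over \<open>x\<close>, up to a small error, into a ball about \<open>y\<close> whose radius does not depend
  on \<open>x\<close> (\<open>overlap_concentrated\<close>). Uniformity for the projections \<open>\<chi>\<^sub>x\<close> and operator norm localisation on \<open>Y\<close> show
  that each \<open>x\<close> overlaps with some \<open>y\<close> once \<open>\<delta>\<close> is small (\<open>overlap_total\<close>). Hence \<open>X\<close> embeds coarsely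
  into \<open>Y\<close>, inherits operator norm localisation (\<open>property_A_coarse_embedding\<close>), and by symmetry each \<open>y\<close>
  overlaps with some \<open>x\<close>.

  By the Cantor-Bernstein theorem there is a bijection of \<open>X \<times> \<nat>\<close> with \<open>Y \<times> \<nat>\<close> that relates overlapping points only.
  Let \<open>w\<close> be the unitary that permutes the given bases accordingly, and \<open>v = w u\<^sup>*\<close>. Then \<open>Ad v \<circ> \<Phi>\<close> is
  conjugation by \<open>w\<close>, which moves supports along a coarse relation and diagonal operators to diagonal operators.

  It remains to see that \<open>v\<close> is band-dominated (\<open>correspondence_unitary_band_dominated\<close>). Given \<open>e\<close>, let
  \<open>B\<^sub>x\<close> be the ball in which the image under \<open>u\<close> of the fibre over \<open>x\<close> is concentrated up to \<open>e\<close>. The points of \<open>X\<close>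
  can be coloured with finitely many colours such that the sets \<open>B\<^sub>x\<close> are disjoint within each colour. For a
  colour \<open>i\<close>, let \<open>A\<^sub>i\<close> be the sum of the operators \<open>\<chi>\<^sub>x u\<^sup>* \<chi>\<^bsub>B x\<^esub>\<close> over the points of this
  colour. The operator \<open>u A\<^sub>i\<close> is an average over signs of products \<open>(u \<lambda> u\<^sup>*) \<mu>\<close> with diagonal \<open>\<lambda>\<close> and \<open>\<mu>\<close>, hence
  band-dominated by uniformity, while \<open>w A\<^sub>i\<close> has finite propagation. The sum of the \<open>A\<^sub>i A\<^sub>i\<^sup>*\<close> is within \<open>e\<close> of the
  identity, so \<open>v\<close> is within \<open>e\<close> of the sum of the band-dominated operators \<open>(w A\<^sub>i) (u A\<^sub>i)\<^sup>*\<close>.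
\<close>

section \<open>Bounded operators on complex Hilbert spaces\<close>

lemma cinner_diff_right: "cinner x (y - z) = cinner x y - cinner x (z::'a::complex_inner)"
  using cinner_add_right[of x "y - z" z] by simp

lemma bounded_bilinear_cinner:
  "bounded_bilinear (cinner :: 'a::complex_inner \<Rightarrow> 'a \<Rightarrow> complex)"
proof
  show "\<exists>K. \<forall>x y::'a. norm (cinner x y) \<le> norm x * norm y * K"
    using Cauchy_Schwarz_complex by (intro exI[of _ 1]) auto
  show "cinner (r *\<^sub>R x) y = r *\<^sub>R cinner x y" for r and x y :: 'a
    unfolding scaleR_scaleC[of r x] cinner_scaleC_left by (simp add: scaleR_conv_of_real)
  show "cinner x (r *\<^sub>R y) = r *\<^sub>R cinner x y" for r and x y :: 'a
    unfolding scaleR_scaleC[of r y] cinner_scaleC_right by (simp add: scaleR_conv_of_real)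
qed (simp_all add: cinner_add_left cinner_add_right)

lemmas cinner_sum_left = bounded_bilinear.sum_left[OF bounded_bilinear_cinner]
  and cinner_sum_right = bounded_bilinear.sum_right[OF bounded_bilinear_cinner]
  and tendsto_cinner [tendsto_intros] = bounded_bilinear.tendsto[OF bounded_bilinear_cinner]

lemma norm_sq_cinner: "(norm x)\<^sup>2 = Re (cinner x (x::'a::complex_inner))"
  by (simp add: cinner_self)

lemma norm_pythagoras:
  fixes x y :: "'a::complex_inner"
  assumes "cinner x y = 0"
  shows "(norm (x + y))\<^sup>2 = (norm x)\<^sup>2 + (norm y)\<^sup>2"
  using assms cinner_commute[of y x]
  by (simp add: norm_sq_cinner cinner_add_left cinner_add_right)

lemma norm_parallelogram:
  fixes x y :: "'a::complex_inner"
  shows "(norm (x + y))\<^sup>2 + (norm (x - y))\<^sup>2 = 2 * (norm x)\<^sup>2 + 2 * (norm y)\<^sup>2"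
  by (simp add: norm_sq_cinner cinner_add_left cinner_add_right cinner_diff_left cinner_diff_right)

lemma norm_leI_cinner:
  fixes x :: "'a::complex_inner"
  assumes "\<And>y. cmod (cinner x y) \<le> K * norm y" "K \<ge> 0"
  shows "norm x \<le> K"
proof (cases "x = 0")
  case False
  have "norm x * norm x \<le> K * norm x"
    using assms(1)[of x] by (simp add: cinner_self power2_eq_square norm_mult)
  then show ?thesis using False by simp
qed (use assms in simp)

text \<open>Riesz representation: the representing vector is a multiple of the point of minimal norm in
  the affine hyperplane where the functional is 1.\<close>

lemma riesz_representation:
  fixes \<phi> :: "'a::complex_hilbert \<Rightarrow> complex"
  assumes add: "\<And>x y. \<phi> (x + y) = \<phi> x + \<phi> y" and scale: "\<And>c x. \<phi> (c *\<^sub>C x) = c * \<phi> x"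
    and bound: "\<And>x. cmod (\<phi> x) \<le> K * norm x"
  shows "\<exists>z. \<forall>x. \<phi> x = cinner x z"
proof (cases "\<forall>x. \<phi> x = 0")
  case True
  then show ?thesis by (intro exI[of _ 0]) simp
next
  case False
  then obtain x1 where x1: "\<phi> x1 \<noteq> 0" by blast
  have diff: "\<phi> (x - y) = \<phi> x - \<phi> y" for x y
    using add[of "x - y" y] by simp
  define S where "S = {x. \<phi> x = 1}"
  define d where "d = Inf (norm ` S)"
  have "(1 / \<phi> x1) *\<^sub>C x1 \<in> S" using x1 by (simp add: S_def scale)
  then have ne: "S \<noteq> {}" by blast
  have d_le: "d \<le> norm x" if "x \<in> S" for x
    unfolding d_def by (rule cINF_lower) (use that in \<open>auto intro!: bdd_belowI[of _ 0]\<close>)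
  have d0: "d \<ge> 0" unfolding d_def using ne by (intro cINF_greatest) auto
  have "\<exists>x\<in>S. norm x < d + inverse (real (Suc n))" for n
  proof -
    have "Inf (norm ` S) < d + inverse (real (Suc n))" by (simp add: d_def)
    then show ?thesis using cInf_lessD[of "norm ` S"] ne by blast
  qed
  then obtain X where X: "\<And>n. X n \<in> S" "\<And>n. norm (X n) < d + inverse (real (Suc n))" by metis
  have normX: "(\<lambda>n. norm (X n)) \<longlonglongrightarrow> d"
  proof (rule tendsto_sandwich[of "\<lambda>_. d"])
    show "(\<lambda>n. d + inverse (real (Suc n))) \<longlonglongrightarrow> d" by (rule LIMSEQ_inverse_real_of_nat_add)
  qed (use X(1) less_imp_le[OF X(2)] d_le in \<open>auto intro!: always_eventually simp del: of_nat_Suc\<close>)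
  have mid: "(norm (x - y))\<^sup>2 \<le> 2 * (norm x)\<^sup>2 + 2 * (norm y)\<^sup>2 - 4 * d\<^sup>2" if "x \<in> S" "y \<in> S" for x y
  proof -
    have "(1/2) *\<^sub>C (x + y) \<in> S" using that by (simp add: S_def scale add)
    from d_le[OF this] have "2 * d \<le> norm (x + y)" by (simp add: norm_scaleC)
    then have "(2 * d)\<^sup>2 \<le> (norm (x + y))\<^sup>2" using d0 by (intro power_mono) auto
    then show ?thesis using norm_parallelogram[of x y] by (simp add: power_mult_distrib)
  qed
  have "Cauchy X"
  proof (rule CauchyI)
    fix e :: real assume e: "e > 0"
    have "(\<lambda>n. (norm (X n))\<^sup>2) \<longlonglongrightarrow> d\<^sup>2" by (intro tendsto_intros normX)
    moreover have "d\<^sup>2 < d\<^sup>2 + e\<^sup>2 / 4" using e by simp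
    ultimately have "\<forall>\<^sub>F n in sequentially. (norm (X n))\<^sup>2 < d\<^sup>2 + e\<^sup>2 / 4"
      by (rule order_tendstoD(2))
    then obtain N where N: "\<And>n. n \<ge> N \<Longrightarrow> (norm (X n))\<^sup>2 < d\<^sup>2 + e\<^sup>2 / 4"
      unfolding eventually_sequentially by blast
    have "norm (X m - X n) < e" if "m \<ge> N" "n \<ge> N" for m n
    proof (rule power2_less_imp_less)
      show "(norm (X m - X n))\<^sup>2 < e\<^sup>2"
        using mid[OF X(1)[of m] X(1)[of n]] N[OF that(1)] N[OF that(2)] by simp
    qed (use e in simp)
    then show "\<exists>M. \<forall>m\<ge>M. \<forall>n\<ge>M. norm (X m - X n) < e" by blast
  qed
  then obtain x0 where lim: "X \<longlonglongrightarrow> x0"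
    using Cauchy_convergent convergent_def by blast
  have "(\<lambda>n. \<phi> (X n)) \<longlonglongrightarrow> \<phi> x0"
  proof (rule Lim_null_comparison[THEN LIM_zero_cancel])
    show "\<forall>\<^sub>F n in sequentially. norm (\<phi> (X n) - \<phi> x0) \<le> K * norm (X n - x0)"
      using bound by (simp flip: diff)
    have "(\<lambda>n. K * norm (X n - x0)) \<longlonglongrightarrow> K * norm (x0 - x0)" by (intro tendsto_intros lim)
    then show "(\<lambda>n. K * norm (X n - x0)) \<longlonglongrightarrow> 0" by simp
  qed
  moreover have "(\<lambda>n. \<phi> (X n)) \<longlonglongrightarrow> 1" using X(1) by (simp add: S_def)
  ultimately have x0: "\<phi> x0 = 1" using LIMSEQ_unique by blast
  have normx0: "norm x0 = d"
    using LIMSEQ_unique[OF tendsto_norm[OF lim] normX] .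
  have orth: "cinner y x0 = 0" if y: "\<phi> y = 0" for y
  proof (cases "y = 0")
    case False
    define c where "c = cinner x0 y / complex_of_real ((norm y)\<^sup>2)"
    define z where "z = x0 - c *\<^sub>C y"
    have "cinner z (c *\<^sub>C y) = 0"
      using False by (simp add: z_def cinner_diff_left cinner_scaleC_left cinner_scaleC_right cinner_self c_def)
    from norm_pythagoras[OF this]
    have "(norm x0)\<^sup>2 = (norm z)\<^sup>2 + (norm (c *\<^sub>C y))\<^sup>2" by (simp add: z_def)
    moreover have "z \<in> S" by (simp add: S_def z_def diff scale y x0)
    then have "d\<^sup>2 \<le> (norm z)\<^sup>2" by (intro power_mono d_le d0)
    ultimately have "norm (c *\<^sub>C y) = 0" using normx0 by simp
    then have "cinner x0 y = 0" using False by (simp add: c_def)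
    then show ?thesis using cinner_commute[of y x0] by simp
  qed simp
  have "x0 \<noteq> 0" using x0 scale[of 0 x0] by auto
  then have n0: "norm x0 \<noteq> 0" by simp
  define w where "w = complex_of_real (1 / (norm x0)\<^sup>2) *\<^sub>C x0"
  have "\<phi> x = cinner x w" for x
  proof -
    have "\<phi> (x - \<phi> x *\<^sub>C x0) = 0" by (simp add: diff scale x0)
    from orth[OF this] have "cinner x x0 = \<phi> x * complex_of_real ((norm x0)\<^sup>2)"
      by (simp add: cinner_diff_left cinner_scaleC_left cinner_self)
    then show ?thesis using n0 by (simp add: w_def cinner_scaleC_right)
  qed
  then show ?thesis by blast
qed

lemma bounded_opsI: "(\<And>c x. blinfun_apply a (c *\<^sub>C x) = c *\<^sub>C a x) \<Longrightarrow> a \<in> bounded_ops"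
  by (simp add: bounded_ops_def)

lemma bounded_ops_scaleC: "a \<in> bounded_ops \<Longrightarrow> blinfun_apply a (c *\<^sub>C x) = c *\<^sub>C a x"
  by (simp add: bounded_ops_def)

lemma bounded_ops_zero [simp]: "0 \<in> bounded_ops"
  by (simp add: bounded_ops_def)

lemma bounded_ops_id [simp]: "id_blinfun \<in> bounded_ops"
  by (simp add: bounded_ops_def)

lemma bounded_ops_add [simp]: "a \<in> bounded_ops \<Longrightarrow> b \<in> bounded_ops \<Longrightarrow> a + b \<in> bounded_ops"
  by (simp add: bounded_ops_def blinfun.add_left scaleC_add_right)

lemma bounded_ops_diff [simp]: "a \<in> bounded_ops \<Longrightarrow> b \<in> bounded_ops \<Longrightarrow> a - b \<in> bounded_ops"
  by (simp add: bounded_ops_def blinfun.diff_left complex_vector.scale_right_diff_distrib)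

lemma bounded_ops_sum [simp]: "(\<And>i. i \<in> I \<Longrightarrow> a i \<in> bounded_ops) \<Longrightarrow> sum a I \<in> bounded_ops"
  by (induction I rule: infinite_finite_induct) auto

lemma bounded_ops_compose [simp]: "a \<in> bounded_ops \<Longrightarrow> b \<in> bounded_ops \<Longrightarrow> a o\<^sub>L b \<in> bounded_ops"
  by (simp add: bounded_ops_def)

lemma op_scaleC_apply [simp]: "blinfun_apply (op_scaleC c a) x = c *\<^sub>C a x"
  by (simp add: op_scaleC.rep_eq)

lemma bounded_ops_op_scaleC [simp]: "a \<in> bounded_ops \<Longrightarrow> op_scaleC c a \<in> bounded_ops"
  by (simp add: bounded_ops_def mult.commute)

lemma bounded_ops_scaleR [simp]: "a \<in> bounded_ops \<Longrightarrow> r *\<^sub>R a \<in> bounded_ops"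
  by (simp add: bounded_ops_def blinfun.scaleR_left scaleR_scaleC mult.commute)

lemma norm_op_scaleC_le: "norm (op_scaleC c a) \<le> cmod c * norm a"
proof (rule norm_blinfun_bound)
  show "norm (blinfun_apply (op_scaleC c a) x) \<le> cmod c * norm a * norm x" for x
    using mult_left_mono[OF norm_blinfun[of a x], of "cmod c"] by (simp add: norm_scaleC mult_ac)
qed simp

lemma bounded_linear_scaleC: "bounded_linear (\<lambda>x::'a::complex_inner. c *\<^sub>C x)"
  by (rule bounded_linear_intro[where K = "cmod c"])
    (simp_all add: scaleC_add_right scaleR_scaleC mult.commute norm_scaleC)

lemma closed_bounded_ops: "closed (bounded_ops :: ('a::complex_inner \<Rightarrow>\<^sub>L 'b::complex_inner) set)"
proof -
  have "closed {a :: 'a \<Rightarrow>\<^sub>L 'b. blinfun_apply a (c *\<^sub>C x) = c *\<^sub>C blinfun_apply a x}" for c x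
    by (intro closed_Collect_eq continuous_intros
        bounded_linear.continuous_on[OF bounded_linear_scaleC])
  then have "closed (\<Inter>c. \<Inter>x. {a :: 'a \<Rightarrow>\<^sub>L 'b. blinfun_apply a (c *\<^sub>C x) = c *\<^sub>C blinfun_apply a x})"
    by (intro closed_INT ballI)
  moreover have "(\<Inter>c. \<Inter>x. {a :: 'a \<Rightarrow>\<^sub>L 'b. blinfun_apply a (c *\<^sub>C x) = c *\<^sub>C blinfun_apply a x}) = bounded_ops"
    by (auto simp: bounded_ops_def)
  ultimately show ?thesis by simp
qed

lemma op_eqI_cinner:
  assumes "\<And>x y. cinner (blinfun_apply a x) y = cinner (blinfun_apply b x) y"
  shows "a = b"
  by (rule blinfun_eqI, rule cinner_eqI, rule assms)

lemma adj_eqI: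
  assumes "\<And>x y. cinner (blinfun_apply a x) y = cinner x (blinfun_apply b y)"
  shows "adj a = b"
  unfolding adj_def
proof (rule the_equality)
  fix b' assume b': "\<forall>x y. cinner (blinfun_apply a x) y = cinner x (blinfun_apply b' y)"
  show "b' = b"
  proof (rule op_eqI_cinner)
    show "cinner (blinfun_apply b' x) y = cinner (blinfun_apply b x) y" for x y
    proof -
      have "cinner y (b' x) = cinner y (b x)" using b' assms by simp
      then show ?thesis by (subst (1 2) cinner_commute) simp
    qed
  qed
qed (intro allI assms)

lemma sesquilinear_op_exists:
  fixes B :: "'a::complex_hilbert \<Rightarrow> 'b::complex_hilbert \<Rightarrow> complex"
  assumes "\<And>x x' y. B (x + x') y = B x y + B x' y" "\<And>c x y. B (c *\<^sub>C x) y = c * B x y"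
    and "\<And>x y y'. B x (y + y') = B x y + B x y'" "\<And>c x y. B x (c *\<^sub>C y) = cnj c * B x y"
    and bound: "\<And>x y. cmod (B x y) \<le> K * norm x * norm y" and K: "K \<ge> 0"
  shows "\<exists>a\<in>bounded_ops. \<forall>x y. cinner (blinfun_apply a x) y = B x y"
proof -
  have "\<exists>z. \<forall>y. cnj (B x y) = cinner y z" for x
    by (rule riesz_representation[where K = "K * norm x"]) (use assms in \<open>simp_all\<close>)
  then obtain f where "\<And>x y. cnj (B x y) = cinner y (f x)" by metis
  then have f: "cinner (f x) y = B x y" for x y
    by (metis cinner_commute complex_cnj_cnj)
  have nf: "norm (f x) \<le> norm x * K" for x
    by (rule norm_leI_cinner) (use bound[of x] K in \<open>simp_all add: f mult_ac\<close>)
  have sc: "f (c *\<^sub>C x) = c *\<^sub>C f x" for c x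
    by (rule cinner_eqI) (simp add: f assms cinner_scaleC_left)
  have "bounded_linear f"
  proof (rule bounded_linear_intro)
    show "f (x + y) = f x + f y" for x y
      by (rule cinner_eqI) (simp add: f assms cinner_add_left)
    show "f (r *\<^sub>R x) = r *\<^sub>R f x" for r x by (simp add: scaleR_scaleC sc)
  qed (rule nf)
  then have "blinfun_apply (Blinfun f) = f" by (rule bounded_linear_Blinfun_apply)
  then show ?thesis using f sc by (intro bexI[of _ "Blinfun f"]) (auto intro: bounded_opsI)
qed

lemma cinner_adj_right:
  fixes a :: "'a::complex_hilbert \<Rightarrow>\<^sub>L 'b::complex_hilbert"
  assumes "a \<in> bounded_ops"
  shows "cinner x (adj a y) = cinner (a x) y"
proof -
  have "\<exists>b\<in>bounded_ops. \<forall>y x. cinner (blinfun_apply b y) x = cinner y (a x)"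
  proof (rule sesquilinear_op_exists[where K = "norm a"])
    show "cmod (cinner y (blinfun_apply a x)) \<le> norm a * norm y * norm x" for x y
      using Cauchy_Schwarz_complex[of y "a x"] mult_left_mono[OF norm_blinfun[of a x], of "norm y"]
      by (simp add: mult_ac)
  qed (simp_all add: cinner_add_left cinner_add_right blinfun.add_right bounded_ops_scaleC[OF assms]
      cinner_scaleC_left cinner_scaleC_right)
  then obtain b where "\<forall>y x. cinner (blinfun_apply b y) x = cinner y (a x)" by blast
  then have b: "cinner (blinfun_apply a x) y = cinner x (blinfun_apply b y)" for x y
    using cinner_commute[of "a x" y] cinner_commute[of x "b y"] by simp
  then have "adj a = b" by (rule adj_eqI)
  then show ?thesis using b by simp
qed

lemma cinner_adj_left: "a \<in> bounded_ops \<Longrightarrow> cinner (adj a y) x = cinner y (a x)"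
  by (subst (1 2) cinner_commute) (simp only: cinner_adj_right)

lemma bounded_ops_adj [simp]: "a \<in> bounded_ops \<Longrightarrow> adj a \<in> bounded_ops"
  by (rule bounded_opsI, rule cinner_eqI) (simp add: cinner_adj_left cinner_scaleC_left)

lemma adj_adj [simp]: "a \<in> bounded_ops \<Longrightarrow> adj (adj a) = a"
  by (rule adj_eqI) (rule cinner_adj_left)

lemma adj_compose: "a \<in> bounded_ops \<Longrightarrow> b \<in> bounded_ops \<Longrightarrow> adj (a o\<^sub>L b) = adj b o\<^sub>L adj a"
  by (rule adj_eqI) (simp add: cinner_adj_right)

lemma adj_diff: "a \<in> bounded_ops \<Longrightarrow> b \<in> bounded_ops \<Longrightarrow> adj (a - b) = adj a - adj b"
  by (rule adj_eqI) (simp add: cinner_adj_right blinfun.diff_left cinner_diff_left cinner_diff_right)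

lemma norm_leI_op:
  fixes a :: "'a::complex_inner \<Rightarrow>\<^sub>L 'b::complex_inner"
  assumes "\<And>x y. cmod (cinner (a x) y) \<le> K * norm x * norm y" "K \<ge> 0"
  shows "norm a \<le> K"
  by (rule norm_blinfun_bound[OF assms(2)], rule norm_leI_cinner[OF assms(1)]) (use assms(2) in simp)

lemma cmod_cinner_op_le: "cmod (cinner (blinfun_apply a x) y) \<le> norm a * norm x * norm y"
  using Cauchy_Schwarz_complex[of "a x" y] mult_right_mono[OF norm_blinfun[of a x], of "norm y"]
  by simp

lemma norm_adj [simp]:
  assumes "a \<in> bounded_ops"
  shows "norm (adj a) = norm a"
proof -
  have le: "norm (adj b) \<le> norm b" if "b \<in> bounded_ops" for b :: "'c::complex_hilbert \<Rightarrow>\<^sub>L 'd::complex_hilbert"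
  proof (rule norm_leI_op)
    show "cmod (cinner (adj b x) y) \<le> norm b * norm x * norm y" for x y
      unfolding cinner_adj_left[OF that] cinner_commute[of x "b y"]
      using cmod_cinner_op_le[of b y x] by (simp add: mult_ac)
  qed simp
  show ?thesis using le[OF assms] le[of "adj a"] assms by simp
qed

lift_definition rank_one :: "'b::complex_inner \<Rightarrow> 'a::complex_inner \<Rightarrow> ('a \<Rightarrow>\<^sub>L 'b)"
  is "\<lambda>\<omega> \<eta> x. cinner x \<eta> *\<^sub>C \<omega>"
proof -
  fix \<omega> :: 'b and \<eta> :: 'a
  show "bounded_linear (\<lambda>x. cinner x \<eta> *\<^sub>C \<omega>)"
  proof (rule bounded_linear_intro[where K = "norm \<omega> * norm \<eta>"])
    show "norm (cinner x \<eta> *\<^sub>C \<omega>) \<le> norm x * (norm \<omega> * norm \<eta>)" for x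
      using mult_right_mono[OF Cauchy_Schwarz_complex[of x \<eta>], of "norm \<omega>"]
      by (simp add: norm_scaleC mult_ac)
  qed (simp_all add: cinner_add_left scaleC_add_left scaleR_scaleC cinner_scaleC_left)
qed

lemma rank_one_apply [simp]: "blinfun_apply (rank_one \<omega> \<eta>) x = cinner x \<eta> *\<^sub>C \<omega>"
  by (simp add: rank_one.rep_eq)

lemma norm_rank_one_le: "norm (rank_one \<omega> \<eta>) \<le> norm \<omega> * norm \<eta>"
proof (rule norm_blinfun_bound)
  show "norm (blinfun_apply (rank_one \<omega> \<eta>) x) \<le> norm \<omega> * norm \<eta> * norm x" for x
    using mult_right_mono[OF Cauchy_Schwarz_complex[of x \<eta>], of "norm \<omega>"]
    by (simp add: norm_scaleC mult_ac)
qed simp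

lemma bounded_ops_rank_one [simp]: "rank_one \<omega> \<eta> \<in> bounded_ops"
  by (rule bounded_opsI) (simp add: cinner_scaleC_left)

lemma adj_rank_one [simp]: "adj (rank_one \<omega> \<eta>) = rank_one \<eta> \<omega>"
proof (rule adj_eqI)
  show "cinner (rank_one \<omega> \<eta> x) y = cinner x (rank_one \<eta> \<omega> y)" for x y
    using cinner_commute[of \<omega> y] by (simp add: cinner_scaleC_left cinner_scaleC_right)
qed

lemma compose_rank_one: "a \<in> bounded_ops \<Longrightarrow> a o\<^sub>L rank_one \<omega> \<eta> = rank_one (a \<omega>) \<eta>"
  by (rule blinfun_eqI) (simp add: bounded_ops_scaleC)

lemma rank_one_compose: "a \<in> bounded_ops \<Longrightarrow> rank_one \<omega> \<eta> o\<^sub>L a = rank_one \<omega> (adj a \<eta>)"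
  by (rule blinfun_eqI) (simp add: cinner_adj_right)

section \<open>Operators on square-summable functions and their supports\<close>

lemma ell2_eqI: "(\<And>x. ell2_apply f x = ell2_apply g x) \<Longrightarrow> f = g"
  by (simp add: ell2_apply_inject[symmetric] fun_eq_iff)

lemma ell2_apply_zero [simp]: "ell2_apply 0 x = 0"
  by transfer simp

lemma ell2_apply_sum: "ell2_apply (sum f I) x = (\<Sum>i\<in>I. ell2_apply (f i) x)"
  by (induction I rule: infinite_finite_induct) (simp_all add: ell2_apply_add)

lemma ell2_apply_delta [simp]: "ell2_apply (delta x \<eta>) y = (if y = x then \<eta> else 0)"
  by (simp add: delta.rep_eq)

lemma delta_zero [simp]: "delta x 0 = 0"
  by (rule ell2_eqI) simp

lemma cinner_delta_left: "cinner (delta y \<eta>) f = cinner \<eta> (ell2_apply f y)"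
  by (subst (1 2) cinner_commute) (simp only: cinner_delta_right)

lemma norm_sq_ell2: "(norm f)\<^sup>2 = (\<Sum>\<^sub>\<infinity>x. (norm (ell2_apply f x))\<^sup>2)"
  by (simp add: norm_ell2.rep_eq infsum_nonneg)

lemma summable_ell2: "(\<lambda>x. (norm (ell2_apply f x))\<^sup>2) summable_on A"
proof -
  have "(\<lambda>x. (norm (ell2_apply f x))\<^sup>2) summable_on UNIV" using ell2_apply[of f] by simp
  then show ?thesis by (rule summable_on_subset_banach) simp
qed

lemma norm_ell2_le:
  fixes f :: "('x, 'h::complex_inner) ell2" and g :: "('x, 'k::complex_inner) ell2"
  assumes "\<And>x. norm (ell2_apply f x) \<le> C * norm (ell2_apply g x)" "C \<ge> 0"
  shows "norm f \<le> C * norm g"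
proof (rule power2_le_imp_le)
  have "(norm f)\<^sup>2 \<le> (\<Sum>\<^sub>\<infinity>x. C\<^sup>2 * (norm (ell2_apply g x))\<^sup>2)"
    unfolding norm_sq_ell2 power_mult_distrib[symmetric]
  proof (rule infsum_mono)
    show "(\<lambda>x. (C * norm (ell2_apply g x))\<^sup>2) summable_on UNIV"
      unfolding power_mult_distrib by (intro summable_on_cmult_right summable_ell2)
  qed (use assms in \<open>auto intro!: power_mono summable_ell2\<close>)
  also have "\<dots> = (C * norm g)\<^sup>2"
    by (simp add: infsum_cmult_right' power_mult_distrib norm_sq_ell2)
  finally show "(norm f)\<^sup>2 \<le> (C * norm g)\<^sup>2" .
qed (use assms in simp)

lift_definition restrict_ell2 :: "'x set \<Rightarrow> ('x, 'h::complex_inner) ell2 \<Rightarrow> ('x, 'h) ell2"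
  is "\<lambda>A f x. if x \<in> A then f x else 0"
proof -
  fix A :: "'x set" and f :: "'x \<Rightarrow> 'h" assume f: "(\<lambda>x. (norm (f x))\<^sup>2) summable_on UNIV"
  show "(\<lambda>x. (norm (if x \<in> A then f x else 0))\<^sup>2) summable_on UNIV"
    by (rule summable_on_comparison_test[OF f]) auto
qed

definition chi :: "'x set \<Rightarrow> (('x, 'h::complex_inner) ell2 \<Rightarrow>\<^sub>L ('x, 'h) ell2)" where
  "chi A = Blinfun (restrict_ell2 A)"

lemma ell2_apply_chi [simp]:
  fixes f :: "('x, 'h::complex_inner) ell2"
  shows "ell2_apply (chi A f) x = (if x \<in> A then ell2_apply f x else 0)"
proof -
  have "bounded_linear (restrict_ell2 A :: ('x, 'h) ell2 \<Rightarrow> ('x, 'h) ell2)"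
  proof (rule bounded_linear_intro[where K = 1])
    show "norm (restrict_ell2 A g) \<le> norm g * 1" for g :: "('x, 'h) ell2"
      using norm_ell2_le[of "restrict_ell2 A g" 1 g] by (simp add: restrict_ell2.rep_eq)
  qed (auto intro!: ell2_eqI simp: restrict_ell2.rep_eq ell2_apply_add ell2_apply_scaleR)
  then show ?thesis by (simp add: chi_def bounded_linear_Blinfun_apply restrict_ell2.rep_eq)
qed

lemma bounded_ops_chi [simp]: "chi A \<in> bounded_ops"
  by (intro bounded_opsI ell2_eqI) (simp add: ell2_apply_scaleC)

lemma norm_chi_apply_le: "norm (chi A f) \<le> norm f"
  using norm_ell2_le[of "chi A f" 1 f] by simp

lemma norm_chi_le: "norm (chi A) \<le> 1"
  by (rule norm_blinfun_bound) (simp_all add: norm_chi_apply_le)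

lemma chi_chi [simp]: "chi A (chi B f) = chi (A \<inter> B) f"
  by (rule ell2_eqI) simp

lemma chi_UNIV [simp]: "chi UNIV = id_blinfun"
  by (rule blinfun_eqI, rule ell2_eqI) simp

lemma chi_empty [simp]: "chi {} = 0"
  by (rule blinfun_eqI, rule ell2_eqI) simp

lemma chi_delta: "chi A (delta x \<eta>) = (if x \<in> A then delta x \<eta> else 0)"
  by (rule ell2_eqI) auto

lemma chi_singleton: "chi {x} f = delta x (ell2_apply f x)"
  by (rule ell2_eqI) simp

lemma chi_Compl: "chi (- A) = id_blinfun - chi A"
  by (rule blinfun_eqI, rule ell2_eqI) (simp add: blinfun.diff_left ell2_apply_diff)

lemma chi_disjoint_Un: "A \<inter> B = {} \<Longrightarrow> chi (A \<union> B) = chi A + chi B"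
  by (rule blinfun_eqI, rule ell2_eqI) (auto simp: blinfun.add_left ell2_apply_add)

lemma chi_finite_sum: "finite F \<Longrightarrow> chi F f = (\<Sum>x\<in>F. delta x (ell2_apply f x))"
  by (rule ell2_eqI) (auto simp: ell2_apply_sum)

lemma cinner_chi_left: "cinner (chi A f) g = cinner f (chi A g)"
  unfolding cinner_ell2.rep_eq by (rule infsum_cong) simp

lemma adj_chi [simp]: "adj (chi A :: ('x, 'h::complex_hilbert) ell2 \<Rightarrow>\<^sub>L _) = chi A"
  by (rule adj_eqI) (rule cinner_chi_left)

lemma norm_sq_chi_split: "(norm f)\<^sup>2 = (norm (chi A f))\<^sup>2 + (norm (chi (- A) f))\<^sup>2"
proof -
  have "cinner (chi A f) (chi (- A) f) = 0" by (simp add: cinner_chi_left)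
  from norm_pythagoras[OF this] show ?thesis
    by (simp add: chi_Compl blinfun.diff_left)
qed

lemma finite_chi_approx:
  fixes f :: "('x, 'h::complex_inner) ell2"
  assumes "e > 0"
  obtains F where "finite F" "\<And>G. F \<subseteq> G \<Longrightarrow> norm (f - chi G f) < e"
proof -
  let ?g = "\<lambda>x. (norm (ell2_apply f x))\<^sup>2"
  have "(?g has_sum (norm f)\<^sup>2) UNIV"
    unfolding norm_sq_ell2 by (intro has_sum_infsum summable_ell2)
  then have "\<forall>\<^sub>F F in finite_subsets_at_top UNIV. dist (sum ?g F) ((norm f)\<^sup>2) < e\<^sup>2"
    unfolding has_sum_def by (rule tendstoD) (use assms in simp)
  then obtain F where F: "finite F" "dist (sum ?g F) ((norm f)\<^sup>2) < e\<^sup>2"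
    unfolding eventually_finite_subsets_at_top by auto
  have "norm (f - chi G f) < e" if "F \<subseteq> G" for G
  proof -
    have "norm (f - chi G f) \<le> norm (chi (- F) f)"
    proof -
      have "norm (ell2_apply (f - chi G f) x) \<le> 1 * norm (ell2_apply (chi (- F) f) x)" for x
        using that by (auto simp: ell2_apply_diff)
      then show ?thesis using norm_ell2_le[of "f - chi G f" 1 "chi (- F) f"] by simp
    qed
    moreover have "(norm (chi F f))\<^sup>2 = sum ?g F"
    proof -
      have "(norm (chi F f))\<^sup>2 = (\<Sum>\<^sub>\<infinity>x\<in>F. ?g x)"
        unfolding norm_sq_ell2 by (rule infsum_cong_neutral) auto
      then show ?thesis using F(1) by simp
    qed
    then have "(norm (chi (- F) f))\<^sup>2 < e\<^sup>2"
      using F(2) norm_sq_chi_split[of f F] by (simp add: dist_real_def)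
    then have "norm (chi (- F) f) < e" by (rule power2_less_imp_less) (use assms in simp)
    ultimately show ?thesis by simp
  qed
  then show ?thesis using that F(1) by blast
qed

text \<open>Supports are recorded as relations, so that the support of a composition is the composition of
  the supports and that of the adjoint is the converse; propagation at most \<open>s\<close> is support in
  the relation \<open>{(x, y). dist x y \<le> s}\<close>.\<close>

definition supported ::
  "('x \<times> 'y) set \<Rightarrow> (('x, 'h::complex_inner) ell2 \<Rightarrow>\<^sub>L ('y, 'h) ell2) \<Rightarrow> bool" where
  "supported E a \<longleftrightarrow> (\<forall>x y \<xi>. (x, y) \<notin> E \<longrightarrow> ell2_apply (a (delta x \<xi>)) y = 0)"

lemma supportedD: "supported E a \<Longrightarrow> (x, y) \<notin> E \<Longrightarrow> ell2_apply (a (delta x \<xi>)) y = 0"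
  by (simp add: supported_def)

lemma supported_mono: "supported E a \<Longrightarrow> E \<subseteq> F \<Longrightarrow> supported F a"
  by (auto simp: supported_def)

lemma supported_add: "supported E a \<Longrightarrow> supported E b \<Longrightarrow> supported E (a + b)"
  by (simp add: supported_def blinfun.add_left ell2_apply_add)

lemma supported_diff: "supported E a \<Longrightarrow> supported E b \<Longrightarrow> supported E (a - b)"
  by (simp add: supported_def blinfun.diff_left ell2_apply_diff)

lemma supported_zero [simp]: "supported E 0"
  by (simp add: supported_def)

lemma supported_sum: "(\<And>i. i \<in> I \<Longrightarrow> supported E (a i)) \<Longrightarrow> supported E (sum a I)"
  by (induction I rule: infinite_finite_induct) (auto intro: supported_add)

lemma supported_op_scaleC: "supported E a \<Longrightarrow> supported E (op_scaleC c a)"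
  by (simp add: supported_def ell2_apply_scaleC)

lemma supported_chi: "Id_on A \<subseteq> E \<Longrightarrow> supported E (chi A)"
  by (auto simp: supported_def chi_delta)

lemma supported_apply_eq_0:
  fixes f :: "('x, 'h::complex_inner) ell2"
  assumes a: "supported E a" and f: "\<And>x. (x, y) \<in> E \<Longrightarrow> ell2_apply f x = 0"
  shows "ell2_apply (a f) y = 0"
proof (rule ccontr)
  assume "ell2_apply (a f) y \<noteq> 0"
  then have pos: "norm (ell2_apply (a f) y) / (norm a + 1) > 0"
    by (simp add: add_nonneg_pos)
  obtain F where F: "finite F" "\<And>G. F \<subseteq> G \<Longrightarrow> norm (f - chi G f) < norm (ell2_apply (a f) y) / (norm a + 1)"
    by (rule finite_chi_approx[OF pos, of f]) blast
  have "ell2_apply (a (delta x (ell2_apply f x))) y = 0" for x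
    using supportedD[OF a] f[of x] by (cases "(x, y) \<in> E") auto
  then have "ell2_apply (a (chi F f)) y = 0"
    by (simp add: chi_finite_sum[OF F(1)] blinfun.sum_right ell2_apply_sum)
  then have "norm (ell2_apply (a f) y) = norm (ell2_apply (a (f - chi F f)) y)"
    by (simp add: blinfun.diff_right ell2_apply_diff)
  also have "\<dots> \<le> norm (a (f - chi F f))" by (rule norm_ell2_apply_le)
  also have "\<dots> \<le> norm a * norm (f - chi F f)" by (rule norm_blinfun)
  also have "\<dots> \<le> (norm a + 1) * norm (f - chi F f)" by (intro mult_right_mono) auto
  also have "\<dots> < norm (ell2_apply (a f) y)"
    using F(2)[of F] norm_ge_zero[of a] by (simp add: field_simps add_nonneg_pos)
  finally show False by simp
qed

lemma supported_compose:
  assumes "supported E a" "supported F b"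
  shows "supported (E O F) (b o\<^sub>L a)"
  unfolding supported_def
proof (intro allI impI)
  fix x y \<xi> assume "(x, y) \<notin> E O F"
  then have "ell2_apply (a (delta x \<xi>)) z = 0" if "(z, y) \<in> F" for z
    using that supportedD[OF assms(1), of x z] by blast
  then show "ell2_apply ((b o\<^sub>L a) (delta x \<xi>)) y = 0"
    by (simp add: supported_apply_eq_0[OF assms(2)])
qed

lemma supported_compose_subset:
  "supported E a \<Longrightarrow> supported F b \<Longrightarrow> E O F \<subseteq> G \<Longrightarrow> supported G (b o\<^sub>L a)"
  by (rule supported_mono[OF supported_compose])

lemma supported_adj:
  fixes a :: "('x, 'h::complex_hilbert) ell2 \<Rightarrow>\<^sub>L ('y, 'h) ell2"
  assumes "a \<in> bounded_ops" "supported E a"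
  shows "supported (E\<inverse>) (adj a)"
  unfolding supported_def
proof (intro allI impI)
  fix y x \<eta> assume "(y, x) \<notin> E\<inverse>"
  then have *: "ell2_apply (a (delta x \<xi>)) y = 0" for \<xi>
    using supportedD[OF assms(2)] by auto
  show "ell2_apply (adj a (delta y \<eta>)) x = 0"
  proof (rule cinner_eqI)
    fix \<xi>
    have "cinner (ell2_apply (adj a (delta y \<eta>)) x) \<xi> = cinner (adj a (delta y \<eta>)) (delta x \<xi>)"
      by (simp add: cinner_delta_right)
    also have "\<dots> = cinner \<eta> (ell2_apply (a (delta x \<xi>)) y)"
      by (simp add: cinner_adj_left[OF assms(1)] cinner_delta_left)
    finally show "cinner (ell2_apply (adj a (delta y \<eta>)) x) \<xi> = cinner 0 \<xi>" by (simp add: *)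
  qed
qed

lemma norm_apply_delta_le:
  fixes T :: "('x, 'h::complex_inner) ell2 \<Rightarrow>\<^sub>L 'b::real_normed_vector"
  assumes unit: "\<And>\<xi>. norm \<xi> \<le> 1 \<Longrightarrow> norm (T (delta x \<xi>)) \<le> K"
  shows "norm (T (delta x \<xi>)) \<le> K * norm \<xi>"
proof (cases "\<xi> = 0")
  case False
  then have n: "norm \<xi> > 0" by simp
  define \<eta> where "\<eta> = complex_of_real (1 / norm \<xi>) *\<^sub>C \<xi>"
  have "\<xi> = norm \<xi> *\<^sub>R \<eta>" using n by (simp add: \<eta>_def scaleR_scaleC)
  then have "delta x \<xi> = norm \<xi> *\<^sub>R delta x \<eta>" by (metis delta_scaleC scaleR_scaleC)
  then have "T (delta x \<xi>) = norm \<xi> *\<^sub>R T (delta x \<eta>)" by (simp add: blinfun.scaleR_right)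
  moreover have "norm \<eta> \<le> 1" using n by (simp add: \<eta>_def norm_scaleC norm_divide)
  ultimately show ?thesis
    using mult_left_mono[OF unit[of \<eta>], of "norm \<xi>"] n by (simp add: mult.commute)
qed simp

lemma norm_apply_le_sum_fibres:
  fixes a :: "('x, 'h::complex_inner) ell2 \<Rightarrow>\<^sub>L 'b::complex_inner"
  assumes "finite D" "\<And>x. x \<notin> D \<Longrightarrow> ell2_apply f x = 0"
  shows "norm (a f) \<le> (\<Sum>x\<in>D. norm (a o\<^sub>L chi {x})) * norm f"
proof -
  have "f = (\<Sum>x\<in>D. chi {x} f)"
    by (rule ell2_eqI) (use assms in \<open>auto simp: ell2_apply_sum\<close>)
  then have "a f = (\<Sum>x\<in>D. (a o\<^sub>L chi {x}) f)"
    by (metis (no_types, lifting) blinfun.sum_right blinfun_apply_blinfun_compose sum.cong)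
  also have "norm \<dots> \<le> (\<Sum>x\<in>D. norm (a o\<^sub>L chi {x}) * norm f)"
    by (intro order_trans[OF norm_sum] sum_mono norm_blinfun)
  finally show ?thesis by (simp add: sum_distrib_right)
qed


section \<open>Propagation and band-dominated operators\<close>

definition band :: "real \<Rightarrow> ('x::metric_space \<times> 'x) set" where
  "band s = {(x, y). dist x y \<le> s}"

lemma in_band [simp]: "(x, y) \<in> band s \<longleftrightarrow> dist x y \<le> s"
  by (simp add: band_def)

lemma band_mono: "r \<le> s \<Longrightarrow> band r \<subseteq> band s"
  by (auto simp: band_def)

lemma band_compose: "band r O band s \<subseteq> band (r + s)"
proof (rule subrelI)
  fix x z :: 'a assume "(x, z) \<in> band r O band s"
  then obtain y where "dist x y \<le> r" "dist y z \<le> s" by auto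
  then show "(x, z) \<in> band (r + s)" using dist_triangle[of x z y] by simp
qed

lemma converse_band [simp]: "(band s)\<inverse> = band s"
  by (auto simp: band_def dist_commute)

definition prop_le ::
  "real \<Rightarrow> (('x::metric_space, 'h::complex_hilbert) ell2 \<Rightarrow>\<^sub>L ('x, 'h) ell2) \<Rightarrow> bool" where
  "prop_le s a \<longleftrightarrow> a \<in> bounded_ops \<and> supported (band s) a"

lemma propagation_le_iff:
  assumes "s \<ge> 0"
  shows "propagation a \<le> ennreal s \<longleftrightarrow> supported (band s) a"
proof -
  have "entry a x y = 0 \<longleftrightarrow> (\<forall>\<xi>. ell2_apply (a (delta x \<xi>)) y = 0)" for x y
    by (metis blinfun_apply_entry blinfun_eqI zero_blinfun.rep_eq)
  then have "propagation a \<le> ennreal s \<longleftrightarrow>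
      (\<forall>x y. (\<exists>\<xi>. ell2_apply (a (delta x \<xi>)) y \<noteq> 0) \<longrightarrow> dist x y \<le> s)"
    unfolding propagation_def SUP_le_iff using assms by (auto simp: ennreal_le_iff)
  then show ?thesis unfolding supported_def by (auto simp: not_le) (meson not_le)
qed

lemma prop_leI_propagation:
  "a \<in> bounded_ops \<Longrightarrow> propagation a \<le> ennreal s \<Longrightarrow> s \<ge> 0 \<Longrightarrow> prop_le s a"
  by (simp add: prop_le_def propagation_le_iff)

lemma prop_le_bounded_ops: "prop_le s a \<Longrightarrow> a \<in> bounded_ops"
  by (simp add: prop_le_def)

lemma prop_le_mono: "prop_le r a \<Longrightarrow> r \<le> s \<Longrightarrow> prop_le s a"
  unfolding prop_le_def using supported_mono band_mono by blast

lemma prop_le_add: "prop_le r a \<Longrightarrow> prop_le s b \<Longrightarrow> prop_le (max r s) (a + b)"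
  using prop_le_mono[of r a "max r s"] prop_le_mono[of s b "max r s"]
  by (simp add: prop_le_def supported_add)

lemma prop_le_zero [simp]: "prop_le s 0"
  by (simp add: prop_le_def)

lemma prop_le_compose: "prop_le r a \<Longrightarrow> prop_le s b \<Longrightarrow> prop_le (r + s) (a o\<^sub>L b)"
  unfolding prop_le_def
  using supported_compose_subset[of "band s" b "band r" a "band (r + s)"] band_compose[of s r]
  by (simp add: add.commute)

lemma prop_le_adj: "prop_le s a \<Longrightarrow> prop_le s (adj a)"
  unfolding prop_le_def using supported_adj[of a "band s"] by simp

lemma prop_le_op_scaleC: "prop_le s a \<Longrightarrow> prop_le s (op_scaleC c a)"
  by (simp add: prop_le_def supported_op_scaleC)

lemma prop_le_chi: "s \<ge> 0 \<Longrightarrow> prop_le s (chi A)"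
  by (auto simp: prop_le_def intro!: supported_chi)

text \<open>The propagation \<open>s\<close> and the error \<open>e\<close> are parameters, since the point of most arguments below is
  that one \<open>s\<close> serves a whole family of operators.\<close>

definition approximable ::
  "real \<Rightarrow> real \<Rightarrow> (('x::metric_space, 'h::complex_hilbert) ell2 \<Rightarrow>\<^sub>L ('x, 'h) ell2) \<Rightarrow> bool" where
  "approximable s e a \<longleftrightarrow> (\<exists>d. prop_le s d \<and> norm (a - d) \<le> e)"

lemma approximableI: "prop_le s d \<Longrightarrow> norm (a - d) \<le> e \<Longrightarrow> approximable s e a"
  by (auto simp: approximable_def)

lemma approximable_prop_le: "prop_le s a \<Longrightarrow> e \<ge> 0 \<Longrightarrow> approximable s e a"
  by (auto simp: approximable_def intro!: exI[of _ a])

lemma approximable_mono: "approximable r e a \<Longrightarrow> r \<le> s \<Longrightarrow> e \<le> f \<Longrightarrow> approximable s f a"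
  unfolding approximable_def by (meson order_trans prop_le_mono)

lemma approximable_add:
  assumes "approximable r e a" "approximable s f b"
  shows "approximable (max r s) (e + f) (a + b)"
proof -
  obtain c d where "prop_le r c" "norm (a - c) \<le> e" "prop_le s d" "norm (b - d) \<le> f"
    using assms by (auto simp: approximable_def)
  moreover have "norm (a + b - (c + d)) \<le> norm (a - c) + norm (b - d)"
    using norm_triangle_ineq[of "a - c" "b - d"] by (simp add: algebra_simps)
  ultimately show ?thesis by (intro approximableI[of _ "c + d"] prop_le_add) auto
qed

lemma approximable_op_scaleC:
  assumes "approximable r e a" "e \<ge> 0" "cmod c \<le> 1"
  shows "approximable r e (op_scaleC c a)"
proof -
  obtain d where d: "prop_le r d" "norm (a - d) \<le> e"
    using assms by (auto simp: approximable_def)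
  have "op_scaleC c a - op_scaleC c d = op_scaleC c (a - d)"
    by (rule blinfun_eqI) (simp add: blinfun.diff_left complex_vector.scale_right_diff_distrib)
  then have "norm (op_scaleC c a - op_scaleC c d) \<le> cmod c * norm (a - d)"
    using norm_op_scaleC_le by metis
  also have "\<dots> \<le> 1 * e" using d assms by (intro mult_mono) auto
  finally show ?thesis using d by (intro approximableI[of _ "op_scaleC c d"] prop_le_op_scaleC) auto
qed

lemma approximable_compose:
  assumes "approximable r e a" "approximable s f b" "norm a \<le> K" "norm b \<le> L" "K \<ge> 0" "f \<ge> 0"
  shows "approximable (r + s) (e * (L + f) + K * f) (a o\<^sub>L b)"
proof -
  obtain c d where c: "prop_le r c" "norm (a - c) \<le> e" and d: "prop_le s d" "norm (b - d) \<le> f"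
    using assms by (auto simp: approximable_def)
  have "e \<ge> 0" using c(2) norm_ge_zero order_trans by blast
  have "norm d \<le> L + f" using d(2) assms(4) norm_triangle_ineq3[of b d] by linarith
  have eq: "(a o\<^sub>L b) - (c o\<^sub>L d) = (a o\<^sub>L (b - d)) + ((a - c) o\<^sub>L d)"
    by (rule blinfun_eqI) (simp add: blinfun.add_left blinfun.diff_left blinfun.diff_right)
  have "norm ((a o\<^sub>L b) - (c o\<^sub>L d)) \<le> norm (a o\<^sub>L (b - d)) + norm ((a - c) o\<^sub>L d)"
    unfolding eq by (rule norm_triangle_ineq)
  also have "\<dots> \<le> norm a * norm (b - d) + norm (a - c) * norm d"
    by (intro add_mono norm_blinfun_compose)
  also have "\<dots> \<le> K * f + e * (L + f)"
    by (intro add_mono mult_mono) (use assms c d \<open>norm d \<le> L + f\<close> \<open>e \<ge> 0\<close> in auto)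
  finally show ?thesis using c d by (intro approximableI[of _ "c o\<^sub>L d"] prop_le_compose) auto
qed

lemma approximable_adj:
  assumes "approximable s e a" "a \<in> bounded_ops"
  shows "approximable s e (adj a)"
proof -
  obtain d where d: "prop_le s d" "norm (a - d) \<le> e"
    using assms by (auto simp: approximable_def)
  then have "norm (adj a - adj d) \<le> e"
    using assms(2) prop_le_bounded_ops[OF d(1)] by (simp flip: adj_diff)
  then show ?thesis using prop_le_adj[OF d(1)] by (rule approximableI[rotated])
qed

lemma band_dominated_iff:
  "a \<in> band_dominated \<longleftrightarrow> (\<forall>e>0. \<exists>s\<ge>0. approximable s e a)"
proof
  assume a: "a \<in> band_dominated"
  show "\<forall>e>0. \<exists>s\<ge>0. approximable s e a"
  proof (intro allI impI)
    fix e :: real assume "e > 0"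
    then obtain d where d: "d \<in> bounded_ops" "propagation d < \<infinity>" "dist d a < e"
      using a unfolding band_dominated_def closure_approachable by blast
    obtain s where "s \<ge> 0" "propagation d = ennreal s"
      using d(2) by (cases "propagation d") auto
    then show "\<exists>s\<ge>0. approximable s e a"
      using d by (intro exI[of _ s] conjI approximableI[of _ d] prop_leI_propagation)
        (auto simp: dist_norm norm_minus_commute)
  qed
next
  assume *: "\<forall>e>0. \<exists>s\<ge>0. approximable s e a"
  show "a \<in> band_dominated"
    unfolding band_dominated_def closure_approachable
  proof (intro allI impI)
    fix e :: real assume "e > 0"
    then obtain s d where s: "s \<ge> 0" and d: "prop_le s d" "norm (a - d) \<le> e / 2"
      using * unfolding approximable_def by (metis half_gt_zero)
    have "propagation d \<le> ennreal s" using s d(1) by (simp add: propagation_le_iff prop_le_def)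
    then have "propagation d < \<infinity>" using ennreal_less_top[of s] by (simp add: order_le_less_trans)
    moreover have "dist d a < e" using d(2) \<open>e > 0\<close> by (simp add: dist_norm norm_minus_commute)
    ultimately show "\<exists>y\<in>{a \<in> bounded_ops. propagation a < \<infinity>}. dist y a < e"
      using d(1) by (auto simp: prop_le_def)
  qed
qed

lemma band_dominated_bounded_ops: "a \<in> band_dominated \<Longrightarrow> a \<in> bounded_ops"
proof -
  have "band_dominated \<subseteq> bounded_ops"
    unfolding band_dominated_def by (rule closure_minimal[OF _ closed_bounded_ops]) auto
  then show "a \<in> band_dominated \<Longrightarrow> a \<in> bounded_ops" by (rule subsetD)
qed

lemma prop_le_band_dominated:
  assumes "prop_le s a" shows "a \<in> band_dominated"
proof -
  have "prop_le (max s 0) a" using assms by (rule prop_le_mono) simp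
  then have "approximable (max s 0) e a" if "e > 0" for e
    using that by (simp add: approximable_prop_le)
  then show ?thesis unfolding band_dominated_iff by (meson max.cobounded2)
qed

lemma band_dominated_add:
  assumes "a \<in> band_dominated" "b \<in> band_dominated"
  shows "a + b \<in> band_dominated"
  unfolding band_dominated_iff
proof (intro allI impI)
  fix e :: real assume "e > 0"
  then obtain r s where "r \<ge> 0" "s \<ge> 0" "approximable r (e/2) a" "approximable s (e/2) b"
    using assms unfolding band_dominated_iff by (meson half_gt_zero)
  then show "\<exists>s\<ge>0. approximable s e (a + b)"
    using approximable_add[of r "e/2" a s "e/2" b] by (intro exI[of _ "max r s"]) auto
qed

lemma band_dominated_compose:
  assumes "a \<in> band_dominated" "b \<in> band_dominated"
  shows "a o\<^sub>L b \<in> band_dominated"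
  unfolding band_dominated_iff
proof (intro allI impI)
  fix e :: real assume e: "e > 0"
  define f where "f = min 1 (e / (norm a + norm b + 1))"
  have f: "f > 0" "f \<le> 1" using e by (simp_all add: f_def add_nonneg_pos)
  then obtain r s where rs: "r \<ge> 0" "s \<ge> 0" "approximable r f a" "approximable s f b"
    using assms unfolding band_dominated_iff by meson
  have "f * (norm b + f) + norm a * f \<le> f * (norm a + norm b + 1)"
    using f by (simp add: algebra_simps mult_le_one)
  also have "\<dots> \<le> e"
  proof -
    have "f \<le> e / (norm a + norm b + 1)" by (simp add: f_def)
    then show ?thesis by (simp add: pos_le_divide_eq add_nonneg_pos)
  qed
  finally show "\<exists>s\<ge>0. approximable s e (a o\<^sub>L b)"
    using approximable_compose[OF rs(3,4) order_refl order_refl] f rs(1,2)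
    by (intro exI[of _ "r + s"]) (auto elim: approximable_mono)
qed

lemma band_dominated_op_scaleC:
  assumes "a \<in> band_dominated" shows "op_scaleC c a \<in> band_dominated"
proof -
  have "op_scaleC c a = op_scaleC c id_blinfun o\<^sub>L a" by (rule blinfun_eqI) simp
  moreover have "op_scaleC c id_blinfun \<in> band_dominated"
    using prop_le_op_scaleC[OF prop_le_chi[of 0 UNIV]] by (auto intro: prop_le_band_dominated)
  ultimately show ?thesis using band_dominated_compose assms by metis
qed

lemma band_dominated_diff:
  assumes "a \<in> band_dominated" "b \<in> band_dominated"
  shows "a - b \<in> band_dominated"
proof -
  have "a - b = a + op_scaleC (-1) b"
    by (rule blinfun_eqI) (simp add: blinfun.add_left blinfun.diff_left complex_vector.scale_minus_left)
  then show ?thesis using band_dominated_add band_dominated_op_scaleC assms by metis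
qed

lemma band_dominated_zero [simp]: "0 \<in> band_dominated"
  by (rule prop_le_band_dominated[of 0]) simp

lemma band_dominated_sum: "(\<And>i. i \<in> I \<Longrightarrow> a i \<in> band_dominated) \<Longrightarrow> sum a I \<in> band_dominated"
  by (induction I rule: infinite_finite_induct) (auto intro: band_dominated_add)

lemma band_dominated_adj: "a \<in> band_dominated \<Longrightarrow> adj a \<in> band_dominated"
  using approximable_adj band_dominated_bounded_ops unfolding band_dominated_iff by blast

lemma closed_band_dominated: "closed band_dominated"
  by (simp add: band_dominated_def)

lemma band_dominated_limit:
  assumes "\<And>e. e > 0 \<Longrightarrow> \<exists>b\<in>band_dominated. norm (a - b) \<le> e"
  shows "a \<in> band_dominated"
proof -
  have "a \<in> closure band_dominated"
    unfolding closure_approachable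
  proof (intro allI impI)
    fix e :: real assume "e > 0"
    then obtain b where "b \<in> band_dominated" "norm (a - b) \<le> e / 2" using assms[of "e/2"] by auto
    then show "\<exists>y\<in>band_dominated. dist y a < e"
      using \<open>e > 0\<close> by (intro bexI[of _ b]) (auto simp: dist_norm norm_minus_commute)
  qed
  then show ?thesis using closed_band_dominated closure_closed by blast
qed

section \<open>Weak operator limits\<close>

text \<open>Bounded sets of operators are weakly compact: matrix coefficients range in a product of discs,
  to which Tychonoff's theorem applies. The limit is along a finer filter instead of a subsequence,
  because an uncountable product of discs is not sequentially compact.\<close>

lemma weak_operator_cluster_point:
  fixes d :: "nat \<Rightarrow> ('a::complex_hilbert \<Rightarrow>\<^sub>L 'b::complex_hilbert)"
  assumes d: "\<And>n. d n \<in> bounded_ops" and M: "\<And>n. norm (d n) \<le> M"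
  obtains F D where "F \<noteq> bot" "F \<le> sequentially" "D \<in> bounded_ops"
    "\<And>x y. ((\<lambda>n. cinner (d n x) y) \<longlongrightarrow> cinner (blinfun_apply D x) y) F"
proof -
  define g where "g = (\<lambda>n (x, y). cinner (d n x) y)"
  define K where "K = (\<Pi>\<^sub>E p\<in>UNIV. cball (0::complex) (case p of (x::'a, y::'b) \<Rightarrow> M * norm x * norm y))"
  have "M \<ge> 0" using M[of 0] norm_ge_zero order_trans by blast
  have bound: "cmod (cinner (d n x) y) \<le> M * norm x * norm y" for n x y
    using cmod_cinner_op_le[of "d n" x y] mult_right_mono[OF M[of n], of "norm x * norm y"]
    by (simp add: mult_ac)
  have "compactin (product_topology (\<lambda>_. euclidean) UNIV) K"
    unfolding K_def compactin_PiE by auto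
  then have "compact K" by (simp add: euclidean_product_topology)
  moreover have "g n \<in> K" for n using bound by (auto simp: g_def K_def)
  then have "eventually (\<lambda>f. f \<in> K) (filtermap g sequentially)"
    by (simp add: eventually_filtermap)
  moreover have "filtermap g sequentially \<noteq> bot" by (simp add: filtermap_bot_iff)
  ultimately obtain l where l: "inf (nhds l) (filtermap g sequentially) \<noteq> bot"
    unfolding compact_filter by blast
  define F where "F = inf sequentially (filtercomap g (nhds l))"
  have Fb: "F \<noteq> bot"
  proof
    assume "F = bot"
    then have "eventually (\<lambda>_. False) F" by simp
    then obtain P Q where "eventually P sequentially" "eventually Q (nhds l)"
      and PQ: "\<And>n. P n \<Longrightarrow> Q (g n) \<Longrightarrow> False"
      unfolding F_def eventually_inf eventually_filtercomap by blast
    then have "eventually (\<lambda>f. \<not> Q f) (filtermap g sequentially)"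
      unfolding eventually_filtermap by (elim eventually_mono) (use PQ in blast)
    then have "eventually (\<lambda>_. False) (inf (nhds l) (filtermap g sequentially))"
      using \<open>eventually Q (nhds l)\<close> unfolding eventually_inf by blast
    then show False using l by (simp add: trivial_limit_def)
  qed
  have Fs: "F \<le> sequentially" by (simp add: F_def)
  have "(g \<longlongrightarrow> l) F"
    unfolding F_def by (rule filterlim_mono[OF filterlim_filtercomap order_refl]) simp
  then have lim: "((\<lambda>n. cinner (d n x) y) \<longlongrightarrow> l (x, y)) F" for x y
    using continuous_on_tendsto_compose[OF continuous_on_product_coordinates[of "(x, y)"] \<open>(g \<longlongrightarrow> l) F\<close>]
    by (simp add: g_def)
  have unique: "l (x, y) = c" if "((\<lambda>n. cinner (d n x) y) \<longlongrightarrow> c) F" for x y c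
    by (rule tendsto_unique[OF Fb lim that])
  have "\<exists>D\<in>bounded_ops. \<forall>x y. cinner (blinfun_apply D x) y = l (x, y)"
  proof (rule sesquilinear_op_exists[OF _ _ _ _ _ \<open>M \<ge> 0\<close>])
    fix x x' :: 'a and y y' :: 'b and c
    show "l (x + x', y) = l (x, y) + l (x', y)"
      by (rule unique) (simp add: blinfun.add_right cinner_add_left tendsto_add lim)
    show "l (c *\<^sub>C x, y) = c * l (x, y)"
      by (rule unique) (simp add: bounded_ops_scaleC[OF d] cinner_scaleC_left tendsto_mult_left lim)
    show "l (x, y + y') = l (x, y) + l (x, y')"
      by (rule unique) (simp add: cinner_add_right tendsto_add lim)
    show "l (x, c *\<^sub>C y) = cnj c * l (x, y)"
      by (rule unique) (simp add: cinner_scaleC_right tendsto_mult_left lim)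
    show "cmod (l (x, y)) \<le> M * norm x * norm y"
      by (rule tendsto_upperbound[OF tendsto_norm[OF lim] _ Fb]) (simp add: bound)
  qed
  then obtain D where "D \<in> bounded_ops" "\<And>x y. cinner (blinfun_apply D x) y = l (x, y)" by blast
  then show ?thesis using that Fb Fs lim by metis
qed

lemma norm_weak_limit_le:
  fixes C :: "'a::complex_inner \<Rightarrow>\<^sub>L 'b::complex_inner"
  assumes lim: "\<And>x y. ((\<lambda>n. cinner (blinfun_apply (c n) x) y) \<longlongrightarrow> cinner (blinfun_apply C x) y) F"
    and F: "F \<noteq> bot" and c: "\<And>n. norm (c n) \<le> M" and M: "M \<ge> 0"
  shows "norm C \<le> M"
proof (rule norm_leI_op[OF _ M])
  fix x y
  have "cmod (cinner (c n x) y) \<le> M * norm x * norm y" for n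
    using cmod_cinner_op_le[of "c n" x y] mult_right_mono[OF c[of n], of "norm x * norm y"]
    by (simp add: mult_ac)
  then show "cmod (cinner (C x) y) \<le> M * norm x * norm y"
    by (intro tendsto_upperbound[OF tendsto_norm[OF lim] _ F]) simp
qed

lemma supported_weak_limit:
  assumes lim: "\<And>x y. ((\<lambda>n. cinner (blinfun_apply (c n) x) y) \<longlongrightarrow> cinner (blinfun_apply C x) y) F"
    and F: "F \<noteq> bot" and c: "\<And>n. supported E (c n)"
  shows "supported E C"
  unfolding supported_def
proof (intro allI impI, rule cinner_eqI)
  fix x y \<xi> \<eta> assume xy: "(x, y) \<notin> E"
  have "((\<lambda>n. 0) \<longlongrightarrow> cinner (ell2_apply (C (delta x \<xi>)) y) \<eta>) F"
    using lim[of "delta x \<xi>" "delta y \<eta>"] supportedD[OF c xy] by (simp add: cinner_delta_right)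
  then show "cinner (ell2_apply (C (delta x \<xi>)) y) \<eta> = cinner 0 \<eta>"
    using tendsto_unique[OF F _ tendsto_const] by (metis cinner_zero_left)
qed

text \<open>By weak compactness the approximants may be taken to converge as well. This is what makes
  Baire category arguments work for approximability.\<close>

lemma approximable_weak_limit:
  fixes c :: "nat \<Rightarrow> (('x::metric_space, 'h::complex_hilbert) ell2 \<Rightarrow>\<^sub>L ('x, 'h) ell2)"
  assumes lim: "\<And>x y. (\<lambda>n. cinner (c n x) y) \<longlonglongrightarrow> cinner (blinfun_apply C x) y"
    and c: "\<And>n. approximable s e (c n)" and M: "\<And>n. norm (c n) \<le> M"
  shows "approximable s e C"
proof -
  obtain d where d: "\<And>n. prop_le s (d n)" "\<And>n. norm (c n - d n) \<le> e"
    using c unfolding approximable_def by metis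
  have e: "e \<ge> 0" using d(2)[of 0] norm_ge_zero order_trans by blast
  have "norm (d n) \<le> M + e" for n
    using M[of n] d(2)[of n] norm_triangle_ineq3[of "c n" "d n"] by linarith
  then obtain F D where F: "F \<noteq> bot" "F \<le> sequentially" and D: "D \<in> bounded_ops"
    and limD: "\<And>x y. ((\<lambda>n. cinner (d n x) y) \<longlongrightarrow> cinner (blinfun_apply D x) y) F"
    using weak_operator_cluster_point[of d "M + e"] d(1) prop_le_bounded_ops by metis
  have "prop_le s D"
    unfolding prop_le_def using D supported_weak_limit[OF limD F(1)] d(1) by (auto simp: prop_le_def)
  moreover have "norm (C - D) \<le> e"
  proof (rule norm_weak_limit_le[OF _ F(1) d(2) e])
    show "((\<lambda>n. cinner ((c n - d n) x) y) \<longlongrightarrow> cinner ((C - D) x) y) F" for x y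
      unfolding blinfun.diff_left cinner_diff_left
      by (intro tendsto_diff limD tendsto_mono[OF F(2) lim])
  qed
  ultimately show ?thesis by (rule approximableI)
qed


section \<open>Hilbert bases\<close>

text \<open>Totality is stated as triviality of the orthogonal complement: in this form it shows directly, by
  passing to adjoints, that operators agreeing on a basis are equal.\<close>

definition hilbert_basis :: "('i \<Rightarrow> 'a::complex_inner) \<Rightarrow> bool" where
  "hilbert_basis e \<longleftrightarrow> (\<forall>i j. cinner (e i) (e j) = (if i = j then 1 else 0)) \<and>
     (\<forall>x. (\<forall>i. cinner x (e i) = 0) \<longrightarrow> x = 0)"

lemma hilbert_basis_cinner: "hilbert_basis e \<Longrightarrow> cinner (e i) (e j) = (if i = j then 1 else 0)"
  by (simp add: hilbert_basis_def)

lemma hilbert_basis_total: "hilbert_basis e \<Longrightarrow> (\<And>i. cinner x (e i) = 0) \<Longrightarrow> x = 0"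
  by (simp add: hilbert_basis_def)

lemma hilbert_basis_eqI:
  assumes "hilbert_basis e" "\<And>i. cinner x (e i) = cinner y (e i)"
  shows "x = y"
  using hilbert_basis_total[OF assms(1), of "x - y"] assms(2) by (simp add: cinner_diff_left)

lemma norm_eq_1_cinner: "cinner x x = 1 \<Longrightarrow> norm (x::'a::complex_inner) = 1"
  using norm_sq_cinner[of x] abs_square_eq_1[of "norm x"] by simp

lemma norm_hilbert_basis [simp]: "hilbert_basis e \<Longrightarrow> norm (e i) = 1"
  by (rule norm_eq_1_cinner) (simp add: hilbert_basis_cinner)

lemma op_eq_on_basis:
  fixes a b :: "'a::complex_hilbert \<Rightarrow>\<^sub>L 'b::complex_hilbert"
  assumes e: "hilbert_basis e" and ab: "a \<in> bounded_ops" "b \<in> bounded_ops"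
    and eq: "\<And>i. a (e i) = b (e i)"
  shows "a = b"
proof -
  have "adj a y = adj b y" for y
    by (rule hilbert_basis_eqI[OF e]) (simp add: cinner_adj_left ab eq)
  then have "adj a = adj b" by (rule blinfun_eqI)
  then show ?thesis using ab by (metis adj_adj)
qed

text \<open>Vectors of norm at most one, including zero, so that the images of a basis under the projection onto
  the span of a part of it form such a family.\<close>

definition orthogonal_family :: "('i \<Rightarrow> 'a::complex_inner) \<Rightarrow> bool" where
  "orthogonal_family f \<longleftrightarrow> (\<forall>i j. i \<noteq> j \<longrightarrow> cinner (f i) (f j) = 0) \<and> (\<forall>i. norm (f i) \<le> 1)"

lemma hilbert_basis_orthogonal_family: "hilbert_basis e \<Longrightarrow> orthogonal_family e"
  by (simp add: orthogonal_family_def hilbert_basis_cinner)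

lemma bessel_inequality:
  fixes f :: "'i \<Rightarrow> 'a::complex_inner"
  assumes f: "orthogonal_family f" and F: "finite F"
  shows "(\<Sum>i\<in>F. (cmod (cinner x (f i)))\<^sup>2) \<le> (norm x)\<^sup>2"
proof -
  define c where "c i = cinner x (f i)" for i
  define y where "y = (\<Sum>i\<in>F. c i *\<^sub>C f i)"
  define s where "s = (\<Sum>i\<in>F. (cmod (c i))\<^sup>2)"
  have s0: "s \<ge> 0" by (simp add: s_def sum_nonneg)
  have "cinner x y = (\<Sum>i\<in>F. cnj (c i) * c i)"
    by (simp add: y_def cinner_sum_right cinner_scaleC_right c_def)
  also have "\<dots> = complex_of_real s"
    by (simp add: s_def complex_norm_square mult.commute del: of_real_power)
  finally have xy: "cinner x y = complex_of_real s" .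
  have "cinner y y = (\<Sum>i\<in>F. \<Sum>j\<in>F. c i * (cnj (c j) * cinner (f i) (f j)))"
    unfolding y_def cinner_sum_left cinner_sum_right
    by (subst sum.swap) (simp add: cinner_scaleC_left cinner_scaleC_right mult_ac)
  also have "\<dots> = (\<Sum>i\<in>F. c i * (cnj (c i) * cinner (f i) (f i)))"
  proof (rule sum.cong[OF refl])
    fix i assume i: "i \<in> F"
    have "(\<Sum>j\<in>F. c i * (cnj (c j) * cinner (f i) (f j)))
        = (\<Sum>j\<in>{i}. c i * (cnj (c j) * cinner (f i) (f j)))"
      by (rule sum.mono_neutral_right) (use F i f in \<open>auto simp: orthogonal_family_def\<close>)
    then show "(\<Sum>j\<in>F. c i * (cnj (c j) * cinner (f i) (f j))) = c i * (cnj (c i) * cinner (f i) (f i))"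
      by simp
  qed
  also have "\<dots> = complex_of_real (\<Sum>i\<in>F. (cmod (c i))\<^sup>2 * (norm (f i))\<^sup>2)"
    unfolding cinner_self of_real_sum of_real_mult complex_norm_square by (simp add: mult_ac)
  finally have "(norm y)\<^sup>2 = (\<Sum>i\<in>F. (cmod (c i))\<^sup>2 * (norm (f i))\<^sup>2)"
    unfolding norm_sq_cinner by simp
  also have "\<dots> \<le> s"
    unfolding s_def using f
    by (intro sum_mono mult_left_le) (auto simp: orthogonal_family_def power_le_one)
  finally have y: "(norm y)\<^sup>2 \<le> s" .
  have "s \<le> norm x * norm y"
    using Cauchy_Schwarz_complex[of x y] s0 by (simp add: xy)
  then have "s\<^sup>2 \<le> (norm x * norm y)\<^sup>2" using s0 by (intro power_mono) auto
  also have "\<dots> \<le> (norm x)\<^sup>2 * s" using y by (simp add: power_mult_distrib mult_left_mono)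
  finally have "s * s \<le> (norm x)\<^sup>2 * s" by (simp add: power2_eq_square)
  then have "s \<le> (norm x)\<^sup>2" using s0 by (cases "s = 0") auto
  then show ?thesis by (simp add: s_def c_def)
qed

lift_definition coord_ell2 :: "('i \<Rightarrow> 'a::complex_inner) \<Rightarrow> 'a \<Rightarrow> ('i, complex) ell2"
  is "\<lambda>f x i. if orthogonal_family f then cinner x (f i) else 0"
proof -
  fix f :: "'i \<Rightarrow> 'a" and x :: 'a
  have "L2_set (\<lambda>i. norm (cinner x (f i))) F \<le> norm x" if "orthogonal_family f" "finite F" for F
    unfolding L2_set_def using bessel_inequality[OF that, of x] by (intro real_le_lsqrt) auto
  from ell2_boundI(1)[OF this]
  show "(\<lambda>i. (norm (if orthogonal_family f then cinner x (f i) else 0))\<^sup>2) summable_on UNIV"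
    by (cases "orthogonal_family f") simp_all
qed

definition coord :: "('i \<Rightarrow> 'a::complex_inner) \<Rightarrow> ('a \<Rightarrow>\<^sub>L ('i, complex) ell2)" where
  "coord f = Blinfun (coord_ell2 f)"

lemma
  fixes f :: "'i \<Rightarrow> 'a::complex_inner"
  assumes f: "orthogonal_family f"
  shows ell2_apply_coord: "ell2_apply (coord f x) i = cinner x (f i)"
    and norm_coord_apply_le: "norm (coord f x) \<le> norm x"
    and bounded_ops_coord: "coord f \<in> bounded_ops"
proof -
  have app: "ell2_apply (coord_ell2 f x) i = cinner x (f i)" for x i
    using f by (simp add: coord_ell2.rep_eq)
  have norm: "norm (coord_ell2 f x) \<le> norm x" for x
    unfolding norm_ell2.rep_eq app
  proof (rule ell2_boundI(2))
    show "L2_set (\<lambda>i. norm (cinner x (f i))) F \<le> norm x" if "finite F" for F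
      unfolding L2_set_def using bessel_inequality[OF f that, of x] by (intro real_le_lsqrt) auto
  qed
  have "bounded_linear (coord_ell2 f)"
  proof (rule bounded_linear_intro[where K = 1])
    show "coord_ell2 f (x + y) = coord_ell2 f x + coord_ell2 f y" for x y
      by (rule ell2_eqI) (simp add: app ell2_apply_add cinner_add_left)
    show "coord_ell2 f (r *\<^sub>R x) = r *\<^sub>R coord_ell2 f x" for r x
      unfolding scaleR_scaleC[of r x] scaleR_scaleC[of r "coord_ell2 f x"]
      by (rule ell2_eqI) (simp add: app ell2_apply_scaleC cinner_scaleC_left scaleC_complex_def)
  qed (use norm in simp)
  then have c: "blinfun_apply (coord f) = coord_ell2 f"
    unfolding coord_def by (rule bounded_linear_Blinfun_apply)
  show "ell2_apply (coord f x) i = cinner x (f i)" by (simp add: c app)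
  show "norm (coord f x) \<le> norm x" by (simp add: c norm)
  show "coord f \<in> bounded_ops"
    by (rule bounded_opsI, rule ell2_eqI)
      (simp add: c app ell2_apply_scaleC cinner_scaleC_left scaleC_complex_def)
qed

lemma norm_coord_le: "orthogonal_family f \<Longrightarrow> norm (coord f) \<le> 1"
  by (rule norm_blinfun_bound) (simp_all add: norm_coord_apply_le)

lemma adj_coord_delta:
  fixes f :: "'i \<Rightarrow> 'a::complex_hilbert"
  assumes f: "orthogonal_family f"
  shows "adj (coord f) (delta i c) = c *\<^sub>C f i"
proof (rule cinner_eqI)
  fix z
  have "cinner (adj (coord f) (delta i c)) z = c * cnj (cinner z (f i))"
    by (simp add: cinner_adj_left bounded_ops_coord[OF f] cinner_delta_left ell2_apply_coord[OF f]
        cinner_complex_def)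
  then show "cinner (adj (coord f) (delta i c)) z = cinner (c *\<^sub>C f i) z"
    by (simp add: cinner_scaleC_left flip: cinner_commute)
qed

text \<open>The operator that sends a Hilbert basis \<open>e\<close> to a given orthogonal family \<open>f\<close> is constructed
  without summation: the adjoint of \<open>coord f\<close> maps the coordinate vectors to the vectors of \<open>f\<close>.\<close>

definition basis_map ::
  "('i \<Rightarrow> 'a::complex_hilbert) \<Rightarrow> ('i \<Rightarrow> 'b::complex_hilbert) \<Rightarrow> ('a \<Rightarrow>\<^sub>L 'b)" where
  "basis_map e f = adj (coord f) o\<^sub>L coord e"

lemma coord_basis: "hilbert_basis e \<Longrightarrow> coord e (e i) = delta i 1"
  by (rule ell2_eqI) (simp add: ell2_apply_coord hilbert_basis_orthogonal_family hilbert_basis_cinner)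

lemma
  assumes e: "hilbert_basis e" and f: "orthogonal_family f"
  shows basis_map_apply: "basis_map e f (e i) = f i"
    and bounded_ops_basis_map: "basis_map e f \<in> bounded_ops"
    and norm_basis_map_le: "norm (basis_map e f) \<le> 1"
proof -
  show "basis_map e f (e i) = f i"
    by (simp add: basis_map_def coord_basis[OF e] adj_coord_delta[OF f])
  note b = bounded_ops_coord[OF hilbert_basis_orthogonal_family[OF e]] bounded_ops_coord[OF f]
  show "basis_map e f \<in> bounded_ops" by (simp add: basis_map_def b)
  have "norm (basis_map e f) \<le> norm (adj (coord f)) * norm (coord e)"
    unfolding basis_map_def by (rule norm_blinfun_compose)
  also have "\<dots> \<le> 1 * 1"
    by (intro mult_mono) (simp_all add: b norm_coord_le f hilbert_basis_orthogonal_family[OF e])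
  finally show "norm (basis_map e f) \<le> 1" by simp
qed

lemma basis_finite_approx:
  fixes e :: "'i \<Rightarrow> 'a::complex_hilbert"
  assumes e: "hilbert_basis e" and "\<epsilon> > 0"
  obtains G c where "finite G" "norm (x - (\<Sum>i\<in>G. c i *\<^sub>C e i)) < \<epsilon>"
proof -
  note s = hilbert_basis_orthogonal_family[OF e]
  have "adj (coord e) o\<^sub>L coord e = id_blinfun"
    by (rule op_eq_on_basis[OF e]) (simp_all add: bounded_ops_coord[OF s] coord_basis[OF e] adj_coord_delta[OF s])
  then have x: "adj (coord e) (coord e x) = x"
    by (metis blinfun_apply_blinfun_compose id_blinfun.rep_eq)
  obtain G where G: "finite G" "\<And>H. G \<subseteq> H \<Longrightarrow> norm (coord e x - chi H (coord e x)) < \<epsilon>"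
    by (rule finite_chi_approx[OF assms(2), of "coord e x"]) blast
  have "x - (\<Sum>i\<in>G. ell2_apply (coord e x) i *\<^sub>C e i) = adj (coord e) (coord e x - chi G (coord e x))"
    by (simp add: blinfun.diff_right x chi_finite_sum[OF G(1)] blinfun.sum_right adj_coord_delta[OF s])
  also have "norm \<dots> \<le> norm (adj (coord e)) * norm (coord e x - chi G (coord e x))"
    by (rule norm_blinfun)
  also have "\<dots> \<le> 1 * norm (coord e x - chi G (coord e x))"
    by (intro mult_right_mono) (simp_all add: bounded_ops_coord[OF s] norm_coord_le[OF s])
  also have "\<dots> < \<epsilon>" using G(2)[of G] by simp
  finally show ?thesis using that G(1) by blast
qed

lemma tendsto_on_basis:
  fixes T :: "nat \<Rightarrow> ('a::complex_hilbert \<Rightarrow>\<^sub>L 'b::complex_hilbert)"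
  assumes e: "hilbert_basis e" and T: "\<And>n. T n \<in> bounded_ops" "\<And>n. norm (T n) \<le> M"
    and S: "S \<in> bounded_ops"
    and lim: "\<And>i. (\<lambda>n. T n (e i)) \<longlonglongrightarrow> S (e i)"
  shows "(\<lambda>n. T n x) \<longlonglongrightarrow> S x"
proof (rule LIMSEQ_I)
  fix \<epsilon> :: real assume \<epsilon>: "\<epsilon> > 0"
  define C where "C = M + norm S + 1"
  have "M \<ge> 0" using T(2)[of 0] norm_ge_zero order_trans by blast
  then have C: "C > 0" by (simp add: C_def add_nonneg_pos)
  obtain G c where G: "finite G" "norm (x - (\<Sum>i\<in>G. c i *\<^sub>C e i)) < \<epsilon> / (2 * C)"
    using basis_finite_approx[OF e, of "\<epsilon> / (2 * C)" x] \<epsilon> C by auto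
  define z where "z = (\<Sum>i\<in>G. c i *\<^sub>C e i)"
  have "(\<lambda>n. T n z) \<longlonglongrightarrow> S z"
    unfolding z_def blinfun.sum_right bounded_ops_scaleC[OF T(1)] bounded_ops_scaleC[OF S]
    by (intro tendsto_sum bounded_linear.tendsto[OF bounded_linear_scaleC] lim)
  then obtain N where N: "\<And>n. n \<ge> N \<Longrightarrow> norm (T n z - S z) < \<epsilon> / 2"
    using LIMSEQ_D[of "\<lambda>n. T n z" "S z" "\<epsilon> / 2"] \<epsilon> by auto
  have "norm (T n x - S x) < \<epsilon>" if "n \<ge> N" for n
  proof -
    have "norm (T n - S) \<le> C"
      using norm_triangle_ineq4[of "T n" S] T(2)[of n] by (simp add: C_def)
    then have "norm ((T n - S) (x - z)) \<le> C * norm (x - z)"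
      using norm_blinfun[of "T n - S" "x - z"] by (meson mult_right_mono norm_ge_zero order_trans)
    also have "\<dots> < \<epsilon> / 2" using G(2) C by (simp add: z_def field_simps)
    finally have "norm ((T n - S) (x - z)) < \<epsilon> / 2" .
    moreover have "T n x - S x = (T n - S) (x - z) + (T n z - S z)"
      by (simp add: blinfun.diff_left blinfun.diff_right)
    ultimately show ?thesis
      using N[OF that] norm_triangle_ineq[of "(T n - S) (x - z)" "T n z - S z"] by simp
  qed
  then show "\<exists>N. \<forall>n\<ge>N. norm (T n x - S x) < \<epsilon>" by blast
qed

definition basis_proj :: "('i \<Rightarrow> 'a::complex_hilbert) \<Rightarrow> 'i set \<Rightarrow> ('a \<Rightarrow>\<^sub>L 'a)" where
  "basis_proj e S = basis_map e (\<lambda>i. if i \<in> S then e i else 0)"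

context
  fixes e :: "'i \<Rightarrow> 'a::complex_hilbert"
  assumes e: "hilbert_basis e"
begin

lemma orthogonal_family_restrict: "orthogonal_family (\<lambda>i. if i \<in> S then e i else 0)"
  using e by (auto simp: orthogonal_family_def hilbert_basis_cinner)

lemma basis_proj_basis: "basis_proj e S (e i) = (if i \<in> S then e i else 0)"
  unfolding basis_proj_def by (rule basis_map_apply[OF e orthogonal_family_restrict])

lemma bounded_ops_basis_proj: "basis_proj e S \<in> bounded_ops"
  unfolding basis_proj_def by (rule bounded_ops_basis_map[OF e orthogonal_family_restrict])

lemma norm_basis_proj_le: "norm (basis_proj e S) \<le> 1"
  unfolding basis_proj_def by (rule norm_basis_map_le[OF e orthogonal_family_restrict])

lemma norm_basis_proj_apply_le: "norm (basis_proj e S x) \<le> norm x"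
  using norm_blinfun[of "basis_proj e S" x] mult_right_mono[OF norm_basis_proj_le[of S], of "norm x"]
  by simp

lemma adj_basis_proj: "adj (basis_proj e S) = basis_proj e S"
proof (rule op_eq_on_basis[OF e])
  show "adj (basis_proj e S) (e i) = basis_proj e S (e i)" for i
    by (rule hilbert_basis_eqI[OF e])
      (simp add: cinner_adj_left bounded_ops_basis_proj basis_proj_basis hilbert_basis_cinner[OF e])
qed (simp_all add: bounded_ops_basis_proj)

lemma cinner_basis_proj: "cinner (basis_proj e S x) y = cinner x (basis_proj e S y)"
  using cinner_adj_left[OF bounded_ops_basis_proj, of S x y] by (simp add: adj_basis_proj)

lemma basis_proj_compose: "basis_proj e S o\<^sub>L basis_proj e T = basis_proj e (S \<inter> T)"
  by (rule op_eq_on_basis[OF e]) (simp_all add: bounded_ops_basis_proj basis_proj_basis)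

lemma basis_proj_proj: "basis_proj e S (basis_proj e T x) = basis_proj e (S \<inter> T) x"
  by (simp flip: basis_proj_compose)

lemma basis_proj_Compl: "basis_proj e (- S) = id_blinfun - basis_proj e S"
  by (rule op_eq_on_basis[OF e]) (simp_all add: bounded_ops_basis_proj basis_proj_basis blinfun.diff_left)

lemma basis_proj_empty: "basis_proj e {} = 0"
  by (rule op_eq_on_basis[OF e]) (simp_all add: bounded_ops_basis_proj basis_proj_basis)

lemma basis_proj_disjoint_Un:
  "S \<inter> T = {} \<Longrightarrow> basis_proj e (S \<union> T) = basis_proj e S + basis_proj e T"
  by (rule op_eq_on_basis[OF e]) (auto simp: bounded_ops_basis_proj basis_proj_basis blinfun.add_left)

lemma basis_proj_finite:
  assumes "finite S" shows "basis_proj e S = (\<Sum>i\<in>S. rank_one (e i) (e i))"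
proof (rule op_eq_on_basis[OF e])
  fix j
  have "(\<Sum>i\<in>S. cinner (e j) (e i) *\<^sub>C e i) = (\<Sum>i\<in>S. if i = j then e j else 0)"
    by (rule sum.cong) (auto simp: hilbert_basis_cinner[OF e])
  then show "basis_proj e S (e j) = (\<Sum>i\<in>S. rank_one (e i) (e i)) (e j)"
    using assms by (simp add: basis_proj_basis blinfun.sum_left)
qed (simp_all add: bounded_ops_basis_proj)

lemma norm_sq_basis_proj_split:
  "(norm x)\<^sup>2 = (norm (basis_proj e S x))\<^sup>2 + (norm (basis_proj e (- S) x))\<^sup>2"
proof -
  have "cinner (basis_proj e S x) (basis_proj e (- S) x) = 0"
    by (simp add: cinner_basis_proj basis_proj_proj basis_proj_empty)
  from norm_pythagoras[OF this] show ?thesis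
    by (simp add: basis_proj_Compl blinfun.diff_left)
qed

lemma basis_proj_tendsto:
  assumes "\<And>i. \<forall>\<^sub>F n in sequentially. i \<in> T n \<longleftrightarrow> i \<in> S"
  shows "(\<lambda>n. basis_proj e (T n) x) \<longlonglongrightarrow> basis_proj e S x"
proof (rule tendsto_on_basis[OF e bounded_ops_basis_proj norm_basis_proj_le bounded_ops_basis_proj])
  show "(\<lambda>n. basis_proj e (T n) (e i)) \<longlonglongrightarrow> basis_proj e S (e i)" for i
    by (intro tendsto_eventually eventually_mono[OF assms[of i]]) (simp add: basis_proj_basis)
qed

end

definition fibre_basis :: "(nat \<Rightarrow> 'h::complex_inner) \<Rightarrow> 'x \<times> nat \<Rightarrow> ('x, 'h) ell2" where
  "fibre_basis \<xi> = (\<lambda>(x, n). delta x (\<xi> n))"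

lemma orthonormal_basis_total:
  assumes \<xi>: "orthonormal_basis \<xi>" and v: "\<And>n. cinner v (\<xi> n) = 0"
  shows "v = 0"
proof -
  have "cspan (range \<xi>) \<subseteq> {w. cinner v w = 0}"
  proof
    fix w assume "w \<in> cspan (range \<xi>)"
    then have "cinner v w = 0"
      by (induction rule: complex_vector.span_induct_alt)
        (auto simp: cinner_add_right cinner_scaleC_right v)
    then show "w \<in> {w. cinner v w = 0}" by simp
  qed
  moreover have "closed {w. cinner v w = 0}"
    by (intro closed_Collect_eq continuous_intros
        bounded_linear.continuous_on[OF bounded_bilinear.bounded_linear_right[OF bounded_bilinear_cinner]])
  ultimately have "closure (cspan (range \<xi>)) \<subseteq> {w. cinner v w = 0}" by (rule closure_minimal)
  then have "cinner v v = 0" using \<xi> by (auto simp: orthonormal_basis_def)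
  then show ?thesis by (simp add: cinner_self)
qed

lemma orthonormal_basis_hilbert_basis: "orthonormal_basis \<xi> \<Longrightarrow> hilbert_basis \<xi>"
  unfolding hilbert_basis_def using orthonormal_basis_total by (auto simp: orthonormal_basis_def)

lemma hilbert_basis_fibre_basis:
  assumes "orthonormal_basis \<xi>"
  shows "hilbert_basis (fibre_basis \<xi> :: 'x \<times> nat \<Rightarrow> ('x, 'h::complex_inner) ell2)"
  unfolding hilbert_basis_def
proof (intro conjI allI impI)
  show "cinner (fibre_basis \<xi> i) (fibre_basis \<xi> j :: ('x, 'h) ell2) = (if i = j then 1 else 0)" for i j
    using assms by (auto simp: fibre_basis_def cinner_delta_right orthonormal_basis_def split: prod.splits)
  fix v :: "('x, 'h) ell2" assume v: "\<forall>i. cinner v (fibre_basis \<xi> i) = 0"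
  have "ell2_apply v x = 0" for x
  proof (rule orthonormal_basis_total[OF assms])
    show "cinner (ell2_apply v x) (\<xi> n) = 0" for n
      using v[rule_format, of "(x, n)"] by (simp add: fibre_basis_def cinner_delta_right)
  qed
  then show "v = 0" by (intro ell2_eqI) simp
qed

section \<open>Compact operators\<close>

text \<open>Compactness of the closed image amounts to total boundedness, since the codomain is complete.\<close>

lemma compact_operator_iff:
  fixes a :: "'a::complex_inner \<Rightarrow>\<^sub>L 'b::complex_hilbert"
  shows "compact_operator a \<longleftrightarrow>
    (\<forall>e>0. \<exists>K. finite K \<and> (\<forall>x. norm x \<le> 1 \<longrightarrow> (\<exists>k\<in>K. norm (a x - k) < e)))"
  (is "_ \<longleftrightarrow> ?tb")
proof
  assume "compact_operator a"
  then have "\<forall>e>0. \<exists>K. finite K \<and> closure (a ` cball 0 1) \<subseteq> (\<Union>k\<in>K. ball k e)"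
    unfolding compact_operator_def compact_eq_totally_bounded by blast
  moreover have "a x \<in> closure (a ` cball 0 1)" if "norm x \<le> 1" for x
    using that closure_subset[of "a ` cball 0 1"] by auto
  ultimately show ?tb
    by (smt (verit, ccfv_threshold) UN_iff dist_commute dist_norm mem_ball subset_iff)
next
  assume tb: ?tb
  show "compact_operator a"
    unfolding compact_operator_def compact_eq_totally_bounded
  proof (intro conjI allI impI)
    show "complete (closure (a ` cball 0 1))" by (simp add: complete_eq_closed)
    fix e :: real assume "e > 0"
    then have "e / 2 > 0" by simp
    then obtain K where K: "finite K" "\<And>x. norm x \<le> 1 \<Longrightarrow> \<exists>k\<in>K. norm (a x - k) < e / 2"
      using tb by blast
    have "a ` cball 0 1 \<subseteq> (\<Union>k\<in>K. cball k (e / 2))"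
    proof (rule image_subsetI)
      fix x :: 'a assume "x \<in> cball 0 1"
      then obtain k where "k \<in> K" "norm (a x - k) < e / 2" using K(2)[of x] by auto
      then show "a x \<in> (\<Union>k\<in>K. cball k (e / 2))"
        by (auto simp: dist_norm norm_minus_commute intro!: bexI[of _ k])
    qed
    moreover have "closed (\<Union>k\<in>K. cball k (e / 2))" using K(1) by (intro closed_UN) auto
    ultimately have "closure (a ` cball 0 1) \<subseteq> (\<Union>k\<in>K. cball k (e / 2))" by (rule closure_minimal)
    also have "\<dots> \<subseteq> (\<Union>k\<in>K. ball k e)" using \<open>e > 0\<close> by fastforce
    finally show "\<exists>K. finite K \<and> closure (a ` cball 0 1) \<subseteq> (\<Union>k\<in>K. ball k e)" using K(1) by blast
  qed
qed

lemma compact_operatorI: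
  fixes a :: "'a::complex_inner \<Rightarrow>\<^sub>L 'b::complex_hilbert"
  assumes "\<And>e. e > 0 \<Longrightarrow> \<exists>K. finite K \<and> (\<forall>x. norm x \<le> 1 \<longrightarrow> (\<exists>k\<in>K. norm (a x - k) < e))"
  shows "compact_operator a"
  using assms compact_operator_iff by blast

lemma compact_operatorE:
  fixes a :: "'a::complex_inner \<Rightarrow>\<^sub>L 'b::complex_hilbert"
  assumes "compact_operator a" "e > 0"
  obtains K where "finite K" "\<And>x. norm x \<le> 1 \<Longrightarrow> \<exists>k\<in>K. norm (a x - k) < e"
  using assms unfolding compact_operator_iff by blast

lemma compact_operator_zero [simp]: "compact_operator (0 :: 'a::complex_inner \<Rightarrow>\<^sub>L 'b::complex_hilbert)"
  by (rule compact_operatorI) (auto intro!: exI[of _ "{0}"])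

lemma compact_operator_add:
  fixes a b :: "'a::complex_inner \<Rightarrow>\<^sub>L 'b::complex_hilbert"
  assumes "compact_operator a" "compact_operator b"
  shows "compact_operator (a + b)"
proof (rule compact_operatorI)
  fix e :: real assume "e > 0"
  then have e2: "e / 2 > 0" by simp
  obtain K where K: "finite K" "\<And>x. norm x \<le> 1 \<Longrightarrow> \<exists>k\<in>K. norm (a x - k) < e / 2"
    by (rule compact_operatorE[OF assms(1) e2]) blast
  obtain L where L: "finite L" "\<And>x. norm x \<le> 1 \<Longrightarrow> \<exists>k\<in>L. norm (b x - k) < e / 2"
    by (rule compact_operatorE[OF assms(2) e2]) blast
  have "\<exists>m\<in>(\<lambda>(k, l). k + l) ` (K \<times> L). norm ((a + b) x - m) < e" if x: "norm x \<le> 1" for x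
  proof -
    obtain k l where kl: "k \<in> K" "norm (a x - k) < e / 2" "l \<in> L" "norm (b x - l) < e / 2"
      using K(2)[OF x] L(2)[OF x] by blast
    have eq: "(a + b) x - (k + l) = (a x - k) + (b x - l)" by (simp add: blinfun.add_left)
    have "norm ((a + b) x - (k + l)) < e"
      unfolding eq using norm_triangle_ineq[of "a x - k" "b x - l"] kl by linarith
    then show ?thesis using kl by force
  qed
  then show "\<exists>K. finite K \<and> (\<forall>x. norm x \<le> 1 \<longrightarrow> (\<exists>k\<in>K. norm ((a + b) x - k) < e))"
    using K(1) L(1) by (intro exI[of _ "(\<lambda>(k, l). k + l) ` (K \<times> L)"]) simp
qed

lemma compact_operator_sum:
  fixes a :: "'i \<Rightarrow> ('a::complex_inner \<Rightarrow>\<^sub>L 'b::complex_hilbert)"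
  shows "(\<And>i. i \<in> I \<Longrightarrow> compact_operator (a i)) \<Longrightarrow> compact_operator (sum a I)"
  by (induction I rule: infinite_finite_induct) (auto intro: compact_operator_add)

lemma compact_operator_compose_left:
  fixes a :: "'a::complex_inner \<Rightarrow>\<^sub>L 'b::complex_hilbert" and b :: "'b \<Rightarrow>\<^sub>L 'c::complex_hilbert"
  assumes "compact_operator a"
  shows "compact_operator (b o\<^sub>L a)"
proof (rule compact_operatorI)
  fix e :: real assume e: "e > 0"
  have e': "e / (norm b + 1) > 0" using e by (simp add: add_nonneg_pos)
  obtain K where K: "finite K" "\<And>x. norm x \<le> 1 \<Longrightarrow> \<exists>k\<in>K. norm (a x - k) < e / (norm b + 1)"
    by (rule compact_operatorE[OF assms e']) blast
  have "\<exists>m\<in>b ` K. norm ((b o\<^sub>L a) x - m) < e" if x: "norm x \<le> 1" for x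
  proof -
    obtain k where k: "k \<in> K" "norm (a x - k) < e / (norm b + 1)" using K(2)[OF x] by blast
    have "norm (b (a x - k)) \<le> (norm b + 1) * norm (a x - k)"
      using norm_blinfun[of b "a x - k"] mult_right_mono[of "norm b" "norm b + 1" "norm (a x - k)"] by simp
    also have "\<dots> < e"
      using k(2) add_nonneg_pos[OF norm_ge_zero[of b] zero_less_one]
      by (simp only: pos_less_divide_eq mult.commute)
    finally show ?thesis using k(1) by (auto simp: blinfun.diff_right)
  qed
  then show "\<exists>K. finite K \<and> (\<forall>x. norm x \<le> 1 \<longrightarrow> (\<exists>k\<in>K. norm ((b o\<^sub>L a) x - k) < e))"
    using K(1) by (intro exI[of _ "b ` K"]) simp
qed

lemma compact_operator_compose_right:
  fixes a :: "'b::complex_inner \<Rightarrow>\<^sub>L 'c::complex_hilbert" and b :: "'a::complex_inner \<Rightarrow>\<^sub>L 'b"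
  assumes "compact_operator a"
  shows "compact_operator (a o\<^sub>L b)"
proof (rule compact_operatorI)
  fix e :: real assume e: "e > 0"
  define M where "M = norm b + 1"
  have M: "M > 0" by (simp add: M_def add_nonneg_pos)
  then have e': "e / M > 0" using e by simp
  obtain K where K: "finite K" "\<And>x. norm x \<le> 1 \<Longrightarrow> \<exists>k\<in>K. norm (a x - k) < e / M"
    by (rule compact_operatorE[OF assms e']) blast
  have "\<exists>m\<in>(\<lambda>k. M *\<^sub>R k) ` K. norm ((a o\<^sub>L b) x - m) < e" if x: "norm x \<le> 1" for x
  proof -
    have "norm (b x) \<le> M"
      using norm_blinfun[of b x] mult_left_le[OF x norm_ge_zero[of b]] by (simp add: M_def)
    then have "norm ((1 / M) *\<^sub>R b x) \<le> 1" using M by simp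
    then obtain k where k: "k \<in> K" "norm (a ((1 / M) *\<^sub>R b x) - k) < e / M" using K(2) by blast
    have "a (b x) - M *\<^sub>R k = M *\<^sub>R (a ((1 / M) *\<^sub>R b x) - k)"
      using M by (simp add: blinfun.scaleR_right scaleR_diff_right)
    then have "norm (a (b x) - M *\<^sub>R k) = M * norm (a ((1 / M) *\<^sub>R b x) - k)"
      using M by (simp only: norm_scaleR abs_of_pos)
    then have "norm (a (b x) - M *\<^sub>R k) < e" using k(2) M by (simp only: pos_less_divide_eq mult.commute)
    then show ?thesis using k(1) by auto
  qed
  then show "\<exists>K. finite K \<and> (\<forall>x. norm x \<le> 1 \<longrightarrow> (\<exists>k\<in>K. norm ((a o\<^sub>L b) x - k) < e))"
    using K(1) by (intro exI[of _ "(\<lambda>k. M *\<^sub>R k) ` K"]) simp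
qed

lemma compact_operator_limit:
  fixes a :: "'a::complex_inner \<Rightarrow>\<^sub>L 'b::complex_hilbert"
  assumes "\<And>e. e > 0 \<Longrightarrow> \<exists>b. compact_operator b \<and> norm (a - b) \<le> e"
  shows "compact_operator a"
proof (rule compact_operatorI)
  fix e :: real assume e: "e > 0"
  then obtain b where b: "compact_operator b" "norm (a - b) \<le> e / 2" using assms[of "e / 2"] by auto
  have e2: "e / 2 > 0" using e by simp
  obtain K where K: "finite K" "\<And>x. norm x \<le> 1 \<Longrightarrow> \<exists>k\<in>K. norm (b x - k) < e / 2"
    by (rule compact_operatorE[OF b(1) e2]) blast
  have "\<exists>k\<in>K. norm (a x - k) < e" if x: "norm x \<le> 1" for x
  proof -
    obtain k where k: "k \<in> K" "norm (b x - k) < e / 2" using K(2)[OF x] by blast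
    have "norm (a x - b x) \<le> e / 2"
      using norm_blinfun[of "a - b" x] mult_left_le[OF x norm_ge_zero[of "a - b"]] b(2)
      by (simp add: blinfun.diff_left)
    then have "norm (a x - k) < e"
      using norm_triangle_ineq[of "a x - b x" "b x - k"] k(2) by simp
    then show ?thesis using k(1) by blast
  qed
  then show "\<exists>K. finite K \<and> (\<forall>x. norm x \<le> 1 \<longrightarrow> (\<exists>k\<in>K. norm (a x - k) < e))" using K(1) by blast
qed

lemma compact_operator_rank_one:
  fixes \<omega> :: "'b::complex_hilbert" and \<eta> :: "'a::complex_inner"
  shows "compact_operator (rank_one \<omega> \<eta>)"
proof -
  let ?S = "(\<lambda>c::complex. c *\<^sub>C \<omega>) ` cball 0 (norm \<eta>)"
  have "bounded_linear (\<lambda>c::complex. c *\<^sub>C \<omega>)"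
  proof (rule bounded_linear_intro[where K = "norm \<omega>"])
    show "(r *\<^sub>R c) *\<^sub>C \<omega> = r *\<^sub>R (c *\<^sub>C \<omega>)" for r and c :: complex
      unfolding scaleR_scaleC[of r "c *\<^sub>C \<omega>"] by (simp add: scaleR_conv_of_real)
  qed (simp_all add: scaleC_add_left norm_scaleC)
  then have S: "compact ?S"
    by (intro compact_continuous_image linear_continuous_on compact_cball)
  have "rank_one \<omega> \<eta> ` cball 0 1 \<subseteq> ?S"
  proof (rule image_subsetI)
    fix x :: 'a assume "x \<in> cball 0 1"
    then have "cmod (cinner x \<eta>) \<le> norm \<eta>"
      using Cauchy_Schwarz_complex[of x \<eta>] mult_right_mono[of "norm x" 1 "norm \<eta>"] by simp
    then show "rank_one \<omega> \<eta> x \<in> ?S" by (auto intro!: imageI)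
  qed
  then have "closure (rank_one \<omega> \<eta> ` cball 0 1) \<subseteq> ?S"
    using S by (intro closure_minimal compact_imp_closed)
  then have "compact (?S \<inter> closure (rank_one \<omega> \<eta> ` cball 0 1))"
    using S by (intro compact_Int_closed) auto
  then show ?thesis
    using \<open>closure _ \<subseteq> ?S\<close> by (simp add: compact_operator_def Int_absorb1)
qed


section \<open>Roe algebras\<close>

lemma ulf_finite_cball:
  assumes "uniformly_locally_finite TYPE('x::metric_space)"
  shows "finite (cball (x::'x) r)"
proof -
  have "finite (cball x (max r 1))"
    using assms unfolding uniformly_locally_finite_def by (meson less_max_iff_disj zero_less_one)
  then show ?thesis by (rule rev_finite_subset) auto
qed

lemma ulf_countable:
  assumes "uniformly_locally_finite TYPE('x::metric_space)"
  shows "countable (UNIV :: 'x set)"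
proof -
  fix x0 :: 'x
  have "\<exists>n. dist x0 x \<le> real n" for x by (rule real_arch_simple)
  then have "UNIV = (\<Union>n. cball x0 (real n))" by (intro set_eqI) simp
  moreover have "countable (\<Union>n. cball x0 (real n))"
    by (rule countable_UN) (auto intro: countable_finite ulf_finite_cball[OF assms])
  ultimately show ?thesis by simp
qed

lemma norm_entry_le: "norm (entry a x y) \<le> norm a"
proof (rule norm_blinfun_bound)
  show "norm (entry a x y \<xi>) \<le> norm a * norm \<xi>" for \<xi>
    using norm_ell2_apply_le[of "a (delta x \<xi>)" y] norm_blinfun[of a "delta x \<xi>"]
    by (simp add: blinfun_apply_entry norm_delta)
qed simp

lemma entry_diff: "entry (a - b) x y = entry a x y - entry b x y"
  by (rule blinfun_eqI) (simp add: blinfun_apply_entry blinfun.diff_left ell2_apply_diff)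

lemma apply_finite_fibres:
  fixes b :: "('x, 'h::complex_inner) ell2 \<Rightarrow>\<^sub>L ('y, 'h) ell2"
  assumes "finite Z" "\<And>z. z \<notin> Z \<Longrightarrow> ell2_apply f z = 0 \<or> (\<forall>\<eta>. ell2_apply (b (delta z \<eta>)) y = 0)"
  shows "ell2_apply (b f) y = (\<Sum>z\<in>Z. ell2_apply (b (delta z (ell2_apply f z))) y)"
proof -
  define E where "E = {(z, y'). \<exists>\<eta>. ell2_apply (b (delta z \<eta>)) y' \<noteq> 0}"
  have "ell2_apply (b (f - chi Z f)) y = 0"
  proof (rule supported_apply_eq_0[of E])
    show "supported E b" by (auto simp: supported_def E_def)
    show "ell2_apply (f - chi Z f) z = 0" if "(z, y) \<in> E" for z
      using that assms(2)[of z] by (auto simp: E_def ell2_apply_diff)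
  qed
  then have "ell2_apply (b f) y = ell2_apply (b (chi Z f)) y"
    by (simp add: blinfun.diff_right ell2_apply_diff)
  then show ?thesis
    by (simp add: chi_finite_sum[OF assms(1)] blinfun.sum_right ell2_apply_sum)
qed

lemma entry_compose:
  fixes a b :: "('x, 'h::complex_hilbert) ell2 \<Rightarrow>\<^sub>L ('x, 'h) ell2"
  assumes "finite Z"
    "\<And>z. z \<notin> Z \<Longrightarrow> (\<forall>\<xi>. ell2_apply (a (delta x \<xi>)) z = 0) \<or> (\<forall>\<eta>. ell2_apply (b (delta z \<eta>)) y = 0)"
  shows "entry (b o\<^sub>L a) x y = (\<Sum>z\<in>Z. entry b z y o\<^sub>L entry a x z)"
proof (rule blinfun_eqI)
  show "entry (b o\<^sub>L a) x y \<xi> = (\<Sum>z\<in>Z. entry b z y o\<^sub>L entry a x z) \<xi>" for \<xi>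
  proof -
    have "ell2_apply (a (delta x \<xi>)) z = 0 \<or> (\<forall>\<eta>. ell2_apply (b (delta z \<eta>)) y = 0)"
      if "z \<notin> Z" for z using assms(2)[OF that] by blast
    from apply_finite_fibres[OF assms(1) this] show ?thesis
      by (simp add: blinfun_apply_entry blinfun.sum_left)
  qed
qed

lemma roe_algebra_band_dominated: "a \<in> roe_algebra \<Longrightarrow> a \<in> band_dominated"
  by (simp add: roe_algebra_def)

lemma roe_algebra_bounded_ops: "a \<in> roe_algebra \<Longrightarrow> a \<in> bounded_ops"
  by (simp add: roe_algebra_band_dominated band_dominated_bounded_ops)

lemma roe_algebra_limit:
  assumes "a \<in> band_dominated"
    and "\<And>e. e > 0 \<Longrightarrow> \<exists>c. (\<forall>x y. compact_operator (entry c x y)) \<and> norm (a - c) \<le> e"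
  shows "a \<in> roe_algebra"
  unfolding roe_algebra_def
proof (intro CollectI conjI allI assms(1) compact_operator_limit)
  fix x y and e :: real assume "e > 0"
  then obtain c where c: "\<And>x y. compact_operator (entry c x y)" "norm (a - c) \<le> e" using assms(2) by metis
  have "norm (entry a x y - entry c x y) \<le> e"
    using norm_entry_le[of "a - c" x y] c(2) by (simp add: entry_diff)
  then show "\<exists>b. compact_operator b \<and> norm (entry a x y - b) \<le> e" using c(1) by blast
qed

text \<open>A factor of finite propagation makes the entries of a product finite sums, because balls are
  finite.\<close>

lemma roe_algebra_compose:
  fixes a b :: "('x::metric_space, 'h::complex_hilbert) ell2 \<Rightarrow>\<^sub>L ('x, 'h) ell2"
  assumes ulf: "uniformly_locally_finite TYPE('x)"
    and b: "b \<in> band_dominated" and a: "a \<in> roe_algebra"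
  shows roe_algebra_compose_left: "b o\<^sub>L a \<in> roe_algebra"
    and roe_algebra_compose_right: "a o\<^sub>L b \<in> roe_algebra"
proof -
  have approx: "\<exists>s d. prop_le s d \<and> norm (b - d) * norm a \<le> e" if e: "e > 0" for e
  proof -
    have "e / (norm a + 1) > 0" using e by (simp add: add_nonneg_pos)
    then obtain s d where d: "prop_le s d" "norm (b - d) \<le> e / (norm a + 1)"
      using b unfolding band_dominated_iff approximable_def by meson
    have "norm (b - d) * norm a \<le> e / (norm a + 1) * (norm a + 1)"
      using d(2) e by (intro mult_mono) auto
    also have "\<dots> = e" by (simp add: add_nonneg_eq_0_iff)
    finally show ?thesis using d(1) by blast
  qed
  note fin = ulf_finite_cball[OF ulf]
  show "b o\<^sub>L a \<in> roe_algebra"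
  proof (rule roe_algebra_limit[OF band_dominated_compose[OF b roe_algebra_band_dominated[OF a]]])
    fix e :: real assume "e > 0"
    then obtain s d where d: "prop_le s d" "norm (b - d) * norm a \<le> e" using approx by blast
    have "entry (d o\<^sub>L a) x y = (\<Sum>z\<in>cball y s. entry d z y o\<^sub>L entry a x z)" for x y
    proof (rule entry_compose[OF fin])
      show "(\<forall>\<xi>. ell2_apply (a (delta x \<xi>)) z = 0) \<or> (\<forall>\<eta>. ell2_apply (d (delta z \<eta>)) y = 0)"
        if "z \<notin> cball y s" for z
        using d(1) that supportedD[of "band s" d z y] by (auto simp: prop_le_def dist_commute)
    qed
    then have "compact_operator (entry (d o\<^sub>L a) x y)" for x y
      using a by (auto intro!: compact_operator_sum compact_operator_compose_left simp: roe_algebra_def)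
    moreover have "(b o\<^sub>L a) - (d o\<^sub>L a) = (b - d) o\<^sub>L a"
      by (rule blinfun_eqI) (simp add: blinfun.diff_left)
    then have "norm ((b o\<^sub>L a) - (d o\<^sub>L a)) \<le> e"
      using norm_blinfun_compose[of "b - d" a] d(2) by simp
    ultimately show "\<exists>c. (\<forall>x y. compact_operator (entry c x y)) \<and> norm ((b o\<^sub>L a) - c) \<le> e" by blast
  qed
  show "a o\<^sub>L b \<in> roe_algebra"
  proof (rule roe_algebra_limit[OF band_dominated_compose[OF roe_algebra_band_dominated[OF a] b]])
    fix e :: real assume "e > 0"
    then obtain s d where d: "prop_le s d" "norm (b - d) * norm a \<le> e" using approx by blast
    have "entry (a o\<^sub>L d) x y = (\<Sum>z\<in>cball x s. entry a z y o\<^sub>L entry d x z)" for x y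
    proof (rule entry_compose[OF fin])
      show "(\<forall>\<xi>. ell2_apply (d (delta x \<xi>)) z = 0) \<or> (\<forall>\<eta>. ell2_apply (a (delta z \<eta>)) y = 0)"
        if "z \<notin> cball x s" for z
        using d(1) that supportedD[of "band s" d x z] by (auto simp: prop_le_def)
    qed
    then have "compact_operator (entry (a o\<^sub>L d) x y)" for x y
      using a by (auto intro!: compact_operator_sum compact_operator_compose_right simp: roe_algebra_def)
    moreover have "(a o\<^sub>L b) - (a o\<^sub>L d) = a o\<^sub>L (b - d)"
      by (rule blinfun_eqI) (simp add: blinfun.diff_left blinfun.diff_right)
    then have "norm ((a o\<^sub>L b) - (a o\<^sub>L d)) \<le> e"
      using norm_blinfun_compose[of a "b - d"] d(2) by (simp add: mult.commute)
    ultimately show "\<exists>c. (\<forall>x y. compact_operator (entry c x y)) \<and> norm ((a o\<^sub>L b) - c) \<le> e" by blast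
  qed
qed

lemma finite_times_subset_band:
  fixes F G :: "'x::metric_space set"
  assumes "finite F" "finite G"
  obtains s where "s \<ge> 0" "F \<times> G \<subseteq> band s"
proof
  let ?D = "insert 0 ((\<lambda>(x, y). dist x y) ` (F \<times> G))"
  show "Max ?D \<ge> 0" using assms by (intro Max_ge) auto
  show "F \<times> G \<subseteq> band (Max ?D)" using assms by (auto intro!: Max_ge)
qed

lemma rank_one_roe_algebra:
  fixes \<omega> \<eta> :: "('x::metric_space, 'h::complex_hilbert) ell2"
  shows "rank_one \<omega> \<eta> \<in> roe_algebra"
  unfolding roe_algebra_def
proof (intro CollectI conjI allI)
  fix x y
  have "entry (rank_one \<omega> \<eta>) x y = rank_one (ell2_apply \<omega> y) (ell2_apply \<eta> x)"
    by (rule blinfun_eqI) (simp add: blinfun_apply_entry cinner_delta_left ell2_apply_scaleC)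
  then show "compact_operator (entry (rank_one \<omega> \<eta>) x y)" by (simp add: compact_operator_rank_one)
next
  show "rank_one \<omega> \<eta> \<in> band_dominated"
  proof (rule band_dominated_limit)
    fix e :: real assume e: "e > 0"
    define K where "K = norm \<omega> + norm \<eta> + 1"
    have K: "K > 0" by (simp add: K_def add_nonneg_pos)
    then have "e / K > 0" using e by simp
    obtain F where F: "finite F" "\<And>H. F \<subseteq> H \<Longrightarrow> norm (\<omega> - chi H \<omega>) < e / K"
      by (rule finite_chi_approx[OF \<open>e / K > 0\<close>]) blast
    obtain G where G: "finite G" "\<And>H. G \<subseteq> H \<Longrightarrow> norm (\<eta> - chi H \<eta>) < e / K"
      by (rule finite_chi_approx[OF \<open>e / K > 0\<close>]) blast
    define b where "b = rank_one (chi F \<omega>) (chi G \<eta>)"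
    obtain s where s: "G \<times> F \<subseteq> band s" by (rule finite_times_subset_band[OF G(1) F(1)]) (rule that)
    have "supported (G \<times> F) b"
      by (auto simp: supported_def b_def cinner_delta_left ell2_apply_scaleC)
    then have "prop_le s b" using supported_mono[OF _ s] by (simp add: prop_le_def b_def)
    then have "b \<in> band_dominated" by (rule prop_le_band_dominated)
    moreover have "norm (rank_one \<omega> \<eta> - b) \<le> e"
    proof -
      have eq: "rank_one \<omega> \<eta> - b = rank_one (\<omega> - chi F \<omega>) \<eta> + rank_one (chi F \<omega>) (\<eta> - chi G \<eta>)"
        by (rule blinfun_eqI)
          (simp add: b_def blinfun.diff_left blinfun.add_left cinner_diff_right
            complex_vector.scale_right_diff_distrib complex_vector.scale_left_diff_distrib)
      have "norm (rank_one \<omega> \<eta> - b) \<le> norm (\<omega> - chi F \<omega>) * norm \<eta> + norm (chi F \<omega>) * norm (\<eta> - chi G \<eta>)"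
        unfolding eq by (rule order_trans[OF norm_triangle_ineq add_mono[OF norm_rank_one_le norm_rank_one_le]])
      also have "\<dots> \<le> e / K * norm \<eta> + norm \<omega> * (e / K)"
        using F(2)[of F] G(2)[of G] less_imp_le[OF \<open>e / K > 0\<close>]
        by (intro add_mono mult_mono) (auto simp: norm_chi_apply_le)
      also have "\<dots> = e / K * (norm \<omega> + norm \<eta>)" by (simp add: algebra_simps)
      also have "\<dots> \<le> e / K * K" using \<open>e / K > 0\<close> by (intro mult_left_mono) (auto simp: K_def)
      also have "\<dots> = e" using K by simp
      finally show ?thesis .
    qed
    ultimately show "\<exists>b\<in>band_dominated. norm (rank_one \<omega> \<eta> - b) \<le> e" by blast
  qed
qed

lemma bounded_ops_entry: "a \<in> bounded_ops \<Longrightarrow> entry a x y \<in> bounded_ops"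
  by (rule bounded_opsI) (simp add: blinfun_apply_entry delta_scaleC bounded_ops_scaleC ell2_apply_scaleC)

lemma supported_basisI:
  fixes T :: "('x, 'h::complex_hilbert) ell2 \<Rightarrow>\<^sub>L ('y, 'h) ell2"
  assumes \<xi>: "orthonormal_basis \<xi>" and T: "T \<in> bounded_ops"
    and E: "\<And>x y n. (x, y) \<notin> E \<Longrightarrow> ell2_apply (T (delta x (\<xi> n))) y = 0"
  shows "supported E T"
  unfolding supported_def
proof (intro allI impI)
  fix x y \<eta> assume xy: "(x, y) \<notin> E"
  have "ell2_apply (adj T (delta y \<theta>)) x = 0" for \<theta>
  proof (rule orthonormal_basis_total[OF \<xi>])
    fix n
    have "cinner (ell2_apply (adj T (delta y \<theta>)) x) (\<xi> n) = cinner (adj T (delta y \<theta>)) (delta x (\<xi> n))"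
      by (simp add: cinner_delta_right)
    then show "cinner (ell2_apply (adj T (delta y \<theta>)) x) (\<xi> n) = 0"
      by (simp add: cinner_adj_left[OF T] cinner_delta_left E[OF xy])
  qed
  then have "cinner (ell2_apply (T (delta x \<eta>)) y) \<theta> = cinner 0 \<theta>" for \<theta>
    using cinner_adj_right[OF T, of "delta x \<eta>" "delta y \<theta>"]
    by (simp add: cinner_delta_right cinner_delta_left)
  then show "ell2_apply (T (delta x \<eta>)) y = 0" by (rule cinner_eqI)
qed

lemma norm_diagonal_le:
  fixes t :: "'a::complex_hilbert \<Rightarrow>\<^sub>L 'a"
  assumes e: "hilbert_basis e" and t: "t \<in> bounded_ops" "\<And>i. t (e i) = l i *\<^sub>C e i"
    and l: "\<And>i. cmod (l i) \<le> c" and c: "c > 0"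
  shows "norm t \<le> c"
proof -
  define f where "f i = (l i / complex_of_real c) *\<^sub>C e i" for i
  have f: "orthogonal_family f"
    using l c by (auto simp: orthogonal_family_def f_def hilbert_basis_cinner[OF e] cinner_scaleC_left
        cinner_scaleC_right norm_scaleC norm_hilbert_basis[OF e] norm_divide)
  have "t = op_scaleC (complex_of_real c) (basis_map e f)"
    by (rule op_eq_on_basis[OF e])
      (use c in \<open>simp_all add: t bounded_ops_basis_map[OF e f] basis_map_apply[OF e f] f_def\<close>)
  then have "norm t \<le> c * norm (basis_map e f)"
    using norm_op_scaleC_le[of "complex_of_real c" "basis_map e f"] c by simp
  also have "\<dots> \<le> c" using norm_basis_map_le[OF e f] c by simp
  finally show ?thesis .
qed

lemma compact_operator_diagonal:
  fixes t :: "'h::complex_hilbert \<Rightarrow>\<^sub>L 'h" and \<xi> :: "nat \<Rightarrow> 'h"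
  assumes e: "hilbert_basis \<xi>" and t: "t \<in> bounded_ops" "\<And>n. t (\<xi> n) = l n *\<^sub>C \<xi> n"
    and l: "l \<longlonglongrightarrow> 0"
  shows "compact_operator t"
proof (rule compact_operator_limit)
  fix c :: real assume c: "c > 0"
  obtain N where N: "\<And>n. n \<ge> N \<Longrightarrow> cmod (l n) < c" using LIMSEQ_D[OF l c] by auto
  define b where "b = (t o\<^sub>L basis_proj \<xi> {..<N})"
  have "b = (\<Sum>i<N. t o\<^sub>L rank_one (\<xi> i) (\<xi> i))"
    by (rule blinfun_eqI) (simp add: b_def basis_proj_finite[OF e] blinfun.sum_left blinfun.sum_right)
  then have "compact_operator b"
    by (auto intro!: compact_operator_sum compact_operator_compose_left compact_operator_rank_one)
  moreover have "norm (t - b) \<le> c"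
  proof (rule norm_diagonal_le[OF e _ _ _ c])
    show "t - b \<in> bounded_ops" by (simp add: t b_def bounded_ops_basis_proj[OF e])
    show "(t - b) (\<xi> n) = (if n < N then 0 else l n) *\<^sub>C \<xi> n" for n
      by (simp add: b_def blinfun.diff_left t basis_proj_basis[OF e])
    show "cmod (if n < N then 0 else l n) \<le> c" for n
      using N[of n] c by (cases "n < N") auto
  qed
  ultimately show "\<exists>b. compact_operator b \<and> norm (t - b) \<le> c" by blast
qed

lemma ell_infty_subset_roe_algebra:
  fixes a :: "('x::metric_space, 'h::complex_hilbert) ell2 \<Rightarrow>\<^sub>L ('x, 'h) ell2"
  assumes \<xi>: "orthonormal_basis \<xi>" and a: "a \<in> ell_infty \<xi>"
  shows "prop_le 0 a" "a \<in> roe_algebra"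
proof -
  note e = orthonormal_basis_hilbert_basis[OF \<xi>]
  have ab: "a \<in> bounded_ops"
    and diag: "\<And>x. \<exists>l. l \<longlonglongrightarrow> 0 \<and> (\<forall>n. a (delta x (\<xi> n)) = l n *\<^sub>C delta x (\<xi> n))"
    using a by (auto simp: ell_infty_def)
  have supp: "supported (band 0) a"
  proof (rule supported_basisI[OF \<xi> ab])
    fix x y :: 'x and n assume "(x, y) \<notin> band 0"
    moreover obtain l where "\<forall>n. a (delta x (\<xi> n)) = l n *\<^sub>C delta x (\<xi> n)" using diag by blast
    ultimately show "ell2_apply (a (delta x (\<xi> n))) y = 0" by (auto simp: ell2_apply_scaleC)
  qed
  have off: "entry a x y = 0" if "x \<noteq> y" for x y
    by (rule blinfun_eqI) (use that supportedD[OF supp, of x y] in \<open>simp add: blinfun_apply_entry\<close>)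
  show p: "prop_le 0 a" using ab supp by (simp add: prop_le_def)
  have "compact_operator (entry a x y)" for x y
  proof (cases "x = y")
    case True
    obtain l where "l \<longlonglongrightarrow> 0" "\<forall>n. a (delta x (\<xi> n)) = l n *\<^sub>C delta x (\<xi> n)" using diag by blast
    then show ?thesis
      by (intro compact_operator_diagonal[OF e bounded_ops_entry[OF ab], of _ _ l])
        (simp_all add: True blinfun_apply_entry ell2_apply_scaleC)
  qed (simp add: off)
  then show "a \<in> roe_algebra" using prop_le_band_dominated[OF p] by (simp add: roe_algebra_def)
qed

lemma basis_proj_ell_infty:
  assumes \<xi>: "orthonormal_basis \<xi>" and S: "\<And>x. finite {n. (x, n) \<in> S}"
  shows "basis_proj (fibre_basis \<xi>) S \<in> ell_infty \<xi>"
  unfolding ell_infty_def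
proof (intro CollectI conjI allI)
  note e = hilbert_basis_fibre_basis[OF \<xi>]
  show "basis_proj (fibre_basis \<xi>) S \<in> bounded_ops" by (rule bounded_ops_basis_proj[OF e])
  fix x
  let ?l = "\<lambda>n. if (x, n) \<in> S then 1 else 0"
  have "\<forall>\<^sub>F n in cofinite. (x, n) \<notin> S" using S[of x] by (simp add: eventually_cofinite)
  then have "\<forall>\<^sub>F n in sequentially. ?l n = 0"
    unfolding cofinite_eq_sequentially by (rule eventually_mono) simp
  then have "?l \<longlonglongrightarrow> 0" by (rule tendsto_eventually)
  moreover have "basis_proj (fibre_basis \<xi>) S (delta x (\<xi> n)) = ?l n *\<^sub>C delta x (\<xi> n)" for n
    using basis_proj_basis[OF e, of S "(x, n)"] by (simp add: fibre_basis_def)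
  ultimately show "\<exists>l. l \<longlonglongrightarrow> 0 \<and>
      (\<forall>n. basis_proj (fibre_basis \<xi>) S (delta x (\<xi> n)) = l n *\<^sub>C delta x (\<xi> n))" by blast
qed

lemma chi_basis_proj:
  assumes \<xi>: "orthonormal_basis \<xi>"
  shows "chi A = basis_proj (fibre_basis \<xi>) (A \<times> UNIV)"
proof (rule op_eq_on_basis[OF hilbert_basis_fibre_basis[OF \<xi>]])
  note e = hilbert_basis_fibre_basis[OF \<xi>]
  show "chi A (fibre_basis \<xi> i) = basis_proj (fibre_basis \<xi>) (A \<times> UNIV) (fibre_basis \<xi> i)" for i
    unfolding basis_proj_basis[OF e] by (auto simp: fibre_basis_def chi_delta split: prod.splits)
qed (simp_all add: bounded_ops_basis_proj[OF hilbert_basis_fibre_basis[OF \<xi>]])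

section \<open>Unitary maps and conjugation\<close>

definition unitary_map :: "('a::complex_hilbert \<Rightarrow>\<^sub>L 'b::complex_hilbert) \<Rightarrow> bool" where
  "unitary_map u \<longleftrightarrow> u \<in> bounded_ops \<and> adj u o\<^sub>L u = id_blinfun \<and> u o\<^sub>L adj u = id_blinfun"

lemma unitary_map_bounded_ops [simp]: "unitary_map u \<Longrightarrow> u \<in> bounded_ops"
  by (simp add: unitary_map_def)

lemma unitary_map_adj: "unitary_map u \<Longrightarrow> unitary_map (adj u)"
  by (simp add: unitary_map_def)

lemma unitary_map_adj_apply [simp]: "unitary_map u \<Longrightarrow> adj u (u x) = x"
  by (metis blinfun_apply_blinfun_compose id_blinfun.rep_eq unitary_map_def)

lemma unitary_map_apply_adj [simp]: "unitary_map u \<Longrightarrow> u (adj u x) = x"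
  by (metis blinfun_apply_blinfun_compose id_blinfun.rep_eq unitary_map_def)

lemma unitary_map_compose: "unitary_map u \<Longrightarrow> unitary_map v \<Longrightarrow> unitary_map (u o\<^sub>L v)"
  unfolding unitary_map_def
  by (intro conjI blinfun_eqI) (simp_all add: adj_compose flip: unitary_map_def)

lemma norm_unitary_map_apply [simp]:
  assumes "unitary_map u" shows "norm (u x) = norm x"
proof -
  have "cinner (u x) (u x) = cinner x x"
    using cinner_adj_right[of u x "u x"] assms by simp
  then show ?thesis by (metis norm_sq_cinner norm_ge_zero power2_eq_imp_eq)
qed

lemma norm_unitary_map_le: "unitary_map u \<Longrightarrow> norm u \<le> 1"
  by (rule norm_blinfun_bound) simp_all

definition conjugate :: "('a::complex_hilbert \<Rightarrow>\<^sub>L 'b::complex_hilbert) \<Rightarrow> ('a \<Rightarrow>\<^sub>L 'a) \<Rightarrow> ('b \<Rightarrow>\<^sub>L 'b)" where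
  "conjugate u a = (u o\<^sub>L a o\<^sub>L adj u)"

lemma conjugate_apply [simp]: "conjugate u a x = u (a (adj u x))"
  by (simp add: conjugate_def)

lemma conjugate_bounded_ops [simp]: "u \<in> bounded_ops \<Longrightarrow> a \<in> bounded_ops \<Longrightarrow> conjugate u a \<in> bounded_ops"
  by (simp add: conjugate_def)

lemma conjugate_compose: "unitary_map u \<Longrightarrow> conjugate u (a o\<^sub>L b) = conjugate u a o\<^sub>L conjugate u b"
  by (rule blinfun_eqI) simp

lemma conjugate_add: "conjugate u (a + b) = conjugate u a + conjugate u b"
  by (rule blinfun_eqI) (simp add: blinfun.add_left blinfun.add_right)

lemma conjugate_diff: "conjugate u (a - b) = conjugate u a - conjugate u b"
  by (rule blinfun_eqI) (simp add: blinfun.diff_left blinfun.diff_right)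

lemma conjugate_zero [simp]: "conjugate u 0 = 0"
  by (rule blinfun_eqI) simp

lemma conjugate_sum: "conjugate u (sum a I) = (\<Sum>i\<in>I. conjugate u (a i))"
  by (induction I rule: infinite_finite_induct) (simp_all add: conjugate_add)

lemma conjugate_op_scaleC:
  "u \<in> bounded_ops \<Longrightarrow> conjugate u (op_scaleC c a) = op_scaleC c (conjugate u a)"
  by (rule blinfun_eqI) (simp add: bounded_ops_scaleC)

lemma conjugate_adj:
  assumes "u \<in> bounded_ops" "a \<in> bounded_ops"
  shows "conjugate u (adj a) = adj (conjugate u a)"
  unfolding conjugate_def by (rule blinfun_eqI) (simp add: adj_compose assms)

lemma conjugate_adj_conjugate [simp]: "unitary_map u \<Longrightarrow> conjugate (adj u) (conjugate u a) = a"
  by (rule blinfun_eqI) simp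

lemma conjugate_conjugate_adj [simp]: "unitary_map u \<Longrightarrow> conjugate u (conjugate (adj u) a) = a"
  by (rule blinfun_eqI) simp

lemma norm_conjugate_le:
  assumes "unitary_map u" shows "norm (conjugate u a) \<le> norm a"
proof (rule norm_blinfun_bound)
  show "norm (conjugate u a x) \<le> norm a * norm x" for x
    using norm_blinfun[of a "adj u x"] assms by (simp add: unitary_map_adj)
qed simp

lemma conjugate_rank_one:
  assumes "unitary_map u" shows "conjugate u (rank_one \<omega> \<eta>) = rank_one (u \<omega>) (u \<eta>)"
  by (rule blinfun_eqI) (use assms in \<open>simp add: cinner_adj_left bounded_ops_scaleC\<close>)

text \<open>A star isomorphism of Roe algebras preserves rank-one projections, because these are the
  nonzero projections \<open>p\<close> with \<open>p A p = \<complex> p\<close>. Choosing one of them in the domain identifies the two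
  Hilbert spaces.\<close>

lemma star_isomorphism_spatial:
  fixes \<Phi> :: "(('x::metric_space, 'h::complex_hilbert) ell2 \<Rightarrow>\<^sub>L ('x, 'h) ell2)
      \<Rightarrow> (('y::metric_space, 'h) ell2 \<Rightarrow>\<^sub>L ('y, 'h) ell2)"
  assumes \<Phi>: "star_isomorphism \<Phi> roe_algebra roe_algebra" and h: "norm (h::'h) = 1"
  obtains u where "unitary_map u" "\<And>a. a \<in> roe_algebra \<Longrightarrow> \<Phi> a = conjugate u a"
proof -
  have bij: "bij_betw \<Phi> roe_algebra roe_algebra"
    and add: "\<And>a b. a \<in> roe_algebra \<Longrightarrow> b \<in> roe_algebra \<Longrightarrow> \<Phi> (a + b) = \<Phi> a + \<Phi> b"
    and mult: "\<And>a b. a \<in> roe_algebra \<Longrightarrow> b \<in> roe_algebra \<Longrightarrow> \<Phi> (a o\<^sub>L b) = \<Phi> a o\<^sub>L \<Phi> b"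
    and scale: "\<And>c a. a \<in> roe_algebra \<Longrightarrow> \<Phi> (op_scaleC c a) = op_scaleC c (\<Phi> a)"
    and adj: "\<And>a. a \<in> roe_algebra \<Longrightarrow> \<Phi> (adj a) = adj (\<Phi> a)"
    using \<Phi> by (auto simp: star_isomorphism_def)
  have \<Phi>_roe: "\<Phi> a \<in> roe_algebra" if "a \<in> roe_algebra" for a
    using bij that by (auto simp: bij_betw_def)
  have \<Phi>_bdd: "\<Phi> a \<in> bounded_ops" if "a \<in> roe_algebra" for a
    using \<Phi>_roe[OF that] by (rule roe_algebra_bounded_ops)
  have \<Phi>_onto: "\<exists>a. a \<in> roe_algebra \<and> \<Phi> a = b" if "b \<in> roe_algebra" for b
    using that unfolding bij_betw_imp_surj_on[OF bij, symmetric] by blast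
  note R = rank_one_roe_algebra
  fix x0 :: 'x
  define e :: "('x, 'h) ell2" where "e = delta x0 h"
  have e: "cinner e e = 1" using h by (simp add: e_def cinner_self norm_delta)
  have pbp: "rank_one e e o\<^sub>L b o\<^sub>L rank_one e e = op_scaleC (cinner (b e) e) (rank_one e e)"
    if "b \<in> bounded_ops" for b
    using that by (intro blinfun_eqI) (simp add: bounded_ops_scaleC cinner_scaleC_left mult.commute)
  \<comment> \<open>The projection \<open>q\<close> inherits \<open>q B q = \<complex> q\<close>, so the rank-one projection \<open>|f\<rangle>\<langle>f|\<close> below \<open>q\<close> equals \<open>q\<close>.\<close>
  define q where "q = \<Phi> (rank_one e e)"
  have q_roe: "q \<in> roe_algebra" and q_bdd: "q \<in> bounded_ops"
    by (simp_all add: q_def \<Phi>_roe \<Phi>_bdd R)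
  have "rank_one e e o\<^sub>L rank_one e e = rank_one e e"
    by (rule blinfun_eqI) (simp add: cinner_scaleC_left e)
  then have qq: "q o\<^sub>L q = q" using mult[OF R R, of e e e e] by (simp add: q_def)
  have q_adj: "adj q = q" using adj[OF R, of e e] by (simp add: q_def)
  have "\<Phi> 0 = op_scaleC 0 (\<Phi> (rank_one e e))"
    using scale[OF R, of 0 e e]
    by (metis (no_types, lifting) blinfun_eqI complex_vector.scale_zero_left op_scaleC_apply zero_blinfun.rep_eq)
  then have \<Phi>0: "\<Phi> 0 = 0" by (simp add: blinfun_eqI)
  have "rank_one e e \<noteq> 0" using e
    by (metis cinner_zero_left norm_eq_1_cinner norm_zero rank_one_apply complex_vector.scale_one zero_blinfun.rep_eq zero_neq_one)
  moreover have "(0 :: ('x, 'h) ell2 \<Rightarrow>\<^sub>L ('x, 'h) ell2) \<in> roe_algebra"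
    using R[of 0 0] by (metis (no_types, lifting) blinfun_eqI cinner_zero_right complex_vector.scale_zero_left rank_one_apply zero_blinfun.rep_eq)
  ultimately have "q \<noteq> 0"
    using bij R[of e e] \<Phi>0 unfolding bij_betw_def inj_on_def q_def by metis
  then obtain g where g: "q g \<noteq> 0" by (metis blinfun_eqI zero_blinfun.rep_eq)
  define f where "f = complex_of_real (1 / norm (q g)) *\<^sub>C q g"
  have "q (q g) = q g" using qq by (metis blinfun_apply_blinfun_compose)
  then have qf: "q f = f" by (simp add: f_def bounded_ops_scaleC[OF q_bdd])
  have "norm f = 1" using g by (simp add: f_def norm_scaleC norm_divide)
  then have f: "cinner f f = 1" by (simp add: cinner_self)
  have q: "q = rank_one f f"
  proof -
    obtain a where a: "a \<in> roe_algebra" "\<Phi> a = rank_one f f"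
      using \<Phi>_onto[OF R] by blast
    have "rank_one f f = q o\<^sub>L rank_one f f o\<^sub>L q"
      using q_bdd by (intro blinfun_eqI) (simp add: bounded_ops_scaleC qf cinner_adj_left[symmetric] q_adj
          flip: cinner_adj_right)
    also have "\<dots> = \<Phi> (rank_one e e o\<^sub>L a o\<^sub>L rank_one e e)"
    proof -
      have "rank_one e e o\<^sub>L a \<in> roe_algebra"
        by (simp add: rank_one_compose roe_algebra_bounded_ops[OF a(1)] R)
      then show ?thesis by (simp only: mult[OF _ R] mult[OF R a(1)] q_def a(2))
    qed
    also have "\<dots> = op_scaleC (cinner (a e) e) q"
      by (simp add: pbp[OF roe_algebra_bounded_ops[OF a(1)]] scale R q_def)
    finally have *: "rank_one f f = op_scaleC (cinner (a e) e) q" .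
    have "f = cinner (a e) e *\<^sub>C f"
      using arg_cong[OF *, of "\<lambda>t. t f"] by (simp add: f qf)
    then have "cinner (a e) e = 1"
      using arg_cong[of _ _ "\<lambda>t. cinner t f"] by (metis cinner_scaleC_left f mult.right_neutral)
    then show ?thesis using * by (simp add: blinfun_eqI)
  qed
  \<comment> \<open>The operators \<open>|\<omega>\<rangle>\<langle>e|\<close> form a copy of the Hilbert space on which the algebra acts by left multiplication.\<close>
  define U where "U \<omega> = \<Phi> (rank_one \<omega> e) f" for \<omega>
  have U_inner: "cinner (U \<omega>) (U \<omega>') = cinner \<omega> \<omega>'" for \<omega> \<omega>'
  proof -
    have eq: "rank_one e \<omega>' o\<^sub>L rank_one \<omega> e = op_scaleC (cinner \<omega> \<omega>') (rank_one e e)"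
      by (rule blinfun_eqI) (simp add: cinner_scaleC_left mult.commute)
    have "adj (\<Phi> (rank_one \<omega>' e)) = \<Phi> (rank_one e \<omega>')"
      using adj[OF R, of \<omega>' e] by simp
    then have "adj (\<Phi> (rank_one \<omega>' e)) o\<^sub>L \<Phi> (rank_one \<omega> e) = op_scaleC (cinner \<omega> \<omega>') q"
      by (simp only: mult[OF R R, symmetric] eq scale[OF R] q_def)
    then have "adj (\<Phi> (rank_one \<omega>' e)) (\<Phi> (rank_one \<omega> e) f) = cinner \<omega> \<omega>' *\<^sub>C f"
      by (metis blinfun_apply_blinfun_compose op_scaleC_apply qf)
    then show ?thesis
      unfolding U_def using cinner_adj_left[OF \<Phi>_bdd[OF R[of \<omega>' e]], of "\<Phi> (rank_one \<omega> e) f" f]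
      by (simp add: cinner_scaleC_left f)
  qed
  have U_scale: "U (c *\<^sub>C \<omega>) = c *\<^sub>C U \<omega>" for c \<omega>
  proof -
    have "rank_one (c *\<^sub>C \<omega>) e = op_scaleC c (rank_one \<omega> e)"
      by (rule blinfun_eqI) (simp add: mult.commute)
    then show ?thesis by (simp add: U_def scale[OF R])
  qed
  have "bounded_linear U"
  proof (rule bounded_linear_intro[where K = 1])
    show "U (\<omega> + \<omega>') = U \<omega> + U \<omega>'" for \<omega> \<omega>'
    proof -
      have "rank_one (\<omega> + \<omega>') e = rank_one \<omega> e + rank_one \<omega>' e"
        by (rule blinfun_eqI) (simp add: blinfun.add_left scaleC_add_right)
      then show ?thesis by (simp add: U_def add[OF R R] blinfun.add_left)
    qed
    show "U (r *\<^sub>R \<omega>) = r *\<^sub>R U \<omega>" for r \<omega> by (simp add: scaleR_scaleC U_scale)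
    show "norm (U \<omega>) \<le> norm \<omega> * 1" for \<omega>
      using U_inner[of \<omega> \<omega>] by (metis mult.right_neutral norm_sq_cinner norm_ge_zero order_refl power2_eq_imp_eq)
  qed
  then obtain u where u: "\<And>\<omega>. blinfun_apply u \<omega> = U \<omega>" by (metis bounded_linear_Blinfun_apply)
  have u_bdd: "u \<in> bounded_ops" by (rule bounded_opsI) (simp add: u U_scale)
  have inj: "adj u o\<^sub>L u = id_blinfun"
  proof (rule op_eqI_cinner)
    show "cinner ((adj u o\<^sub>L u) x) y = cinner (id_blinfun x) y" for x y
      by (simp add: cinner_adj_left u_bdd u U_inner)
  qed
  have intertwine: "u (a \<omega>) = \<Phi> a (u \<omega>)" if a: "a \<in> roe_algebra" for a \<omega>
    using mult[OF a R, of \<omega> e]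
    by (simp add: u U_def compose_rank_one[OF roe_algebra_bounded_ops[OF a]])
  have surj: "\<exists>\<omega>. u \<omega> = \<eta>" for \<eta>
  proof -
    obtain b where b: "b \<in> roe_algebra" "\<Phi> b = rank_one \<eta> f"
      using \<Phi>_onto[OF R] by blast
    have "u e = f" by (simp add: u U_def qf flip: q_def)
    then have "u (b e) = \<eta>" using intertwine[OF b(1), of e] b(2) f by simp
    then show ?thesis by blast
  qed
  have id1: "adj u (u x) = x" for x
    using inj by (metis blinfun_apply_blinfun_compose id_blinfun.rep_eq)
  have "u o\<^sub>L adj u = id_blinfun"
  proof (rule blinfun_eqI)
    fix \<eta>
    obtain \<omega> where "\<eta> = u \<omega>" using surj by metis
    then show "(u o\<^sub>L adj u) \<eta> = id_blinfun \<eta>" by (simp add: id1)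
  qed
  with inj u_bdd have un: "unitary_map u" by (simp add: unitary_map_def)
  have "\<Phi> a = conjugate u a" if "a \<in> roe_algebra" for a
    by (rule blinfun_eqI) (simp add: intertwine[OF that] un)
  with un show ?thesis by (rule that)
qed


section \<open>A Baire category argument\<close>

text \<open>The Baire category theorem in the form of the recursion that proves it: \<open>agree n\<close> plays the
  part of a neighbourhood base.\<close>

lemma baire_alternative:
  fixes D :: "nat \<Rightarrow> 'a \<Rightarrow> bool" and agree :: "nat \<Rightarrow> 'a \<Rightarrow> 'a \<Rightarrow> bool"
  assumes ne: "c0 \<in> C"
    and cover: "\<And>a. a \<in> C \<Longrightarrow> \<exists>s. D s a"
    and closed: "\<And>s a. a \<in> C \<Longrightarrow> \<not> D s a \<Longrightarrow> \<exists>n. \<forall>b\<in>C. agree n a b \<longrightarrow> \<not> D s b"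
    and antimono: "\<And>m n a b. agree n a b \<Longrightarrow> m \<le> n \<Longrightarrow> agree m a b"
    and complete: "\<And>a m. (\<And>k. a k \<in> C) \<Longrightarrow> (\<And>k. agree (m k) (a k) (a (Suc k))) \<Longrightarrow>
      strict_mono m \<Longrightarrow> \<exists>b\<in>C. \<forall>k. agree (m k) (a k) b"
  obtains s n a where "a \<in> C" "\<And>b. b \<in> C \<Longrightarrow> agree n a b \<Longrightarrow> D s b"
proof (rule ccontr)
  note thesisI = that
  assume "\<not> thesis"
  then have bad: "\<exists>b\<in>C. agree n a b \<and> \<not> D s b" if "a \<in> C" for s n a
    using thesisI[OF that, of n s] by blast
  let ?Q = "\<lambda>k p p'. agree (snd p) (fst p) (fst p') \<and> snd p < snd p' \<and>
    (\<forall>b\<in>C. agree (snd p') (fst p') b \<longrightarrow> \<not> D k b)"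
  have "\<exists>f. \<forall>k. fst (f k) \<in> C \<and> ?Q k (f k) (f (Suc k))"
  proof (rule dependent_nat_choice)
    show "\<exists>p :: 'a \<times> nat. fst p \<in> C" using ne by (intro exI[of _ "(c0, 0)"]) simp
    fix p :: "'a \<times> nat" and k assume "fst p \<in> C"
    then obtain b where b: "b \<in> C" "agree (snd p) (fst p) b" "\<not> D k b" using bad by blast
    then obtain n where n: "\<forall>b'\<in>C. agree n b b' \<longrightarrow> \<not> D k b'" using closed by blast
    show "\<exists>p'. fst p' \<in> C \<and> ?Q k p p'"
      by (rule exI[of _ "(b, Suc (max n (snd p)))"])
        (use b n antimono[of "Suc (max n (snd p))" b _ n] in auto)
  qed
  then obtain f where f: "\<And>k. fst (f k) \<in> C" "\<And>k. agree (snd (f k)) (fst (f k)) (fst (f (Suc k)))"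
      "\<And>k. snd (f k) < snd (f (Suc k))"
      "\<And>k b. b \<in> C \<Longrightarrow> agree (snd (f (Suc k))) (fst (f (Suc k))) b \<Longrightarrow> \<not> D k b"
    by blast
  have "strict_mono (\<lambda>k. snd (f k))" by (rule strict_monoI_Suc) (rule f(3))
  then obtain b where b: "b \<in> C" "\<And>k. agree (snd (f k)) (fst (f k)) b"
    using complete[of "\<lambda>k. fst (f k)" "\<lambda>k. snd (f k)"] f(1,2) by blast
  then have "\<not> D k b" for k using f(4) by blast
  then show False using cover[OF b(1)] by blast
qed

section \<open>Multipliers of the Roe algebra are band-dominated\<close>

lemma prop_le_basis_proj:
  assumes \<xi>: "orthonormal_basis \<xi>"
  shows "prop_le 0 (basis_proj (fibre_basis \<xi>) S
    :: ('x::metric_space, 'h::complex_hilbert) ell2 \<Rightarrow>\<^sub>L ('x, 'h) ell2)"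
proof -
  note e = hilbert_basis_fibre_basis[OF \<xi>, where 'x = 'x]
  have "supported (band 0) (basis_proj (fibre_basis \<xi>) S :: ('x, 'h) ell2 \<Rightarrow>\<^sub>L ('x, 'h) ell2)"
  proof (rule supported_basisI[OF \<xi> bounded_ops_basis_proj[OF e]])
    fix x y :: 'x and n assume "(x, y) \<notin> band 0"
    then show "ell2_apply (basis_proj (fibre_basis \<xi>) S (delta x (\<xi> n))) y = 0"
      using basis_proj_basis[OF e, of S "(x, n)"] by (auto simp: fibre_basis_def)
  qed
  then show ?thesis by (simp add: prop_le_def bounded_ops_basis_proj[OF e])
qed

lemma blinfun_compose_assoc: "(a o\<^sub>L b) o\<^sub>L c = a o\<^sub>L (b o\<^sub>L c)"
  by (rule blinfun_eqI) simp

lemma supported_chi_compose_chi: "supported (F \<times> G) (chi G o\<^sub>L a o\<^sub>L chi F)"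
  by (auto simp: supported_def chi_delta)

lemma chi_compose_chi_band_dominated:
  fixes a :: "('x::metric_space, 'h::complex_hilbert) ell2 \<Rightarrow>\<^sub>L ('x, 'h) ell2"
  assumes "finite F" "finite G" "a \<in> bounded_ops"
  shows "chi G o\<^sub>L a o\<^sub>L chi F \<in> band_dominated"
proof -
  obtain s where "F \<times> G \<subseteq> band s" by (rule finite_times_subset_band[OF assms(1,2)]) (rule that)
  then have "prop_le s (chi G o\<^sub>L a o\<^sub>L chi F)"
    using supported_mono[OF supported_chi_compose_chi] assms(3) by (simp add: prop_le_def)
  then show ?thesis by (rule prop_le_band_dominated)
qed

text \<open>On a countable type, the sets \<open>{x. index x < n}\<close> are finite and exhaust the type.\<close>

definition index :: "'x \<Rightarrow> nat" where
  "index = to_nat_on UNIV"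

lemma inj_index: "countable (UNIV :: 'x set) \<Longrightarrow> inj (index :: 'x \<Rightarrow> nat)"
  unfolding index_def by (rule inj_on_to_nat_on)

lemma finite_index_less: "countable (UNIV :: 'x set) \<Longrightarrow> finite {x::'x. index x < n}"
  using finite_vimageI[OF finite_lessThan[of n] inj_index] by (simp add: vimage_def)

lemma approximable_basis_proj_limit:
  fixes b :: "('x::metric_space, 'h::complex_hilbert) ell2 \<Rightarrow>\<^sub>L ('x, 'h) ell2"
  assumes e: "hilbert_basis \<epsilon>" and T: "\<And>i. \<forall>\<^sub>F n in sequentially. i \<in> T n \<longleftrightarrow> i \<in> S"
    and approx: "\<And>n. approximable s e (b o\<^sub>L basis_proj \<epsilon> (T n))"
  shows "approximable s e (b o\<^sub>L basis_proj \<epsilon> S)"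
proof (rule approximable_weak_limit[OF _ approx])
  show "(\<lambda>n. cinner ((b o\<^sub>L basis_proj \<epsilon> (T n)) x) y) \<longlonglongrightarrow> cinner ((b o\<^sub>L basis_proj \<epsilon> S) x) y" for x y
    unfolding blinfun_apply_blinfun_compose
    by (intro tendsto_cinner tendsto_const blinfun.tendsto basis_proj_tendsto[OF e] T)
  show "norm (b o\<^sub>L basis_proj \<epsilon> (T n)) \<le> norm b * 1" for n
    using norm_blinfun_compose[of b "basis_proj \<epsilon> (T n)"]
      mult_left_mono[OF norm_basis_proj_le[OF e, of "T n"] norm_ge_zero[of b]] by simp
qed

text \<open>Truncating a multiplier by the projections onto \<open>{(y, n). n < h y}\<close>, which have compact
  entries, lands in the band-dominated operators. Baire category makes the propagation needed
  for the approximation independent of \<open>h\<close>, up to finitely many fibres.\<close>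

lemma band_dominated_right_multiplier:
  fixes b :: "('x::metric_space, 'h::complex_hilbert) ell2 \<Rightarrow>\<^sub>L ('x, 'h) ell2"
  assumes \<xi>: "orthonormal_basis \<xi>" and cnt: "countable (UNIV :: 'x set)"
    and b: "\<And>h. b o\<^sub>L basis_proj (fibre_basis \<xi>) {(y, n). n < h y} \<in> band_dominated"
    and bF: "\<And>F. finite F \<Longrightarrow> b o\<^sub>L chi F \<in> band_dominated"
  shows "b \<in> band_dominated"
  unfolding band_dominated_iff
proof (intro allI impI)
  fix e :: real assume e: "e > 0"
  note B = hilbert_basis_fibre_basis[OF \<xi>, where 'x = 'x]
  let ?P = "\<lambda>S. basis_proj (fibre_basis \<xi>) S :: ('x, 'h) ell2 \<Rightarrow>\<^sub>L ('x, 'h) ell2"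
  let ?L = "\<lambda>h :: 'x \<Rightarrow> nat. {(y, n). n < h y}"
  let ?D = "\<lambda>s h. approximable (real s) (e / 2) (b o\<^sub>L ?P (?L h))"
  let ?agree = "\<lambda>n h h'. \<forall>y::'x. index y < n \<longrightarrow> h y = (h' y :: nat)"
  obtain s :: nat and n h0 where sn: "\<And>h. ?agree n h0 h \<Longrightarrow> ?D s h"
  proof (rule baire_alternative[where C = UNIV and D = ?D and agree = ?agree])
    show "(\<lambda>_. 0) \<in> UNIV" by simp
    show "\<exists>s. ?D s h" for h
    proof -
      obtain s where "approximable s (e / 2) (b o\<^sub>L ?P (?L h))"
        using b[of h] e unfolding band_dominated_iff by (meson half_gt_zero)
      moreover obtain N where "s \<le> real N" by (meson real_arch_simple)
      ultimately show ?thesis by (meson approximable_mono order_refl)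
    qed
    show "\<exists>n. \<forall>h'\<in>UNIV. ?agree n h h' \<longrightarrow> \<not> ?D s h'" if "\<not> ?D s h" for s h
    proof (rule ccontr)
      assume "\<not> ?thesis"
      then have "\<forall>n. \<exists>h'. ?agree n h h' \<and> ?D s h'" by blast
      then obtain H where H: "\<And>n. ?agree n h (H n)" "\<And>n. ?D s (H n)" by metis
      have "?D s h"
      proof (rule approximable_basis_proj_limit[OF B _ H(2)])
        fix i :: "'x \<times> nat"
        obtain y k where i: "i = (y, k)" by (cases i)
        have "\<forall>\<^sub>F n in sequentially. index y < n" by (rule eventually_gt_at_top)
        then show "\<forall>\<^sub>F n in sequentially. i \<in> ?L (H n) \<longleftrightarrow> i \<in> ?L h"
          by (rule eventually_mono) (use H(1) in \<open>simp add: i\<close>)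
      qed
      with that show False by contradiction
    qed
    show "?agree m h h'" if "?agree n h h'" "m \<le> n" for m n h h' using that by simp
    show "\<exists>h'\<in>UNIV. \<forall>k. ?agree (m k) (H k) h'"
      if H: "\<And>k. ?agree (m k) (H k) (H (Suc k))" and m: "strict_mono m" for H m
    proof -
      have chain: "H (k + j) y = H k y" if "index y < m k" for k j y
      proof (induction j)
        case (Suc j)
        have "index y < m (k + j)" using that strict_mono_less_eq[OF m, of k "k + j"] by simp
        then show ?case using H[of "k + j"] Suc by simp
      qed simp
      define h' where "h' y = H (Suc (index y)) y" for y
      have "H k y = h' y" if k: "index y < m k" for k y
      proof (cases "k \<le> Suc (index y)")
        case True
        then show ?thesis using chain[OF k, of "Suc (index y) - k"] by (simp add: h'_def)
      next
        case False
        have "index y < m (Suc (index y))"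
          using strict_mono_imp_increasing[OF m, of "Suc (index y)"] by simp
        then show ?thesis using chain[of y "Suc (index y)" "k - Suc (index y)"] False by (simp add: h'_def)
      qed
      then show ?thesis by blast
    qed
    fix s n and a :: "'x \<Rightarrow> nat"
    assume "\<And>h. h \<in> UNIV \<Longrightarrow> ?agree n a h \<Longrightarrow> ?D s h"
    then show thesis by (intro that) simp
  qed
  define F where "F = {y::'x. index y < n}"
  define T where "T = {(y, j). index (y::'x) < n \<longrightarrow> j < h0 y}"
  define h1 where "h1 y = (if index (y::'x) < n then h0 y else 0)" for y
  \<comment> \<open>Here \<open>h\<close> tends to infinity outside the finitely many fibres where it is prescribed.\<close>
  have T: "approximable (real s) (e / 2) (b o\<^sub>L ?P T)"
  proof (rule approximable_basis_proj_limit[OF B])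
    fix i :: "'x \<times> nat"
    obtain y k where i: "i = (y, k)" by (cases i)
    have "\<forall>\<^sub>F j in sequentially. k < j" by (rule eventually_gt_at_top)
    then show "\<forall>\<^sub>F j in sequentially. i \<in> ?L (\<lambda>y. if index y < n then h0 y else j) \<longleftrightarrow> i \<in> T"
      by (rule eventually_mono) (simp add: i T_def)
    show "?D s (\<lambda>y. if index y < n then h0 y else j)" for j by (rule sn) simp
  qed
  have "?P (- T) + ?P (?L h1) = chi F"
  proof -
    have "- T \<inter> ?L h1 = {}" "- T \<union> ?L h1 = F \<times> UNIV" by (auto simp: T_def h1_def F_def split: if_splits)
    then show ?thesis using basis_proj_disjoint_Un[OF B, of "- T" "?L h1"] chi_basis_proj[OF \<xi>, of F] by simp
  qed
  then have "?P (- T) = chi F - ?P (?L h1)" by (simp add: algebra_simps)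
  then have "b o\<^sub>L ?P (- T) = (b o\<^sub>L chi F) - (b o\<^sub>L ?P (?L h1))"
    by (intro blinfun_eqI) (simp add: blinfun.diff_left blinfun.diff_right)
  then have "b o\<^sub>L ?P (- T) \<in> band_dominated"
    using band_dominated_diff[OF bF b, of F h1] finite_index_less[OF cnt, of n] by (simp add: F_def)
  then obtain t where t: "t \<ge> 0" "approximable t (e / 2) (b o\<^sub>L ?P (- T))"
    using e unfolding band_dominated_iff by (meson half_gt_zero)
  have "b = (b o\<^sub>L ?P T) + (b o\<^sub>L ?P (- T))"
    by (rule blinfun_eqI) (simp add: blinfun.add_left basis_proj_Compl[OF B] blinfun.diff_left blinfun.diff_right)
  then have "approximable (max (real s) t) e b"
    using approximable_add[OF T t(2)] by simp
  then show "\<exists>s\<ge>0. approximable s e b" using t(1) by (intro exI[of _ "max (real s) t"]) simp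
qed

text \<open>The restriction to finitely many fibres that the previous criterion asks for is again treated by
  that criterion, after passing to the adjoint; what remains is supported in a finite set.\<close>

lemma multiplier_band_dominated:
  fixes b :: "('x::metric_space, 'h::complex_hilbert) ell2 \<Rightarrow>\<^sub>L ('x, 'h) ell2"
  assumes \<xi>: "orthonormal_basis \<xi>" and cnt: "countable (UNIV :: 'x set)" and b: "b \<in> bounded_ops"
    and right: "\<And>h. b o\<^sub>L basis_proj (fibre_basis \<xi>) {(y, n). n < h y} \<in> band_dominated"
    and left: "\<And>h. basis_proj (fibre_basis \<xi>) {(y, n). n < h y} o\<^sub>L b \<in> band_dominated"
  shows "b \<in> band_dominated"
proof (rule band_dominated_right_multiplier[OF \<xi> cnt right])
  note B = hilbert_basis_fibre_basis[OF \<xi>, where 'x = 'x]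
  note Pb = bounded_ops_basis_proj[OF B]
  fix F :: "'x set" assume F: "finite F"
  have "chi F o\<^sub>L adj b \<in> band_dominated"
  proof (rule band_dominated_right_multiplier[OF \<xi> cnt])
    fix h :: "'x \<Rightarrow> nat"
    let ?P = "basis_proj (fibre_basis \<xi>) {(y, n). n < h y}"
    have "adj (?P o\<^sub>L b) \<in> band_dominated" by (rule band_dominated_adj[OF left])
    then have "adj b o\<^sub>L ?P \<in> band_dominated" by (simp add: adj_compose Pb b adj_basis_proj[OF B])
    then have "chi F o\<^sub>L (adj b o\<^sub>L ?P) \<in> band_dominated"
      by (rule band_dominated_compose[OF prop_le_band_dominated[OF prop_le_chi[OF order_refl]]])
    then show "(chi F o\<^sub>L adj b) o\<^sub>L ?P \<in> band_dominated" by (simp add: blinfun_compose_assoc)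
  next
    fix G :: "'x set" assume "finite G"
    then show "(chi F o\<^sub>L adj b) o\<^sub>L chi G \<in> band_dominated"
      using chi_compose_chi_band_dominated[of G F "adj b"] F b by simp
  qed
  from band_dominated_adj[OF this] show "b o\<^sub>L chi F \<in> band_dominated"
    by (simp add: adj_compose b)
qed

text \<open>Conjugates of band-dominated operators are multipliers, since band-dominated operators multiply
  the Roe algebra into itself.\<close>

lemma conjugate_band_dominated:
  fixes u :: "('x::metric_space, 'h::complex_hilbert) ell2 \<Rightarrow>\<^sub>L ('y::metric_space, 'h) ell2"
  assumes \<xi>: "orthonormal_basis (\<xi> :: nat \<Rightarrow> 'h)"
    and X: "uniformly_locally_finite TYPE('x)" and Y: "uniformly_locally_finite TYPE('y)"
    and u: "unitary_map u"
    and roe: "\<And>a. a \<in> roe_algebra \<Longrightarrow> conjugate u a \<in> roe_algebra"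
    and roe': "\<And>b. b \<in> roe_algebra \<Longrightarrow> conjugate (adj u) b \<in> roe_algebra"
    and a: "a \<in> band_dominated"
  shows "conjugate u a \<in> band_dominated"
proof (rule multiplier_band_dominated[OF \<xi> ulf_countable[OF Y]])
  show "conjugate u a \<in> bounded_ops" using u band_dominated_bounded_ops[OF a] by simp
  fix h :: "'y \<Rightarrow> nat"
  let ?P = "basis_proj (fibre_basis \<xi>) {(y, n). n < h y} :: ('y, 'h) ell2 \<Rightarrow>\<^sub>L ('y, 'h) ell2"
  have "?P \<in> ell_infty \<xi>" by (rule basis_proj_ell_infty[OF \<xi>]) simp
  then have P: "conjugate (adj u) ?P \<in> roe_algebra"
    by (intro roe' ell_infty_subset_roe_algebra(2)[OF \<xi>])
  have "conjugate u (a o\<^sub>L conjugate (adj u) ?P) \<in> roe_algebra"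
    by (intro roe roe_algebra_compose_left[OF X a P])
  then show "conjugate u a o\<^sub>L ?P \<in> band_dominated"
    using u by (simp add: conjugate_compose roe_algebra_band_dominated)
  have "conjugate u (conjugate (adj u) ?P o\<^sub>L a) \<in> roe_algebra"
    by (intro roe roe_algebra_compose_right[OF X a P])
  then show "?P o\<^sub>L conjugate u a \<in> band_dominated"
    using u by (simp add: conjugate_compose roe_algebra_band_dominated)
qed

section \<open>Equi-approximability\<close>

lemma approximable_diff:
  assumes "approximable r e a" "approximable s f b"
  shows "approximable (max r s) (e + f) (a - b)"
proof -
  obtain d where d: "prop_le s d" "norm (b - d) \<le> f" using assms(2) by (auto simp: approximable_def)
  have "prop_le s (0 - d)"
    unfolding prop_le_def
    using bounded_ops_diff[OF bounded_ops_zero, of d] supported_diff[OF supported_zero, of "band s" d]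
      d(1)[unfolded prop_le_def] by blast
  then have "approximable s f (0 - b)"
    using d(2) by (intro approximableI[of s "0 - d"]) (simp_all add: norm_minus_commute)
  from approximable_add[OF assms(1) this] show ?thesis by simp
qed

text \<open>A family, not a set, of operators: it is the parametrisation that is kept when several families
  are added.\<close>

definition equi_approximable ::
  "'i set \<Rightarrow> ('i \<Rightarrow> (('x::metric_space, 'h::complex_hilbert) ell2 \<Rightarrow>\<^sub>L ('x, 'h) ell2)) \<Rightarrow> bool" where
  "equi_approximable C f \<longleftrightarrow> (\<forall>e>0. \<exists>s. \<forall>b\<in>C. approximable s e (f b))"

lemma equi_approximableD:
  "equi_approximable C f \<Longrightarrow> e > 0 \<Longrightarrow> \<exists>s. \<forall>b\<in>C. approximable s e (f b)"
  by (simp add: equi_approximable_def)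

lemma equi_approximable_const: "a \<in> band_dominated \<Longrightarrow> equi_approximable C (\<lambda>_. a)"
  unfolding equi_approximable_def band_dominated_iff by blast

lemma equi_approximable_add:
  assumes "equi_approximable C f" "equi_approximable C g"
  shows "equi_approximable C (\<lambda>b. f b + g b)"
  unfolding equi_approximable_def
proof (intro allI impI)
  fix e :: real assume "e > 0"
  then have e2: "e / 2 > 0" by simp
  obtain s t where st: "\<And>b. b \<in> C \<Longrightarrow> approximable s (e / 2) (f b)"
    "\<And>b. b \<in> C \<Longrightarrow> approximable t (e / 2) (g b)"
    using equi_approximableD[OF assms(1) e2] equi_approximableD[OF assms(2) e2] by blast
  have "approximable (max s t) e (f b + g b)" if "b \<in> C" for b
    using approximable_add[OF st(1)[OF that] st(2)[OF that]] by simp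
  then show "\<exists>s. \<forall>b\<in>C. approximable s e (f b + g b)" by blast
qed

lemma equi_approximable_sum:
  "(\<And>i. i \<in> I \<Longrightarrow> equi_approximable C (f i)) \<Longrightarrow> equi_approximable C (\<lambda>b. \<Sum>i\<in>I. f i b)"
  by (induction I rule: infinite_finite_induct) (auto intro: equi_approximable_add equi_approximable_const)

lemma equi_approximable_op_scaleC:
  assumes "a \<in> band_dominated" "\<And>b. b \<in> C \<Longrightarrow> cmod (c b) \<le> 1"
  shows "equi_approximable C (\<lambda>b. op_scaleC (c b) a)"
  unfolding equi_approximable_def
proof (intro allI impI)
  fix e :: real assume e: "e > 0"
  then obtain s where "approximable s e a" using assms(1) unfolding band_dominated_iff by blast
  then show "\<exists>s. \<forall>b\<in>C. approximable s e (op_scaleC (c b) a)"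
    using assms(2) e by (intro exI[of _ s] ballI approximable_op_scaleC) auto
qed

lemma equi_approximable_cong:
  "equi_approximable C f \<Longrightarrow> (\<And>b. b \<in> C \<Longrightarrow> g b = f b) \<Longrightarrow> equi_approximable C g"
  unfolding equi_approximable_def by simp

definition prop_ball :: "real \<Rightarrow> (('x::metric_space, 'h::complex_hilbert) ell2 \<Rightarrow>\<^sub>L ('x, 'h) ell2) set" where
  "prop_ball r = {b. prop_le r b \<and> norm b \<le> 1}"

lemma prop_ball_bounded_ops: "b \<in> prop_ball r \<Longrightarrow> b \<in> bounded_ops"
  unfolding prop_ball_def using prop_le_bounded_ops by blast

lemma prop_ball_compose_left:
  assumes "prop_le 0 a" "norm a \<le> 1" "b \<in> prop_ball r" shows "a o\<^sub>L b \<in> prop_ball r"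
proof -
  have "norm (a o\<^sub>L b) \<le> norm a * norm b" by (rule norm_blinfun_compose)
  also have "\<dots> \<le> 1 * 1" using assms by (intro mult_mono) (auto simp: prop_ball_def)
  finally show ?thesis using assms prop_le_compose[of 0 a r b] by (simp add: prop_ball_def)
qed

lemma prop_ball_compose_right:
  assumes "prop_le 0 a" "norm a \<le> 1" "b \<in> prop_ball r" shows "b o\<^sub>L a \<in> prop_ball r"
proof -
  have "norm (b o\<^sub>L a) \<le> norm b * norm a" by (rule norm_blinfun_compose)
  also have "\<dots> \<le> 1 * 1" using assms by (intro mult_mono) (auto simp: prop_ball_def)
  finally show ?thesis using assms prop_le_compose[of r b 0 a] by (simp add: prop_ball_def)
qed

lemma prop_ball_adj: "b \<in> prop_ball r \<Longrightarrow> adj b \<in> prop_ball r"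
  using prop_le_adj[of r b] norm_adj[OF prop_ball_bounded_ops, of b r] by (simp add: prop_ball_def)

definition corner :: "nat \<Rightarrow> ('x \<times> nat) set" where
  "corner n = {(x, k). index x < n \<and> k < n}"

lemma finite_corner: "countable (UNIV :: 'x set) \<Longrightarrow> finite (corner n :: ('x \<times> nat) set)"
  by (rule finite_subset[of _ "{x. index x < n} \<times> {..<n}"]) (auto simp: corner_def finite_index_less)

lemma corner_mono: "m \<le> n \<Longrightarrow> corner m \<subseteq> corner n"
  by (auto simp: corner_def)

lemma eventually_corner: "\<forall>\<^sub>F n in sequentially. i \<in> corner n"
proof -
  obtain x k where i: "i = (x, k)" by (cases i)
  have "\<forall>\<^sub>F n in sequentially. max (index x) k < n" by (rule eventually_gt_at_top)
  then show ?thesis by (rule eventually_mono) (simp add: i corner_def)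
qed

text \<open>Agreement of the compressions to a corner. On bounded sets this describes a neighbourhood base for
  the weak operator topology.\<close>

definition corner_agree ::
  "(nat \<Rightarrow> 'h::complex_hilbert) \<Rightarrow> nat \<Rightarrow> (('x, 'h) ell2 \<Rightarrow>\<^sub>L ('x, 'h) ell2) \<Rightarrow> (('x, 'h) ell2 \<Rightarrow>\<^sub>L ('x, 'h) ell2) \<Rightarrow> bool"
  where "corner_agree \<xi> n a b \<longleftrightarrow> (\<forall>x y.
    cinner (a (basis_proj (fibre_basis \<xi>) (corner n) x)) (basis_proj (fibre_basis \<xi>) (corner n) y)
    = cinner (b (basis_proj (fibre_basis \<xi>) (corner n) x)) (basis_proj (fibre_basis \<xi>) (corner n) y))"

lemma corner_agree_weak_limit:
  fixes b :: "nat \<Rightarrow> (('x, 'h::complex_hilbert) ell2 \<Rightarrow>\<^sub>L ('x, 'h) ell2)"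
  assumes \<xi>: "orthonormal_basis \<xi>" and ag: "\<And>n. corner_agree \<xi> n a (b n)"
    and a: "norm a \<le> 1" and b: "\<And>n. norm (b n) \<le> 1"
  shows "(\<lambda>n. cinner (b n x) y) \<longlonglongrightarrow> cinner (a x) y"
proof (rule Lim_null_comparison[THEN LIM_zero_cancel])
  note B = hilbert_basis_fibre_basis[OF \<xi>, where 'x = 'x]
  let ?q = "\<lambda>n. basis_proj (fibre_basis \<xi>) (corner n) :: ('x, 'h) ell2 \<Rightarrow>\<^sub>L ('x, 'h) ell2"
  let ?g = "\<lambda>n. 2 * norm (x - ?q n x) * norm y + 2 * norm x * norm (y - ?q n y)"
  show "\<forall>\<^sub>F n in sequentially. norm (cinner (b n x) y - cinner (a x) y) \<le> ?g n"
  proof (intro always_eventually allI)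
    fix n
    define t where "t = b n - a"
    have t: "norm t \<le> 2" using norm_triangle_ineq4[of "b n" a] a b[of n] by (simp add: t_def)
    have "cinner (t (?q n x)) (?q n y) = 0"
      using ag[of n] by (simp add: t_def corner_agree_def blinfun.diff_left cinner_diff_left)
    then have "cinner (b n x) y - cinner (a x) y
        = cinner (t (x - ?q n x)) y + cinner (t (?q n x)) (y - ?q n y)"
      by (simp add: t_def blinfun.diff_left blinfun.diff_right cinner_diff_left cinner_diff_right)
    also have "cmod \<dots> \<le> norm t * norm (x - ?q n x) * norm y + norm t * norm (?q n x) * norm (y - ?q n y)"
      by (rule order_trans[OF norm_triangle_ineq add_mono[OF cmod_cinner_op_le cmod_cinner_op_le]])
    also have "\<dots> \<le> ?g n"
      using t norm_basis_proj_apply_le[OF B, of "corner n" x] by (intro add_mono mult_mono) auto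
    finally show "norm (cinner (b n x) y - cinner (a x) y) \<le> ?g n" .
  qed
  have q: "(\<lambda>n. ?q n z) \<longlonglongrightarrow> z" for z
  proof -
    have "basis_proj (fibre_basis \<xi>) UNIV = (id_blinfun :: ('x, 'h) ell2 \<Rightarrow>\<^sub>L ('x, 'h) ell2)"
      using chi_basis_proj[OF \<xi>, of "UNIV :: 'x set"] by simp
    moreover have "(\<lambda>n. ?q n z) \<longlonglongrightarrow> basis_proj (fibre_basis \<xi>) UNIV z"
      by (rule basis_proj_tendsto[OF B]) (simp add: eventually_corner)
    ultimately show ?thesis by simp
  qed
  have "?g \<longlonglongrightarrow> 2 * norm (x - x) * norm y + 2 * norm x * norm (y - y)"
    by (intro tendsto_intros q)
  then show "?g \<longlonglongrightarrow> 0" by simp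
qed

context
  fixes \<xi> :: "nat \<Rightarrow> 'h::complex_hilbert"
    and u :: "('x::metric_space, 'h) ell2 \<Rightarrow>\<^sub>L ('y::metric_space, 'h) ell2"
  assumes \<xi>: "orthonormal_basis \<xi>" and cnt: "countable (UNIV :: 'x set)" and u: "unitary_map u"
    and BD: "\<And>a. a \<in> band_dominated \<Longrightarrow> conjugate u a \<in> band_dominated"
begin

abbreviation (input) bproj :: "('x \<times> nat) set \<Rightarrow> (('x, 'h) ell2 \<Rightarrow>\<^sub>L ('x, 'h) ell2)" where
  "bproj \<equiv> basis_proj (fibre_basis \<xi>)"

abbreviation (input) qcorner :: "nat \<Rightarrow> (('x, 'h) ell2 \<Rightarrow>\<^sub>L ('x, 'h) ell2)" where
  "qcorner n \<equiv> bproj (corner n)"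

lemma fibre_hilbert_basis: "hilbert_basis (fibre_basis \<xi> :: _ \<Rightarrow> ('x, 'h) ell2)"
  by (rule hilbert_basis_fibre_basis[OF \<xi>])

lemmas bproj_simps = bounded_ops_basis_proj[OF fibre_hilbert_basis] norm_basis_proj_le[OF fibre_hilbert_basis] prop_le_basis_proj[OF \<xi>]

lemma conjugate_approximable_corner_limit:
  assumes "\<And>n. corner_agree \<xi> n a (b n)" "norm a \<le> 1" "\<And>n. norm (b n) \<le> 1"
    and "\<And>n. approximable s e (conjugate u (b n))"
  shows "approximable s e (conjugate u a)"
proof (rule approximable_weak_limit[OF _ assms(4)])
  show "(\<lambda>n. cinner (conjugate u (b n) x) y) \<longlonglongrightarrow> cinner (conjugate u a x) y" for x y
    using corner_agree_weak_limit[OF \<xi> assms(1-3), of "adj u x" "adj u y"] u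
    by (simp add: cinner_adj_right)
  show "norm (conjugate u (b n)) \<le> 1" for n
    using norm_conjugate_le[OF u, of "b n"] assms(3)[of n] by simp
qed

lemma prop_ball_corner_complete:
  fixes a :: "nat \<Rightarrow> (('x, 'h) ell2 \<Rightarrow>\<^sub>L ('x, 'h) ell2)"
  assumes a: "\<And>k. a k \<in> prop_ball r" and ag: "\<And>k. corner_agree \<xi> (m k) (a k) (a (Suc k))"
    and m: "strict_mono m"
    and antimono: "\<And>m n a b. corner_agree \<xi> n a b \<Longrightarrow> m \<le> n \<Longrightarrow>
      corner_agree \<xi> m a (b :: ('x, 'h) ell2 \<Rightarrow>\<^sub>L ('x, 'h) ell2)"
  shows "\<exists>b\<in>prop_ball r. \<forall>k. corner_agree \<xi> (m k) (a k) b"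
proof -
  have na: "norm (a k) \<le> 1" and pa: "prop_le r (a k)" for k using a[of k] by (simp_all add: prop_ball_def)
  obtain F D where F: "F \<noteq> bot" "F \<le> sequentially" and D: "D \<in> bounded_ops"
    and lim: "\<And>x y. ((\<lambda>n. cinner (a n x) y) \<longlongrightarrow> cinner (blinfun_apply D x) y) F"
    by (rule weak_operator_cluster_point[of a 1, OF prop_le_bounded_ops[OF pa] na]) blast
  have "norm D \<le> 1" by (rule norm_weak_limit_le[OF lim F(1) na]) simp
  moreover have "supported (band r) D"
    by (rule supported_weak_limit[OF lim F(1)]) (use pa in \<open>simp add: prop_le_def\<close>)
  ultimately have "D \<in> prop_ball r" using D by (simp add: prop_ball_def prop_le_def)
  moreover have "corner_agree \<xi> (m k) (a k) D" for k
  proof -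
    have chain: "corner_agree \<xi> (m k) (a k) (a (k + j))" for j
    proof (induction j)
      case (Suc j)
      have "corner_agree \<xi> (m k) (a (k + j)) (a (Suc (k + j)))"
        by (rule antimono[OF ag]) (simp add: strict_mono_less_eq[OF m])
      then show ?case using Suc by (simp add: corner_agree_def)
    qed (simp add: corner_agree_def)
    show ?thesis
      unfolding corner_agree_def
    proof (intro allI)
      fix x y
      have "\<forall>\<^sub>F n in sequentially. cinner (a n (qcorner (m k) x)) (qcorner (m k) y) = cinner (a k (qcorner (m k) x)) (qcorner (m k) y)"
        using eventually_ge_at_top[of k]
      proof eventually_elim
        case (elim n)
        then show ?case using chain[of "n - k"] by (simp add: corner_agree_def)
      qed
      then have "\<forall>\<^sub>F n in F. cinner (a n (qcorner (m k) x)) (qcorner (m k) y) = cinner (a k (qcorner (m k) x)) (qcorner (m k) y)"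
        using F(2) by (rule filter_leD[rotated])
      then have "((\<lambda>n. cinner (a n (qcorner (m k) x)) (qcorner (m k) y)) \<longlongrightarrow> cinner (a k (qcorner (m k) x)) (qcorner (m k) y)) F"
        by (rule tendsto_eventually)
      then show "cinner (a k (qcorner (m k) x)) (qcorner (m k) y) = cinner (D (qcorner (m k) x)) (qcorner (m k) y)"
        using tendsto_unique[OF F(1) _ lim] by blast
    qed
  qed
  ultimately show ?thesis by blast
qed

lemma corner_agree_antimono:
  assumes "corner_agree \<xi> n a b" "m \<le> n"
  shows "corner_agree \<xi> m a (b :: ('x, 'h) ell2 \<Rightarrow>\<^sub>L ('x, 'h) ell2)"
proof -
  have "qcorner n (qcorner m x) = qcorner m x" for x
  proof -
    have "corner n \<inter> corner m = (corner m :: ('x \<times> nat) set)" using corner_mono[OF assms(2)] by blast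
    then show ?thesis by (simp add: basis_proj_proj[OF fibre_hilbert_basis])
  qed
  then show ?thesis using assms(1) unfolding corner_agree_def by metis
qed

text \<open>By Baire category in the weakly compact unit ball, one propagation bound works for all operators
  with a certain corner. Any operator compressed to the complement of the corner can be completed by
  that corner, without increasing the norm.\<close>

lemma approximable_off_corner:
  assumes e: "e > 0"
  shows "\<exists>n s. \<forall>b\<in>prop_ball r. approximable s e (conjugate u (bproj (- corner n) o\<^sub>L b o\<^sub>L bproj (- corner n)))"
proof -
  let ?D = "\<lambda>s a. approximable (real s) (e / 2) (conjugate u a)"
  obtain s :: nat and n and a :: "('x, 'h) ell2 \<Rightarrow>\<^sub>L ('x, 'h) ell2"
    where a: "a \<in> prop_ball r" and sn: "\<And>b. b \<in> prop_ball r \<Longrightarrow> corner_agree \<xi> n a b \<Longrightarrow> ?D s b"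
  proof (rule baire_alternative[where C = "prop_ball r" and D = ?D and agree = "corner_agree \<xi>"])
    show "0 \<in> prop_ball r" by (simp add: prop_ball_def)
    show "\<exists>s. ?D s b" if "b \<in> prop_ball r" for b
    proof -
      have "conjugate u b \<in> band_dominated"
        using that by (intro BD prop_le_band_dominated[of r]) (simp add: prop_ball_def)
      then obtain s where "approximable s (e / 2) (conjugate u b)"
        using e unfolding band_dominated_iff by (meson half_gt_zero)
      moreover obtain N where "s \<le> real N" by (meson real_arch_simple)
      ultimately show ?thesis by (meson approximable_mono order_refl)
    qed
    show "\<exists>n. \<forall>b\<in>prop_ball r. corner_agree \<xi> n a b \<longrightarrow> \<not> ?D s b"
      if a: "a \<in> prop_ball r" "\<not> ?D s a" for s a
    proof (rule ccontr)
      assume "\<not> ?thesis"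
      then have "\<forall>n. \<exists>b. b \<in> prop_ball r \<and> corner_agree \<xi> n a b \<and> ?D s b" by blast
      then obtain b where b: "\<And>n. b n \<in> prop_ball r" "\<And>n. corner_agree \<xi> n a (b n)" "\<And>n. ?D s (b n)"
        by metis
      have "?D s a"
        by (rule conjugate_approximable_corner_limit[OF b(2) _ _ b(3)])
          (use a(1) b(1) in \<open>simp_all add: prop_ball_def\<close>)
      with a(2) show False by contradiction
    qed
    show "corner_agree \<xi> m a b" if "corner_agree \<xi> n a b" "m \<le> n"
      for m n and a b :: "('x, 'h) ell2 \<Rightarrow>\<^sub>L ('x, 'h) ell2"
      using that by (rule corner_agree_antimono)
    show "\<exists>b\<in>prop_ball r. \<forall>k. corner_agree \<xi> (m k) (a k) b"
      if "\<And>k. a k \<in> prop_ball r" "\<And>k. corner_agree \<xi> (m k) (a k) (a (Suc k))" "strict_mono m"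
      for m and a :: "nat \<Rightarrow> (('x, 'h) ell2 \<Rightarrow>\<^sub>L ('x, 'h) ell2)"
      using prop_ball_corner_complete[OF that corner_agree_antimono] .
  qed blast
  define q where "q = qcorner n"
  define p where "p = bproj (- corner n)"
  have qp: "prop_le 0 q" "norm q \<le> 1" "q \<in> bounded_ops" "prop_le 0 p" "norm p \<le> 1" "p \<in> bounded_ops"
    by (simp_all add: q_def p_def bproj_simps)
  have qq: "q (q x) = q x" "q (p x) = 0" "p (q x) = 0" for x
    by (simp_all add: q_def p_def basis_proj_proj[OF fibre_hilbert_basis] basis_proj_empty[OF fibre_hilbert_basis])
  have split: "(norm x)\<^sup>2 = (norm (q x))\<^sup>2 + (norm (p x))\<^sup>2" for x
    unfolding q_def p_def by (rule norm_sq_basis_proj_split[OF fibre_hilbert_basis])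
  have qaq: "q o\<^sub>L a o\<^sub>L q \<in> prop_ball r"
    by (intro prop_ball_compose_left prop_ball_compose_right qp a)
  then have "conjugate u (q o\<^sub>L a o\<^sub>L q) \<in> band_dominated"
    by (intro BD prop_le_band_dominated[of r]) (simp add: prop_ball_def)
  then obtain t where t: "approximable t (e / 2) (conjugate u (q o\<^sub>L a o\<^sub>L q))"
    using e unfolding band_dominated_iff by (meson half_gt_zero)
  have "approximable (max (real s) t) e (conjugate u (p o\<^sub>L b o\<^sub>L p))" if b: "b \<in> prop_ball r" for b
  proof -
    have pbp: "p o\<^sub>L b o\<^sub>L p \<in> prop_ball r"
      by (intro prop_ball_compose_left prop_ball_compose_right qp b)
    define c where "c = (q o\<^sub>L a o\<^sub>L q) + (p o\<^sub>L b o\<^sub>L p)"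
    have "prop_le r c"
      using qaq pbp prop_le_add[of r _ r] unfolding c_def prop_ball_def by auto
    moreover have "norm c \<le> 1"
    proof (rule norm_blinfun_bound)
      fix x
      have le: "norm (a y) \<le> norm y" "norm (b y) \<le> norm y" for y
        using norm_blinfun[of a y] norm_blinfun[of b y] a b
          mult_right_mono[of "norm a" 1 "norm y"] mult_right_mono[of "norm b" 1 "norm y"]
        by (simp_all add: prop_ball_def)
      have "norm (q y) \<le> norm y" "norm (p y) \<le> norm y" for y
        by (simp_all add: q_def p_def norm_basis_proj_apply_le[OF fibre_hilbert_basis])
      then have le': "norm (q (a (q x))) \<le> norm (q x)" "norm (p (b (p x))) \<le> norm (p x)"
        using le order_trans by blast+
      have "q (c x) = q (a (q x))" "p (c x) = p (b (p x))"
        using qq by (simp_all add: c_def blinfun.add_left blinfun.add_right q_def p_def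
            basis_proj_proj[OF fibre_hilbert_basis] basis_proj_empty[OF fibre_hilbert_basis])
      then have "(norm (c x))\<^sup>2 = (norm (q (a (q x))))\<^sup>2 + (norm (p (b (p x))))\<^sup>2"
        using split[of "c x"] by simp
      also have "\<dots> \<le> (norm (q x))\<^sup>2 + (norm (p x))\<^sup>2"
        by (intro add_mono power_mono le') auto
      also have "\<dots> = (norm x)\<^sup>2" by (rule split[symmetric])
      finally have "norm (c x) \<le> norm x" by (rule power2_le_imp_le) simp
      then show "norm (c x) \<le> 1 * norm x" by simp
    qed simp
    ultimately have "c \<in> prop_ball r" by (simp add: prop_ball_def)
    moreover have "corner_agree \<xi> n a c"
    proof -
      have "cinner (c (q x)) (q y) = cinner (a (q x)) (q y)" for x y
      proof -
        have "cinner (c (q x)) (q y) = cinner (q (a (q x))) (q y)"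
          by (simp add: c_def blinfun.add_left qq)
        also have "\<dots> = cinner (a (q x)) (q (q y))"
          unfolding q_def by (rule cinner_basis_proj[OF fibre_hilbert_basis])
        finally show ?thesis by (simp add: qq)
      qed
      then show ?thesis by (simp add: corner_agree_def q_def)
    qed
    ultimately have "?D s c" by (rule sn)
    from approximable_diff[OF this t]
    show ?thesis by (simp add: c_def flip: conjugate_diff)
  qed
  then have "\<forall>b\<in>prop_ball r. approximable (max (real s) t) e (conjugate u (p o\<^sub>L b o\<^sub>L p))" by blast
  then show ?thesis unfolding p_def by (intro exI)
qed

text \<open>Row operators cannot be completed in this way, since the norm would grow. But with \<open>\<omega>\<close> the given
  basis vector and \<open>v\<close> one of the same fibre outside the corner, \<open>|\<omega>\<rangle>\<langle>\<omega>| b\<close> is the product of the fixed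
  operator \<open>|\<omega>\<rangle>\<langle>v|\<close> and of \<open>|v\<rangle>\<langle>\<omega>| b\<close>, and the latter lies off the corner up to finitely many columns.
  Infinite dimension of the fibres is essential here.\<close>

lemma equi_approximable_row:
  "equi_approximable (prop_ball r) (\<lambda>b. conjugate u (rank_one (fibre_basis \<xi> i) (fibre_basis \<xi> i) o\<^sub>L b))"
  unfolding equi_approximable_def
proof (intro allI impI)
  fix e :: real assume e: "e > 0"
  then have e2: "e / 2 > 0" by simp
  obtain x k where i: "i = (x, k)" by (cases i)
  let ?b = "fibre_basis \<xi> :: _ \<Rightarrow> ('x, 'h) ell2"
  define \<omega> where "\<omega> = ?b i"
  have n\<omega>: "norm (?b j) = 1" for j by (rule norm_hilbert_basis[OF fibre_hilbert_basis])
  have rank_BD: "conjugate u (rank_one \<eta> \<theta>) \<in> band_dominated" for \<eta> \<theta>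
    by (intro BD roe_algebra_band_dominated rank_one_roe_algebra)
  \<comment> \<open>A product of contractions that are approximable up to \<open>f\<close> is approximable up to \<open>3 f\<close>.\<close>
  define f where "f = min 1 (e / 8)"
  have f: "f > 0" "f * (1 + f) + 1 * f \<le> e / 2"
  proof -
    show "f > 0" using e by (simp add: f_def)
    then have "f * (1 + f) \<le> f * 2" by (intro mult_left_mono) (auto simp: f_def)
    moreover have "f \<le> e / 8" by (simp add: f_def)
    ultimately show "f * (1 + f) + 1 * f \<le> e / 2" using e by linarith
  qed
  obtain n s where ns: "\<And>b. b \<in> prop_ball r \<Longrightarrow>
      approximable s f (conjugate u (bproj (- corner n) o\<^sub>L b o\<^sub>L bproj (- corner n)))"
    using approximable_off_corner[OF f(1), of r] by blast
  define p where "p = bproj (- corner n)"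
  define v where "v = ?b (x, n)"
  have pv: "p v = v" by (simp add: p_def v_def basis_proj_basis[OF fibre_hilbert_basis] corner_def)
  have p_adj: "adj p = p" by (simp add: p_def adj_basis_proj[OF fibre_hilbert_basis])
  have p_bdd: "p \<in> bounded_ops" by (simp add: p_def bproj_simps)
  obtain t where t: "approximable t f (conjugate u (rank_one \<omega> v))"
    using rank_BD[of \<omega> v] f(1) unfolding band_dominated_iff by blast
  have rank1: "rank_one v \<omega> o\<^sub>L b \<in> prop_ball r" if "b \<in> prop_ball r" for b
  proof (rule prop_ball_compose_left[OF _ _ that])
    have "supported (band 0) (rank_one v \<omega>)"
      by (auto simp: supported_def v_def \<omega>_def i fibre_basis_def cinner_delta_left ell2_apply_scaleC)
    then show "prop_le 0 (rank_one v \<omega>)" by (simp add: prop_le_def)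
    show "norm (rank_one v \<omega>) \<le> 1"
      using norm_rank_one_le[of v \<omega>] by (simp add: v_def \<omega>_def n\<omega>)
  qed
  have "equi_approximable (prop_ball r)
      (\<lambda>b. \<Sum>j\<in>corner n. op_scaleC (cinner (b (?b j)) \<omega>) (conjugate u (rank_one \<omega> (?b j))))"
  proof (intro equi_approximable_sum equi_approximable_op_scaleC rank_BD)
    fix j and b :: "('x, 'h) ell2 \<Rightarrow>\<^sub>L ('x, 'h) ell2" assume "b \<in> prop_ball r"
    then show "cmod (cinner (blinfun_apply b (?b j)) \<omega>) \<le> 1"
      using cmod_cinner_op_le[of b "?b j" \<omega>] by (simp add: prop_ball_def n\<omega> \<omega>_def)
  qed
  from equi_approximableD[OF this e2] obtain s1 where s1: "\<And>b. b \<in> prop_ball r \<Longrightarrow> approximable s1 (e / 2)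
      (\<Sum>j\<in>corner n. op_scaleC (cinner (b (?b j)) \<omega>) (conjugate u (rank_one \<omega> (?b j))))" by blast
  have "approximable (max s1 (t + s)) e (conjugate u (rank_one \<omega> \<omega> o\<^sub>L b))" if b: "b \<in> prop_ball r" for b
  proof -
    have b_bdd: "b \<in> bounded_ops" by (rule prop_ball_bounded_ops[OF b])
    define c where "c = (p o\<^sub>L (rank_one v \<omega> o\<^sub>L b) o\<^sub>L p)"
    have c_ball: "c \<in> prop_ball r"
      unfolding c_def p_def by (intro prop_ball_compose_left prop_ball_compose_right bproj_simps rank1 b)
    have "approximable (t + s) (f * (1 + f) + 1 * f)
        (conjugate u (rank_one \<omega> v) o\<^sub>L conjugate u c)"
    proof (rule approximable_compose[OF t])
      show "approximable s f (conjugate u c)"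
        unfolding c_def p_def by (rule ns[OF rank1[OF b]])
      show "norm (conjugate u (rank_one \<omega> v)) \<le> 1"
        using norm_conjugate_le[OF u, of "rank_one \<omega> v"] norm_rank_one_le[of \<omega> v] by (simp add: \<omega>_def v_def n\<omega>)
      show "norm (conjugate u c) \<le> 1"
        using norm_conjugate_le[OF u, of c] c_ball by (simp add: prop_ball_def)
    qed (use f(1) in auto)
    then have 2: "approximable (t + s) (e / 2) (conjugate u (rank_one \<omega> v o\<^sub>L c))"
      using f(2) by (auto simp: conjugate_compose[OF u] elim: approximable_mono)
    have eq1: "rank_one \<omega> \<omega> o\<^sub>L b o\<^sub>L p = rank_one \<omega> v o\<^sub>L c"
    proof (rule blinfun_eqI)
      fix z
      have "cinner v v = 1" by (simp add: v_def hilbert_basis_cinner[OF fibre_hilbert_basis])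
      then show "(rank_one \<omega> \<omega> o\<^sub>L b o\<^sub>L p) z = (rank_one \<omega> v o\<^sub>L c) z"
        by (simp add: c_def bounded_ops_scaleC[OF p_bdd] pv cinner_scaleC_left)
    qed
    have "rank_one \<omega> \<omega> o\<^sub>L b o\<^sub>L qcorner n = (\<Sum>j\<in>corner n. op_scaleC (cinner (b (?b j)) \<omega>) (rank_one \<omega> (?b j)))"
      by (rule blinfun_eqI) (simp add: basis_proj_finite[OF fibre_hilbert_basis finite_corner[OF cnt]] blinfun.sum_left
          blinfun.sum_right bounded_ops_scaleC[OF b_bdd] cinner_sum_left cinner_scaleC_left
          complex_vector.scale_sum_left mult.commute)
    then have "conjugate u (rank_one \<omega> \<omega> o\<^sub>L b o\<^sub>L qcorner n)
        = (\<Sum>j\<in>corner n. op_scaleC (cinner (b (?b j)) \<omega>) (conjugate u (rank_one \<omega> (?b j))))"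
      using u by (simp add: conjugate_sum conjugate_op_scaleC)
    then have 1: "approximable s1 (e / 2) (conjugate u (rank_one \<omega> \<omega> o\<^sub>L b o\<^sub>L qcorner n))"
      using s1[OF b] by simp
    have "rank_one \<omega> \<omega> o\<^sub>L b = (rank_one \<omega> \<omega> o\<^sub>L b o\<^sub>L qcorner n) + (rank_one \<omega> \<omega> o\<^sub>L b o\<^sub>L p)"
      by (rule blinfun_eqI) (simp add: p_def basis_proj_Compl[OF fibre_hilbert_basis] blinfun.add_left blinfun.diff_left
          blinfun.diff_right cinner_diff_left complex_vector.scale_left_diff_distrib)
    then have "conjugate u (rank_one \<omega> \<omega> o\<^sub>L b)
        = conjugate u (rank_one \<omega> \<omega> o\<^sub>L b o\<^sub>L qcorner n) + conjugate u (rank_one \<omega> v o\<^sub>L c)"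
      by (metis conjugate_add eq1)
    then show ?thesis using approximable_add[OF 1 2] by simp
  qed
  then show "\<exists>s. \<forall>b\<in>prop_ball r. approximable s e (conjugate u (rank_one (?b i) (?b i) o\<^sub>L b))"
    unfolding \<omega>_def by blast
qed

lemma equi_approximable_rows:
  "equi_approximable (prop_ball r) (\<lambda>b. conjugate u (qcorner n o\<^sub>L b))"
proof (rule equi_approximable_cong[OF equi_approximable_sum[OF equi_approximable_row]])
  show "conjugate u (qcorner n o\<^sub>L b)
      = (\<Sum>i\<in>corner n. conjugate u (rank_one (fibre_basis \<xi> i) (fibre_basis \<xi> i) o\<^sub>L b))" for b
  proof -
    have "qcorner n o\<^sub>L b = (\<Sum>i\<in>corner n. rank_one (fibre_basis \<xi> i) (fibre_basis \<xi> i) o\<^sub>L b)"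
      by (rule blinfun_eqI) (simp add: basis_proj_finite[OF fibre_hilbert_basis finite_corner[OF cnt]] blinfun.sum_left)
    then show ?thesis by (simp add: conjugate_sum)
  qed
qed

text \<open>An operator differs from its compression to the complement of a corner by finitely many rows and
  columns.\<close>

lemma equi_approximable_conjugate: "equi_approximable (prop_ball r) (conjugate u)"
  unfolding equi_approximable_def
proof (intro allI impI)
  fix e :: real assume "e > 0"
  then have e3: "e / 3 > 0" by simp
  obtain n s where off: "\<And>b. b \<in> prop_ball r \<Longrightarrow>
      approximable s (e / 3) (conjugate u (bproj (- corner n) o\<^sub>L b o\<^sub>L bproj (- corner n)))"
    using approximable_off_corner[OF e3, of r] by blast
  define p where "p = bproj (- corner n)"
  have p: "p \<in> bounded_ops" "norm p \<le> 1" "prop_le 0 p" "adj p = p"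
    by (simp_all add: p_def bproj_simps adj_basis_proj[OF fibre_hilbert_basis])
  obtain t where t: "\<And>b. b \<in> prop_ball r \<Longrightarrow> approximable t (e / 3) (conjugate u (qcorner n o\<^sub>L b))"
    using equi_approximableD[OF equi_approximable_rows e3] by blast
  have "approximable (max s t) e (conjugate u b)" if b: "b \<in> prop_ball r" for b
  proof -
    have b_bdd: "b \<in> bounded_ops" by (rule prop_ball_bounded_ops[OF b])
    have "adj b o\<^sub>L p \<in> prop_ball r" by (intro prop_ball_compose_right p prop_ball_adj b)
    then have "approximable t (e / 3) (adj (conjugate u (qcorner n o\<^sub>L (adj b o\<^sub>L p))))"
      using u b_bdd p by (intro approximable_adj t) (simp_all add: bproj_simps)
    then have 3: "approximable t (e / 3) (conjugate u (p o\<^sub>L b o\<^sub>L qcorner n))"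
      using u b_bdd p by (simp add: bproj_simps adj_compose adj_basis_proj[OF fibre_hilbert_basis] flip: conjugate_adj)
    have "b = (p o\<^sub>L b o\<^sub>L p) + (p o\<^sub>L b o\<^sub>L qcorner n) + (qcorner n o\<^sub>L b)"
      by (rule blinfun_eqI) (simp add: p_def basis_proj_Compl[OF fibre_hilbert_basis] blinfun.add_left blinfun.diff_left
          blinfun.diff_right)
    then have "conjugate u b = conjugate u (p o\<^sub>L b o\<^sub>L p) + conjugate u (p o\<^sub>L b o\<^sub>L qcorner n) + conjugate u (qcorner n o\<^sub>L b)"
      by (metis conjugate_add)
    then show ?thesis
      using approximable_add[OF approximable_add[OF off[OF b, folded p_def] 3] t[OF b]]
      by (simp add: max.assoc)
  qed
  then show "\<exists>s. \<forall>b\<in>prop_ball r. approximable s e (conjugate u b)" by blast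
qed

end

section \<open>The coarse correspondence induced by a unitary\<close>

definition equi_unitary ::
  "(('x::metric_space, 'h::complex_hilbert) ell2 \<Rightarrow>\<^sub>L ('y::metric_space, 'h) ell2) \<Rightarrow> bool" where
  "equi_unitary u \<longleftrightarrow> unitary_map u \<and> (\<forall>r. equi_approximable (prop_ball r) (conjugate u))"

lemma equi_unitary_unitary_map: "equi_unitary u \<Longrightarrow> unitary_map u"
  by (simp add: equi_unitary_def)

lemma equi_unitaryE:
  assumes "equi_unitary u" "e > 0"
  obtains s where "\<And>b. b \<in> prop_ball r \<Longrightarrow> approximable s e (conjugate u b)"
  using assms unfolding equi_unitary_def equi_approximable_def by metis

text \<open>A correspondence instead of a map, since there is no canonical choice of \<open>y\<close> for \<open>x\<close>, and since this
  makes the roles of \<open>u\<close> and its adjoint symmetric.\<close>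

definition overlap ::
  "(('x, 'h::complex_hilbert) ell2 \<Rightarrow>\<^sub>L ('y, 'h) ell2) \<Rightarrow> real \<Rightarrow> ('x \<times> 'y) set" where
  "overlap u \<delta> = {(x, y). \<delta> \<le> norm (chi {y} o\<^sub>L u o\<^sub>L chi {x})}"

lemma overlap_adj:
  assumes "u \<in> bounded_ops"
  shows "overlap (adj u) \<delta> = (overlap u \<delta>)\<inverse>"
proof -
  have "norm (chi {x} o\<^sub>L adj u o\<^sub>L chi {y}) = norm (chi {y} o\<^sub>L u o\<^sub>L chi {x})" for x y
  proof -
    have "adj (chi {y} o\<^sub>L u o\<^sub>L chi {x}) = chi {x} o\<^sub>L adj u o\<^sub>L chi {y}"
      using assms by (simp add: adj_compose blinfun_compose_assoc)
    then show ?thesis using norm_adj[of "chi {y} o\<^sub>L u o\<^sub>L chi {x}"] assms by simp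
  qed
  then show ?thesis by (auto simp: overlap_def)
qed

lemma overlap_vector:
  fixes u :: "('x, 'h::complex_hilbert) ell2 \<Rightarrow>\<^sub>L ('y, 'h) ell2"
  assumes xy: "(x, y) \<in> overlap u \<delta>" and \<delta>: "\<delta> > 0"
  obtains \<xi> where "norm \<xi> \<le> 1" "norm (chi {y} (u (delta x \<xi>))) \<ge> \<delta> / 2"
proof (rule ccontr)
  note thesisI = that
  assume "\<not> thesis"
  then have small: "norm (chi {y} (u (delta x \<xi>))) \<le> \<delta> / 2" if "norm \<xi> \<le> 1" for \<xi>
    using thesisI[OF that] by linarith
  have "norm (chi {y} o\<^sub>L u o\<^sub>L chi {x}) \<le> \<delta> / 2"
  proof (rule norm_blinfun_bound)
    fix f :: "('x, 'h) ell2"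
    have "norm ((chi {y} o\<^sub>L u) (delta x (ell2_apply f x))) \<le> \<delta> / 2 * norm (ell2_apply f x)"
      by (rule norm_apply_delta_le) (simp only: blinfun_apply_blinfun_compose small)
    also have "\<dots> \<le> \<delta> / 2 * norm f"
      using \<delta> by (intro mult_left_mono norm_ell2_apply_le) auto
    finally show "norm ((chi {y} o\<^sub>L u o\<^sub>L chi {x}) f) \<le> \<delta> / 2 * norm f"
      by (simp add: chi_singleton)
  qed (use \<delta> in simp)
  then show False using xy \<delta> by (simp add: overlap_def)
qed

text \<open>An operator of propagation \<open>s\<close> has no block between sets further than \<open>s\<close> apart, whereas the block of
  a rank-one operator has the product of the two masses as its norm.\<close>

lemma approximable_rank_one_separated:
  fixes \<alpha> \<beta> :: "('y::metric_space, 'h::complex_hilbert) ell2"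
  assumes approx: "approximable s e (rank_one \<alpha> \<beta>)"
    and sep: "\<And>y z. y \<in> A \<Longrightarrow> z \<in> B \<Longrightarrow> dist z y > s"
  shows "norm (chi A \<alpha>) * norm (chi B \<beta>) \<le> e"
proof -
  obtain d where d: "prop_le s d" "norm (rank_one \<alpha> \<beta> - d) \<le> e"
    using approx by (auto simp: approximable_def)
  have e: "e \<ge> 0" using d(2) norm_ge_zero order_trans by blast
  have "chi A (d (chi B \<beta>)) = 0"
  proof (rule ell2_eqI)
    fix y
    have "ell2_apply (d (chi B \<beta>)) y = 0" if "y \<in> A"
      by (rule supported_apply_eq_0[of "band s"]) (use d(1) sep[OF that] in \<open>auto simp: prop_le_def not_less[symmetric]\<close>)
    then show "ell2_apply (chi A (d (chi B \<beta>))) y = ell2_apply 0 y" by simp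
  qed
  then have "chi A ((rank_one \<alpha> \<beta> - d) (chi B \<beta>)) = cinner (chi B \<beta>) \<beta> *\<^sub>C chi A \<alpha>"
    by (simp add: blinfun.diff_left blinfun.diff_right bounded_ops_scaleC)
  moreover have "cinner (chi B \<beta>) \<beta> = complex_of_real ((norm (chi B \<beta>))\<^sup>2)"
    unfolding cinner_self[symmetric] cinner_chi_left by simp
  ultimately have "(norm (chi B \<beta>))\<^sup>2 * norm (chi A \<alpha>) = norm (chi A ((rank_one \<alpha> \<beta> - d) (chi B \<beta>)))"
    by (simp add: norm_scaleC norm_power)
  also have "\<dots> \<le> norm ((rank_one \<alpha> \<beta> - d) (chi B \<beta>))" by (rule norm_chi_apply_le)
  also have "\<dots> \<le> e * norm (chi B \<beta>)"
    using norm_blinfun[of "rank_one \<alpha> \<beta> - d" "chi B \<beta>"] mult_right_mono[OF d(2), of "norm (chi B \<beta>)"] by simp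
  finally show ?thesis
    using e by (cases "norm (chi B \<beta>) = 0") (simp_all add: power2_eq_square mult.commute)
qed

lemma equi_unitary_separated:
  fixes u :: "('x::metric_space, 'h::complex_hilbert) ell2 \<Rightarrow>\<^sub>L ('y::metric_space, 'h) ell2"
  assumes u: "equi_unitary u" and e: "e > 0"
  obtains s where "\<And>x x' \<xi> \<xi>' A B. dist x x' \<le> r \<Longrightarrow> norm \<xi> \<le> 1 \<Longrightarrow> norm \<xi>' \<le> 1 \<Longrightarrow>
    (\<And>y z. y \<in> A \<Longrightarrow> z \<in> B \<Longrightarrow> dist z y > s) \<Longrightarrow>
    norm (chi A (u (delta x' \<xi>'))) * norm (chi B (u (delta x \<xi>))) \<le> e"
proof -
  note un = equi_unitary_unitary_map[OF u]
  obtain s where s: "\<And>b. b \<in> prop_ball r \<Longrightarrow> approximable s e (conjugate u b)"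
    by (rule equi_unitaryE[OF u e]) blast
  show ?thesis
  proof (rule that[of s])
    fix x x' :: 'x and \<xi> \<xi>' :: 'h and A B :: "'y set"
    assume d: "dist x x' \<le> r" and n: "norm \<xi> \<le> 1" "norm \<xi>' \<le> 1"
      and sep: "\<And>y z. y \<in> A \<Longrightarrow> z \<in> B \<Longrightarrow> dist z y > s"
    have "supported (band r) (rank_one (delta x' \<xi>') (delta x \<xi>))"
      using d by (auto simp: supported_def cinner_delta_right ell2_apply_scaleC)
    moreover have "norm (rank_one (delta x' \<xi>') (delta x \<xi>)) \<le> 1"
      using norm_rank_one_le[of "delta x' \<xi>'" "delta x \<xi>"] mult_le_one[OF n(2) norm_ge_zero n(1)]
      by (simp add: norm_delta)
    ultimately have "rank_one (delta x' \<xi>') (delta x \<xi>) \<in> prop_ball r"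
      by (simp add: prop_ball_def prop_le_def)
    then have "approximable s e (rank_one (u (delta x' \<xi>')) (u (delta x \<xi>)))"
      using s by (simp flip: conjugate_rank_one[OF un])
    then show "norm (chi A (u (delta x' \<xi>'))) * norm (chi B (u (delta x \<xi>))) \<le> e"
      by (rule approximable_rank_one_separated) (rule sep)
  qed
qed

text \<open>Both fibres send a fixed amount of mass to their overlapping points, so these cannot be far apart
  when the two fibres are connected by operators of small propagation.\<close>

lemma overlap_coarse:
  fixes u :: "('x::metric_space, 'h::complex_hilbert) ell2 \<Rightarrow>\<^sub>L ('y::metric_space, 'h) ell2"
  assumes u: "equi_unitary u" and \<delta>: "\<delta> > 0"
  obtains s where "\<And>x y x' y'. (x, y) \<in> overlap u \<delta> \<Longrightarrow> (x', y') \<in> overlap u \<delta> \<Longrightarrow>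
    dist x x' \<le> r \<Longrightarrow> dist y y' \<le> s"
proof -
  have "\<delta>\<^sup>2 / 8 > 0" using \<delta> by simp
  then obtain s where s: "\<And>x x' \<xi> \<xi>' A B. dist x x' \<le> r \<Longrightarrow> norm \<xi> \<le> 1 \<Longrightarrow> norm \<xi>' \<le> 1 \<Longrightarrow>
    (\<And>y z. y \<in> A \<Longrightarrow> z \<in> B \<Longrightarrow> dist z y > s) \<Longrightarrow>
    norm (chi A (u (delta x' \<xi>'))) * norm (chi B (u (delta x \<xi>))) \<le> \<delta>\<^sup>2 / 8"
    by (rule equi_unitary_separated[OF u]) blast
  show ?thesis
  proof (rule that[of s], rule ccontr)
    fix x y x' y' assume xy: "(x, y) \<in> overlap u \<delta>" "(x', y') \<in> overlap u \<delta>"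
      and d: "dist x x' \<le> r" and far: "\<not> dist y y' \<le> s"
    obtain \<xi> where \<xi>: "norm \<xi> \<le> 1" "norm (chi {y} (u (delta x \<xi>))) \<ge> \<delta> / 2"
      by (rule overlap_vector[OF xy(1) \<delta>])
    obtain \<xi>' where \<xi>': "norm \<xi>' \<le> 1" "norm (chi {y'} (u (delta x' \<xi>'))) \<ge> \<delta> / 2"
      by (rule overlap_vector[OF xy(2) \<delta>])
    have "\<delta> / 2 * (\<delta> / 2) \<le> norm (chi {y'} (u (delta x' \<xi>'))) * norm (chi {y} (u (delta x \<xi>)))"
      using \<xi> \<xi>' \<delta> by (intro mult_mono) auto
    also have "\<dots> \<le> \<delta>\<^sup>2 / 8" by (rule s[OF d \<xi>(1) \<xi>'(1)]) (use far in auto)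
    finally show False using \<delta> by (simp add: power2_eq_square)
  qed
qed

text \<open>All vectors of a fibre are connected by operators of propagation 0 to the one vector that
  has mass at \<open>y\<close>.\<close>

lemma overlap_concentrated:
  fixes u :: "('x::metric_space, 'h::complex_hilbert) ell2 \<Rightarrow>\<^sub>L ('y::metric_space, 'h) ell2"
  assumes u: "equi_unitary u" and \<delta>: "\<delta> > 0" and e: "e > 0"
  obtains R where "\<And>x y \<xi>. (x, y) \<in> overlap u \<delta> \<Longrightarrow>
    norm (chi (- cball y R) (u (delta x \<xi>))) \<le> e * norm \<xi>"
proof -
  have "e * \<delta> / 2 > 0" using \<delta> e by simp
  then obtain s where s: "\<And>x x' \<xi> \<xi>' A B. dist x x' \<le> 0 \<Longrightarrow> norm \<xi> \<le> 1 \<Longrightarrow> norm \<xi>' \<le> 1 \<Longrightarrow>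
    (\<And>y z. y \<in> A \<Longrightarrow> z \<in> B \<Longrightarrow> dist z y > s) \<Longrightarrow>
    norm (chi A (u (delta x' \<xi>'))) * norm (chi B (u (delta x \<xi>))) \<le> e * \<delta> / 2"
    by (rule equi_unitary_separated[OF u]) blast
  show ?thesis
  proof (rule that[of s])
    fix x y \<xi> assume xy: "(x, y) \<in> overlap u \<delta>"
    obtain \<eta> where \<eta>: "norm \<eta> \<le> 1" "norm (chi {y} (u (delta x \<eta>))) \<ge> \<delta> / 2"
      by (rule overlap_vector[OF xy \<delta>])
    have unit: "norm (chi (- cball y s) (u (delta x \<xi>))) \<le> e" if "norm \<xi> \<le> 1" for \<xi>
    proof -
      have "norm (chi (- cball y s) (u (delta x \<xi>))) * (\<delta> / 2)
          \<le> norm (chi (- cball y s) (u (delta x \<xi>))) * norm (chi {y} (u (delta x \<eta>)))"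
        using \<eta> by (intro mult_left_mono) auto
      also have "\<dots> \<le> e * \<delta> / 2" by (rule s[OF _ \<eta>(1) that]) auto
      finally show ?thesis using \<delta> by simp
    qed
    then show "norm (chi (- cball y s) (u (delta x \<xi>))) \<le> e * norm \<xi>"
      using norm_apply_delta_le[of "chi (- cball y s) o\<^sub>L u" x e \<xi>] by simp
  qed
qed

lemma ediam_le_iff: "r \<ge> 0 \<Longrightarrow> ediam S \<le> ennreal r \<longleftrightarrow> (\<forall>x\<in>S. \<forall>y\<in>S. dist x y \<le> r)"
  unfolding ediam_def SUP_le_iff by (auto simp: ennreal_le_iff)

text \<open>Operator norm localisation of approximants to the projections \<open>u \<chi>\<^sub>x u\<^sup>*\<close> makes some point
  \<open>y\<close> carry a fixed proportion of the mass.\<close>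

lemma overlap_total:
  fixes u :: "('x::metric_space, 'h::complex_hilbert) ell2 \<Rightarrow>\<^sub>L ('y::metric_space, 'h) ell2"
  assumes u: "equi_unitary u" and Y: "uniformly_locally_finite TYPE('y)"
    and A: "property_A TYPE('y) TYPE('h)" and h: "norm (h::'h) = 1"
  obtains \<delta> where "\<delta> > 0" "\<And>x. \<exists>y. (x, y) \<in> overlap u \<delta>"
proof -
  note un = equi_unitary_unitary_map[OF u]
  obtain s0 where s0: "\<And>b. b \<in> prop_ball 0 \<Longrightarrow> approximable s0 (1 / 4) (conjugate u b)"
    by (rule equi_unitaryE[OF u, of "1 / 4" 0]) auto
  define s where "s = max s0 1"
  have "s > 0" by (simp add: s_def)
  then obtain r where r: "r > 0" "\<And>a. (a :: ('y, 'h) ell2 \<Rightarrow>\<^sub>L ('y, 'h) ell2) \<in> bounded_ops \<Longrightarrow>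
      propagation a \<le> ennreal s \<Longrightarrow>
      \<exists>\<xi>. norm \<xi> = 1 \<and> ediam {x. ell2_apply \<xi> x \<noteq> 0} \<le> ennreal r \<and> norm (a \<xi>) \<ge> 1 / 2 * norm a"
    using A[unfolded property_A_def, rule_format, of s "1 / 2"] by auto
  obtain N where N: "\<And>y::'y. finite (cball y r) \<and> card (cball y r) \<le> N"
    using Y r(1) unfolding uniformly_locally_finite_def by blast
  \<comment> \<open>The localised vector keeps mass \<open>1/2 * (1 - 1/4) - 1/4 = 1/8\<close>, spread over at most \<open>N\<close> points.\<close>
  define \<delta> where "\<delta> = 1 / (8 * (real N + 1))"
  show ?thesis
  proof (rule that[of \<delta>])
    show "\<delta> > 0" by (simp add: \<delta>_def)
    fix x :: 'x
    have "chi {x} \<in> prop_ball 0" by (simp add: prop_ball_def prop_le_chi norm_chi_le)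
    from s0[OF this] obtain d where d: "prop_le s0 d" "norm (conjugate u (chi {x}) - d) \<le> 1 / 4"
      by (auto simp: approximable_def)
    have "prop_le s d" using d(1) by (rule prop_le_mono) (simp add: s_def)
    then have "propagation d \<le> ennreal s" "d \<in> bounded_ops"
      using \<open>s > 0\<close> by (simp_all add: propagation_le_iff prop_le_def)
    then obtain \<eta> where \<eta>: "norm \<eta> = 1" "ediam {y. ell2_apply \<eta> y \<noteq> 0} \<le> ennreal r"
      "norm (d \<eta>) \<ge> 1 / 2 * norm d" using r(2) by blast
    have "norm (conjugate u (chi {x})) \<ge> 1"
    proof -
      have "conjugate u (chi {x}) (u (delta x h)) = u (delta x h)" using un by (simp add: chi_delta)
      then show ?thesis
        using norm_blinfun[of "conjugate u (chi {x})" "u (delta x h)"] un h by (simp add: norm_delta)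
    qed
    then have "norm d \<ge> 3 / 4" using d(2) norm_triangle_ineq2[of "conjugate u (chi {x})" d] by linarith
    then have "norm (d \<eta>) \<ge> 3 / 8" using \<eta>(3) by linarith
    moreover have "norm (conjugate u (chi {x}) \<eta> - d \<eta>) \<le> 1 / 4"
      using norm_blinfun[of "conjugate u (chi {x}) - d" \<eta>] d(2) \<eta>(1) by (simp add: blinfun.diff_left)
    ultimately have "norm (conjugate u (chi {x}) \<eta>) \<ge> 1 / 8"
      using norm_triangle_ineq3[of "conjugate u (chi {x}) \<eta>" "d \<eta>"] by linarith
    then have big: "norm ((chi {x} o\<^sub>L adj u) \<eta>) \<ge> 1 / 8" using un by simp
    define D where "D = {y. ell2_apply \<eta> y \<noteq> 0}"
    have "\<eta> \<noteq> 0" using \<eta>(1) by auto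
    then obtain y0 where y0: "y0 \<in> D" unfolding D_def by (metis (mono_tags) ell2_apply_zero ell2_eqI mem_Collect_eq)
    have "D \<subseteq> cball y0 r"
      using \<eta>(2) r(1) y0 by (auto simp: ediam_le_iff D_def)
    then have D: "finite D" "card D \<le> N"
      using N[of y0] by (auto intro: finite_subset order_trans[OF card_mono])
    have "\<exists>y\<in>D. \<delta> \<le> norm (chi {x} o\<^sub>L adj u o\<^sub>L chi {y})"
    proof (rule ccontr)
      assume "\<not> ?thesis"
      then have "norm ((chi {x} o\<^sub>L adj u) o\<^sub>L chi {y}) \<le> \<delta>" if "y \<in> D" for y using that by force
      then have "(\<Sum>y\<in>D. norm ((chi {x} o\<^sub>L adj u) o\<^sub>L chi {y})) \<le> real (card D) * \<delta>"
        by (rule sum_bounded_above)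
      also have "\<dots> \<le> real N * \<delta>" using D(2) by (intro mult_right_mono) (auto simp: \<delta>_def)
      also have "\<dots> < 1 / 8" by (simp add: \<delta>_def field_simps)
      finally have "(\<Sum>y\<in>D. norm ((chi {x} o\<^sub>L adj u) o\<^sub>L chi {y})) * norm \<eta> < 1 / 8"
        by (simp add: \<eta>(1))
      moreover have "norm ((chi {x} o\<^sub>L adj u) \<eta>)
          \<le> (\<Sum>y\<in>D. norm ((chi {x} o\<^sub>L adj u) o\<^sub>L chi {y})) * norm \<eta>"
        by (rule norm_apply_le_sum_fibres[OF D(1)]) (simp add: D_def)
      ultimately show False using big by linarith
    qed
    then obtain y where "(y, x) \<in> overlap (adj u) \<delta>" by (auto simp: overlap_def)
    then show "\<exists>y. (x, y) \<in> overlap u \<delta>" using overlap_adj[of u \<delta>] un by auto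
  qed
qed


section \<open>Isometries from maps of index sets\<close>

definition index_map ::
  "(nat \<Rightarrow> 'h::complex_hilbert) \<Rightarrow> (nat \<Rightarrow> 'h) \<Rightarrow> ('x \<times> nat \<Rightarrow> 'y \<times> nat) \<Rightarrow> (('x, 'h) ell2 \<Rightarrow>\<^sub>L ('y, 'h) ell2)" where
  "index_map \<xi> \<zeta> k = basis_map (fibre_basis \<xi>) (\<lambda>p. fibre_basis \<zeta> (k p))"

context
  fixes \<xi> \<zeta> :: "nat \<Rightarrow> 'h::complex_hilbert" and k :: "'x \<times> nat \<Rightarrow> 'y \<times> nat"
  assumes \<xi>: "orthonormal_basis \<xi>" and \<zeta>: "orthonormal_basis \<zeta>" and k: "inj k"
begin

lemma orthogonal_family_index_map: "orthogonal_family (\<lambda>p. fibre_basis \<zeta> (k p) :: ('y, 'h) ell2)"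
  using hilbert_basis_fibre_basis[OF \<zeta>, where 'x = 'y] k
  by (auto simp: orthogonal_family_def hilbert_basis_cinner inj_eq)

lemma index_map_basis: "index_map \<xi> \<zeta> k (fibre_basis \<xi> p) = fibre_basis \<zeta> (k p)"
  unfolding index_map_def by (rule basis_map_apply[OF hilbert_basis_fibre_basis[OF \<xi>] orthogonal_family_index_map])

lemma index_map_bounded_ops: "index_map \<xi> \<zeta> k \<in> bounded_ops"
  unfolding index_map_def by (rule bounded_ops_basis_map[OF hilbert_basis_fibre_basis[OF \<xi>] orthogonal_family_index_map])

lemma norm_index_map_le: "norm (index_map \<xi> \<zeta> k) \<le> 1"
  unfolding index_map_def by (rule norm_basis_map_le[OF hilbert_basis_fibre_basis[OF \<xi>] orthogonal_family_index_map])

lemma adj_index_map_basis: "adj (index_map \<xi> \<zeta> k) (fibre_basis \<zeta> (k p)) = fibre_basis \<xi> p"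
proof (rule hilbert_basis_eqI[OF hilbert_basis_fibre_basis[OF \<xi>]])
  show "cinner (adj (index_map \<xi> \<zeta> k) (fibre_basis \<zeta> (k p))) (fibre_basis \<xi> i)
      = cinner (fibre_basis \<xi> p :: ('x, 'h) ell2) (fibre_basis \<xi> i)" for i
    using k by (simp add: cinner_adj_left index_map_bounded_ops index_map_basis inj_eq
        hilbert_basis_cinner[OF hilbert_basis_fibre_basis[OF \<xi>]]
        hilbert_basis_cinner[OF hilbert_basis_fibre_basis[OF \<zeta>]])
qed

lemma index_map_isometry: "adj (index_map \<xi> \<zeta> k) o\<^sub>L index_map \<xi> \<zeta> k = id_blinfun"
  by (rule op_eq_on_basis[OF hilbert_basis_fibre_basis[OF \<xi>]])
    (simp_all add: index_map_bounded_ops index_map_basis adj_index_map_basis)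

lemma index_map_unitary: "surj k \<Longrightarrow> unitary_map (index_map \<xi> \<zeta> k)"
  unfolding unitary_map_def
proof (intro conjI index_map_bounded_ops index_map_isometry)
  assume s: "surj k"
  show "index_map \<xi> \<zeta> k o\<^sub>L adj (index_map \<xi> \<zeta> k) = id_blinfun"
  proof (rule op_eq_on_basis[OF hilbert_basis_fibre_basis[OF \<zeta>]])
    fix q
    obtain p where "q = k p" using s by (metis surjD)
    then show "(index_map \<xi> \<zeta> k o\<^sub>L adj (index_map \<xi> \<zeta> k)) (fibre_basis \<zeta> q) = id_blinfun (fibre_basis \<zeta> q)"
      by (simp add: index_map_basis adj_index_map_basis)
  qed (simp_all add: index_map_bounded_ops)
qed

lemma supported_index_map:
  assumes "\<And>x n. (x, fst (k (x, n))) \<in> E"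
  shows "supported E (index_map \<xi> \<zeta> k)"
proof (rule supported_basisI[OF \<xi> index_map_bounded_ops])
  fix x y n assume "(x, y) \<notin> E"
  then have "fst (k (x, n)) \<noteq> y" using assms by metis
  then show "ell2_apply (index_map \<xi> \<zeta> k (delta x (\<xi> n))) y = 0"
    using index_map_basis[of "(x, n)"] by (cases "k (x, n)") (simp add: fibre_basis_def)
qed

end

text \<open>The isometry \<open>V\<close> that puts the fibre over \<open>x\<close> into the fibre over \<open>f x\<close> transports operators of finite
  propagation to such operators. The infinite-dimensional fibre over a point \<open>y\<close> accommodates the fibres
  over all preimages of \<open>y\<close>.\<close>

lemma property_A_coarse_embedding:
  fixes f :: "'x::metric_space \<Rightarrow> 'y::metric_space" and \<xi> :: "nat \<Rightarrow> 'h::complex_hilbert"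
  assumes \<xi>: "orthonormal_basis \<xi>" and cnt: "countable (UNIV :: 'x set)"
    and up: "\<And>r. \<exists>s. \<forall>x x'. dist x x' \<le> r \<longrightarrow> dist (f x) (f x') \<le> s"
    and low: "\<And>r. \<exists>s. \<forall>x x'. dist (f x) (f x') \<le> r \<longrightarrow> dist x x' \<le> s"
    and A: "property_A TYPE('y) TYPE('h)"
  shows "property_A TYPE('x) TYPE('h)"
  unfolding property_A_def
proof (intro allI impI)
  fix s \<rho> :: real assume s: "s > 0" and \<rho>: "0 < \<rho> \<and> \<rho> < 1"
  define k where "k = (\<lambda>(x::'x, n). (f x, prod_encode (index x, n)))"
  have k: "inj k" using inj_index[OF cnt] by (auto simp: inj_def k_def)
  define V where "V = (index_map \<xi> \<xi> k :: ('x, 'h) ell2 \<Rightarrow>\<^sub>L ('y, 'h) ell2)"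
  note V_bdd = index_map_bounded_ops[OF \<xi> \<xi> k, folded V_def]
  have V_supp: "supported {(x, f x) |x. True} V"
    unfolding V_def by (rule supported_index_map[OF \<xi> \<xi> k]) (simp add: k_def)
  have VV: "adj V (V z) = z" for z
    using index_map_isometry[OF \<xi> \<xi> k] unfolding V_def
    by (metis blinfun_apply_blinfun_compose id_blinfun.rep_eq)
  have normV: "norm V \<le> 1" unfolding V_def by (rule norm_index_map_le[OF \<xi> \<xi> k])
  have V_adj_le: "norm (adj V z) \<le> norm z" for z
    using norm_blinfun[of "adj V" z] mult_right_mono[OF normV, of "norm z"] V_bdd by simp
  have V_norm: "norm (V z) = norm z" for z
  proof -
    have "cinner (V z) (V z) = cinner z z" using cinner_adj_right[OF V_bdd, of z "V z"] VV by simp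
    then show ?thesis by (metis norm_sq_cinner norm_ge_zero power2_eq_imp_eq)
  qed
  obtain s1 where s1: "\<And>x x'. dist x x' \<le> s \<Longrightarrow> dist (f x) (f x') \<le> s1" using up by metis
  define s' where "s' = max s1 1"
  have "s' > 0" by (simp add: s'_def)
  then obtain r where r: "r > 0" "\<And>a. (a :: ('y, 'h) ell2 \<Rightarrow>\<^sub>L ('y, 'h) ell2) \<in> bounded_ops \<Longrightarrow>
      propagation a \<le> ennreal s' \<Longrightarrow>
      \<exists>\<xi>. norm \<xi> = 1 \<and> ediam {x. ell2_apply \<xi> x \<noteq> 0} \<le> ennreal r \<and> norm (a \<xi>) \<ge> \<rho> * norm a"
    using A[unfolded property_A_def, rule_format, of s' \<rho>] \<rho> by auto
  obtain r1 where r1: "\<And>x x'. dist (f x) (f x') \<le> r \<Longrightarrow> dist x x' \<le> r1" using low by metis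
  define r' where "r' = max r1 1"
  have r': "r' > 0" by (simp add: r'_def)
  have "\<exists>\<theta>. norm \<theta> = 1 \<and> ediam {x. ell2_apply \<theta> x \<noteq> 0} \<le> ennreal r' \<and> norm (a \<theta>) \<ge> \<rho> * norm a"
    if a: "a \<in> bounded_ops" "propagation a \<le> ennreal s" for a :: "('x, 'h) ell2 \<Rightarrow>\<^sub>L ('x, 'h) ell2"
  proof -
    define b where "b = conjugate V a"
    have "supported (band s) a" using a s by (simp add: propagation_le_iff)
    then have "supported ({(x, f x) |x. True}\<inverse> O band s O {(x, f x) |x. True}) b"
      unfolding b_def conjugate_def blinfun_compose_assoc
      by (metis (no_types) O_assoc V_bdd V_supp supported_adj supported_compose)
    then have "supported (band s') b"
      by (rule supported_mono) (use s1 in \<open>force simp: s'_def\<close>)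
    then have "propagation b \<le> ennreal s'" using \<open>s' > 0\<close> by (simp add: propagation_le_iff)
    moreover have "b \<in> bounded_ops" by (simp add: b_def a V_bdd)
    ultimately obtain \<eta> where \<eta>: "norm \<eta> = 1" "ediam {y. ell2_apply \<eta> y \<noteq> 0} \<le> ennreal r"
      "norm (b \<eta>) \<ge> \<rho> * norm b" using r(2) by blast
    have "norm a \<le> norm b"
    proof (rule norm_blinfun_bound)
      fix z
      have "norm (a z) = norm (b (V z))" by (simp add: b_def VV V_norm)
      then show "norm (a z) \<le> norm b * norm z" using norm_blinfun[of b "V z"] by (simp add: V_norm)
    qed simp
    then have "\<rho> * norm a \<le> \<rho> * norm b" using \<rho> by (intro mult_left_mono) auto
    define \<theta> where "\<theta> = adj V \<eta>"
    have a\<theta>: "norm (a \<theta>) \<ge> \<rho> * norm a"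
      using \<eta>(3) \<open>\<rho> * norm a \<le> \<rho> * norm b\<close> by (simp add: b_def \<theta>_def V_norm)
    have n\<theta>: "norm \<theta> \<le> 1" using V_adj_le[of \<eta>] \<eta>(1) by (simp add: \<theta>_def)
    show ?thesis
    proof (cases "\<theta> = 0")
      case True
      then have "norm a = 0" using a\<theta> \<rho> by (simp add: mult_le_0_iff)
      fix x0 :: 'x
      define \<theta>0 where "\<theta>0 = delta x0 (\<xi> 0)"
      have "norm \<theta>0 = 1"
        using norm_hilbert_basis[OF orthonormal_basis_hilbert_basis[OF \<xi>]] by (simp add: \<theta>0_def norm_delta)
      moreover have "ediam {x. ell2_apply \<theta>0 x \<noteq> 0} \<le> ennreal r'"
        using r' by (auto simp: ediam_le_iff \<theta>0_def)
      ultimately show ?thesis using \<open>norm a = 0\<close> by (intro exI[of _ \<theta>0]) simp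
    next
      case False
      then have n: "norm \<theta> > 0" by simp
      define \<theta>1 where "\<theta>1 = (1 / norm \<theta>) *\<^sub>R \<theta>"
      have "norm \<theta>1 = 1" using n by (simp add: \<theta>1_def)
      moreover have "ediam {x. ell2_apply \<theta>1 x \<noteq> 0} \<le> ennreal r'"
      proof -
        have supp: "ell2_apply \<eta> (f x) \<noteq> 0" if "ell2_apply \<theta>1 x \<noteq> 0" for x
        proof
          assume "ell2_apply \<eta> (f x) = 0"
          then have "ell2_apply \<theta> x = 0"
            unfolding \<theta>_def by (intro supported_apply_eq_0[OF supported_adj[OF V_bdd V_supp]]) auto
          then show False using that by (simp add: \<theta>1_def ell2_apply_scaleR)
        qed
        have "dist x x' \<le> r'" if "ell2_apply \<theta>1 x \<noteq> 0" "ell2_apply \<theta>1 x' \<noteq> 0" for x x'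
        proof -
          have "dist (f x) (f x') \<le> r" using supp[OF that(1)] supp[OF that(2)] \<eta>(2) r(1) by (auto simp: ediam_le_iff)
          then show ?thesis using r1 by (fastforce simp: r'_def)
        qed
        then show ?thesis using r' by (auto simp: ediam_le_iff)
      qed
      moreover have "norm (a \<theta>1) \<ge> \<rho> * norm a"
      proof -
        have "norm (a \<theta>) \<le> norm (a \<theta>) / norm \<theta>" using n n\<theta> by (simp add: field_simps mult_left_le_one_le)
        then show ?thesis using a\<theta> n by (simp add: \<theta>1_def blinfun.scaleR_right)
      qed
      ultimately show ?thesis by blast
    qed
  qed
  then show "\<exists>r>0. \<forall>a\<in>bounded_ops. propagation (a :: ('x, 'h) ell2 \<Rightarrow>\<^sub>L ('x, 'h) ell2) \<le> ennreal s \<longrightarrow>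
      (\<exists>\<xi>. norm \<xi> = 1 \<and> ediam {x. ell2_apply \<xi> x \<noteq> 0} \<le> ennreal r \<and> norm (a \<xi>) \<ge> \<rho> * norm a)"
    using r' by blast
qed


section \<open>A bijection along a correspondence\<close>

text \<open>The bijection of the Cantor-Bernstein theorem, with the information that it is contained in the union of
  the graph of one injection and the converse of the other.\<close>

lemma cantor_bernstein_subset:
  assumes i: "inj i" and j: "inj j"
  obtains k where "bij k" "\<And>p. k p = i p \<or> j (k p) = p"
proof -
  define S where "S = lfp (\<lambda>S. - j ` (- (i ` S)))"
  have "mono (\<lambda>S. - j ` (- (i ` S)))" by (intro monoI) blast
  then have S: "S = - j ` (- (i ` S))" unfolding S_def by (rule lfp_unfold)
  define k where "k p = (if p \<in> S then i p else inv j p)" for p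
  have off: "p \<notin> S \<Longrightarrow> j (k p) = p \<and> k p \<notin> i ` S" for p
  proof -
    assume p: "p \<notin> S"
    then obtain q where "p = j q" "q \<notin> i ` S" using S by blast
    then show ?thesis using p j by (simp add: k_def)
  qed
  have "inj k"
  proof (rule injI)
    fix p q assume eq: "k p = k q"
    show "p = q"
    proof (cases "p \<in> S"; cases "q \<in> S")
      assume "p \<in> S" "q \<in> S" then show ?thesis using eq i by (simp add: k_def inj_eq)
    next
      assume pq: "p \<in> S" "q \<notin> S"
      then have "k p \<in> i ` S" by (simp add: k_def)
      then show ?thesis using eq off[OF pq(2)] by simp
    next
      assume pq: "p \<notin> S" "q \<in> S"
      then have "k q \<in> i ` S" by (simp add: k_def)
      then show ?thesis using eq off[OF pq(1)] by simp
    next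
      assume "p \<notin> S" "q \<notin> S" then show ?thesis using eq off by metis
    qed
  qed
  moreover have "surj k"
    unfolding surj_def
  proof
    fix q
    show "\<exists>p. q = k p"
    proof (cases "q \<in> i ` S")
      case True then show ?thesis by (auto simp: k_def)
    next
      case False
      then have "j q \<notin> S" using S by blast
      then show ?thesis using j by (intro exI[of _ "j q"]) (simp add: k_def)
    qed
  qed
  ultimately have "bij k" by (rule bijI)
  moreover have "k p = i p \<or> j (k p) = p" for p using off[of p] by (auto simp: k_def)
  ultimately show ?thesis by (rule that)
qed

text \<open>The factor \<^typ>\<open>nat\<close> turns choice functions of the correspondence into injections.\<close>

lemma correspondence_bijection:
  fixes E :: "('x \<times> 'y) set"
  assumes cnt: "countable (UNIV :: 'x set)" "countable (UNIV :: 'y set)"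
    and tot: "\<And>x. \<exists>y. (x, y) \<in> E" "\<And>y. \<exists>x. (x, y) \<in> E"
  obtains k :: "'x \<times> nat \<Rightarrow> 'y \<times> nat" where "bij k" "\<And>x n. (x, fst (k (x, n))) \<in> E"
proof -
  obtain f g where f: "\<And>x. (x, f x) \<in> E" and g: "\<And>y. (g y, y) \<in> E" using tot by metis
  define i where "i = (\<lambda>(x, n). (f x, prod_encode (index x, n)))"
  define j where "j = (\<lambda>(y, n). (g y, prod_encode (index y, n)))"
  have ij: "inj i" "inj j" using inj_index[OF cnt(1)] inj_index[OF cnt(2)] by (auto simp: inj_def i_def j_def)
  obtain k where k: "bij k" "\<And>p. k p = i p \<or> j (k p) = p" by (rule cantor_bernstein_subset[OF ij]) blast
  have "(x, fst (k (x, n))) \<in> E" for x n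
  proof -
    obtain y m where ym: "k (x, n) = (y, m)" by (cases "k (x, n)")
    then consider "y = f x" | "x = g y" using k(2)[of "(x, n)"] by (auto simp: i_def j_def)
    then show ?thesis using f[of x] g[of y] ym by cases auto
  qed
  with k(1) show ?thesis by (rule that)
qed

section \<open>Unitaries along the correspondence differ by a band-dominated unitary\<close>

text \<open>Greedy colouring along an enumeration: at most \<open>N\<close> of the \<open>N + 1\<close> colours are taken by neighbours
  when a point is coloured.\<close>

lemma bounded_degree_colouring:
  fixes G :: "'x \<Rightarrow> 'x \<Rightarrow> bool"
  assumes cnt: "countable (UNIV :: 'x set)" and sym: "\<And>x y. G x y \<Longrightarrow> G y x"
    and deg: "\<And>x. finite {y. G x y} \<and> card {y. G x y} \<le> N"
  obtains c :: "'x \<Rightarrow> nat" where "\<And>x. c x \<le> N" "\<And>x y. x \<noteq> y \<Longrightarrow> G x y \<Longrightarrow> c x \<noteq> c y"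
proof -
  define W where "W x = {y. index y < index x \<and> G x y}" for x
  define c :: "'x \<Rightarrow> nat" where "c = wfrec (inv_image less_than index) (\<lambda>g x. LEAST m. m \<notin> g ` W x)"
  have c: "c x = (LEAST m. m \<notin> c ` W x)" for x
  proof -
    have "c x = (LEAST m. m \<notin> cut c (inv_image less_than index) x ` W x)"
      unfolding c_def by (rule trans[OF wfrec[OF wf_inv_image[OF wf_less_than]]]) simp
    moreover have "cut c (inv_image less_than index) x ` W x = c ` W x"
      by (rule image_cong[OF refl]) (simp add: cut_apply W_def)
    ultimately show ?thesis by simp
  qed
  have ex: "\<exists>m\<le>N. m \<notin> c ` W x" for x
  proof (rule ccontr)
    assume "\<not> ?thesis"
    then have sub: "{..N} \<subseteq> c ` W x" by auto
    have fin: "finite (W x)" using deg[of x] by (auto simp: W_def intro: finite_subset)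
    have "card {..N} \<le> card (W x)"
      using card_mono[OF finite_imageI[OF fin] sub] card_image_le[OF fin, of c] by simp
    also have "\<dots> \<le> card {y. G x y}" using deg[of x] by (intro card_mono) (auto simp: W_def)
    finally show False using deg[of x] by simp
  qed
  have "c x \<le> N" for x
  proof -
    obtain m where "m \<le> N" "m \<notin> c ` W x" using ex by blast
    then show ?thesis unfolding c[of x] using Least_le[of "\<lambda>m. m \<notin> c ` W x" m] by linarith
  qed
  moreover have notin: "c x \<notin> c ` W x" for x
  proof -
    obtain m where "m \<notin> c ` W x" using ex by blast
    then have "(LEAST m. m \<notin> c ` W x) \<notin> c ` W x" by (rule LeastI)
    then show ?thesis by (simp flip: c)
  qed
  moreover have "c x \<noteq> c y" if xy: "x \<noteq> y" "G x y" for x y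
  proof -
    have "index x \<noteq> index y" using inj_index[OF cnt] xy(1) by (simp add: inj_eq)
    then consider "y \<in> W x" | "x \<in> W y" using xy(2) sym by (force simp: W_def)
    then show ?thesis using notin[of x] notin[of y] by cases (auto simp: image_iff)
  qed
  ultimately show ?thesis using that by blast
qed

lemma approximable_midpoint:
  assumes "approximable s e a" "approximable s e b"
  shows "approximable s e ((1 / 2) *\<^sub>R (a + b))"
proof -
  obtain c d where c: "prop_le s c" "norm (a - c) \<le> e" and d: "prop_le s d" "norm (b - d) \<le> e"
    using assms by (auto simp: approximable_def)
  have "prop_le s ((1 / 2) *\<^sub>R (c + d))"
    using prop_le_add[OF c(1) d(1)]
    by (simp add: prop_le_def supported_def blinfun.scaleR_left ell2_apply_scaleR)
  moreover have "norm ((1 / 2) *\<^sub>R (a + b) - (1 / 2) *\<^sub>R (c + d)) \<le> e"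
  proof -
    have eq: "(1 / 2) *\<^sub>R (a + b) - (1 / 2) *\<^sub>R (c + d) = (1 / 2) *\<^sub>R ((a - c) + (b - d))"
      by (simp add: algebra_simps)
    show ?thesis unfolding eq using norm_triangle_ineq[of "a - c" "b - d"] c(2) d(2) by simp
  qed
  ultimately show ?thesis by (rule approximableI)
qed

text \<open>Averaging a product of two signed sums over all signs kills the off-diagonal terms. The summands
  \<open>A\<close> and \<open>B\<close> collect the terms whose signs are already fixed in the induction.\<close>

lemma sign_averaging:
  fixes a :: "'i \<Rightarrow> ('b::real_normed_vector \<Rightarrow>\<^sub>L 'c::real_normed_vector)"
    and b :: "'i \<Rightarrow> ('a::real_normed_vector \<Rightarrow>\<^sub>L 'b)"
  assumes mid: "\<And>p q. K p \<Longrightarrow> K q \<Longrightarrow> K ((1 / 2) *\<^sub>R (p + q))" and "finite G"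
    and "\<And>l. (\<And>x. l x = 1 \<or> l x = - 1) \<Longrightarrow>
      K (((\<Sum>x\<in>G. (l x :: real) *\<^sub>R a x) + A) o\<^sub>L ((\<Sum>x\<in>G. l x *\<^sub>R b x) + B))"
  shows "K ((\<Sum>x\<in>G. a x o\<^sub>L b x) + (A o\<^sub>L B))"
  using assms(2,3)
proof (induction G arbitrary: A B rule: finite_induct)
  case empty
  from empty.prems[of "\<lambda>_. 1"] show ?case by simp
next
  case (insert z G)
  have step: "K ((\<Sum>x\<in>G. a x o\<^sub>L b x) + ((\<sigma> *\<^sub>R a z + A) o\<^sub>L (\<sigma> *\<^sub>R b z + B)))" if \<sigma>: "\<sigma> = 1 \<or> \<sigma> = - 1" for \<sigma>
  proof (rule insert.IH)
    fix l :: "'i \<Rightarrow> real" assume l: "\<And>x. l x = 1 \<or> l x = - 1"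
    have "K (((\<Sum>x\<in>insert z G. (l(z := \<sigma>)) x *\<^sub>R a x) + A) o\<^sub>L ((\<Sum>x\<in>insert z G. (l(z := \<sigma>)) x *\<^sub>R b x) + B))"
      by (rule insert.prems) (use l \<sigma> in auto)
    moreover have "(\<Sum>x\<in>G. (l(z := \<sigma>)) x *\<^sub>R a x) = (\<Sum>x\<in>G. l x *\<^sub>R a x)"
      "(\<Sum>x\<in>G. (l(z := \<sigma>)) x *\<^sub>R b x) = (\<Sum>x\<in>G. l x *\<^sub>R b x)"
      using insert.hyps(2) by (auto intro!: sum.cong)
    ultimately show "K (((\<Sum>x\<in>G. l x *\<^sub>R a x) + (\<sigma> *\<^sub>R a z + A)) o\<^sub>L ((\<Sum>x\<in>G. l x *\<^sub>R b x) + (\<sigma> *\<^sub>R b z + B)))"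
      using insert.hyps by (simp add: add_ac)
  qed
  have "K ((1 / 2) *\<^sub>R (((\<Sum>x\<in>G. a x o\<^sub>L b x) + ((1 *\<^sub>R a z + A) o\<^sub>L (1 *\<^sub>R b z + B)))
      + ((\<Sum>x\<in>G. a x o\<^sub>L b x) + (((- 1) *\<^sub>R a z + A) o\<^sub>L ((- 1) *\<^sub>R b z + B)))))"
    by (intro mid step) auto
  moreover have "(1 / 2) *\<^sub>R (((\<Sum>x\<in>G. a x o\<^sub>L b x) + ((1 *\<^sub>R a z + A) o\<^sub>L (1 *\<^sub>R b z + B)))
      + ((\<Sum>x\<in>G. a x o\<^sub>L b x) + (((- 1) *\<^sub>R a z + A) o\<^sub>L ((- 1) *\<^sub>R b z + B))))
      = (\<Sum>x\<in>insert z G. a x o\<^sub>L b x) + (A o\<^sub>L B)"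
  proof (rule blinfun_eqI)
    fix v
    have half: "(1 / 2) *\<^sub>R (p + p) = p" for p :: 'c
      by (metis field_sum_of_halves scaleR_add_left scaleR_add_right scaleR_one)
    show "((1 / 2) *\<^sub>R (((\<Sum>x\<in>G. a x o\<^sub>L b x) + ((1 *\<^sub>R a z + A) o\<^sub>L (1 *\<^sub>R b z + B)))
      + ((\<Sum>x\<in>G. a x o\<^sub>L b x) + (((- 1) *\<^sub>R a z + A) o\<^sub>L ((- 1) *\<^sub>R b z + B))))) v
      = ((\<Sum>x\<in>insert z G. a x o\<^sub>L b x) + (A o\<^sub>L B)) v"
      using insert.hyps half[of "(\<Sum>x\<in>G. a x (b x v)) + a z (b z v) + A (B v)"]
      by (simp add: blinfun.add_left blinfun.add_right blinfun.scaleR_left blinfun.minus_left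
          blinfun.minus_right blinfun.diff_left blinfun.diff_right blinfun.sum_left algebra_simps)
  qed
  ultimately show ?case by simp
qed

lemma norm_signed_sum_chi_le:
  fixes C :: "'i \<Rightarrow> 'x set"
  assumes G: "finite G" and l: "\<And>x. l x = 1 \<or> l x = (- 1 :: real)"
    and disj: "\<And>x x'. x \<in> G \<Longrightarrow> x' \<in> G \<Longrightarrow> x \<noteq> x' \<Longrightarrow> C x \<inter> C x' = {}"
  shows "norm (\<Sum>x\<in>G. l x *\<^sub>R (chi (C x) :: ('x, 'h::complex_inner) ell2 \<Rightarrow>\<^sub>L ('x, 'h) ell2)) \<le> 1"
proof (rule norm_blinfun_bound)
  fix f :: "('x, 'h) ell2"
  have "norm (ell2_apply ((\<Sum>x\<in>G. l x *\<^sub>R chi (C x)) f) y) \<le> 1 * norm (ell2_apply f y)" for y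
  proof -
    have eq: "ell2_apply ((\<Sum>x\<in>G. l x *\<^sub>R chi (C x)) f) y = (\<Sum>x\<in>G. if y \<in> C x then l x *\<^sub>R ell2_apply f y else 0)"
      by (auto simp: blinfun.sum_left blinfun.scaleR_left ell2_apply_sum ell2_apply_scaleR intro!: sum.cong)
    show ?thesis
    proof (cases "\<exists>x\<in>G. y \<in> C x")
      case True
      then obtain x where x: "x \<in> G" "y \<in> C x" by blast
      have "(\<Sum>x\<in>G. if y \<in> C x then l x *\<^sub>R ell2_apply f y else 0)
          = (\<Sum>x\<in>{x}. if y \<in> C x then l x *\<^sub>R ell2_apply f y else 0)"
        using x G disj by (intro sum.mono_neutral_right) auto
      then have "ell2_apply ((\<Sum>x\<in>G. l x *\<^sub>R chi (C x)) f) y = l x *\<^sub>R ell2_apply f y"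
        using eq x by simp
      then show ?thesis using l[of x] by auto
    next
      case False
      then have "(\<Sum>x\<in>G. if y \<in> C x then l x *\<^sub>R ell2_apply f y else 0) = 0"
        by (intro sum.neutral) auto
      then show ?thesis using eq by simp
    qed
  qed
  then show "norm ((\<Sum>x\<in>G. l x *\<^sub>R chi (C x)) f) \<le> 1 * norm f" by (rule norm_ell2_le) simp
qed simp

lemma sum_norm_sq_chi_le:
  fixes f :: "('x, 'h::complex_inner) ell2"
  assumes "finite F" "\<And>x x'. x \<in> F \<Longrightarrow> x' \<in> F \<Longrightarrow> x \<noteq> x' \<Longrightarrow> C x \<inter> C x' = {}"
  shows "(\<Sum>x\<in>F. (norm (chi (C x) f))\<^sup>2) \<le> (norm f)\<^sup>2"
proof -
  have "(\<Sum>x\<in>F. (norm (chi (C x) f))\<^sup>2) = (norm (chi (\<Union>x\<in>F. C x) f))\<^sup>2"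
    using assms
  proof (induction F rule: finite_induct)
    case (insert z F)
    have d: "C z \<inter> (\<Union>x\<in>F. C x) = {}" using insert.prems insert.hyps(2) by blast
    have orth: "cinner (chi (C z) f) (chi (\<Union>x\<in>F. C x) f) = 0" by (simp add: cinner_chi_left d)
    moreover have "chi (C z \<union> (\<Union>x\<in>F. C x)) f = chi (C z) f + chi (\<Union>x\<in>F. C x) f"
      by (simp add: chi_disjoint_Un[OF d] blinfun.add_left)
    ultimately show ?case using insert norm_pythagoras[OF orth] by simp
  qed simp
  also have "\<dots> \<le> (norm f)\<^sup>2" by (intro power_mono norm_chi_apply_le) simp
  finally show ?thesis .
qed

text \<open>Disjointness of the sets \<open>C x\<close> bounds the sum of the squares of the values, so that
  \<open>\<Sum>x\<in>S. \<chi>\<^sub>x T \<chi>\<^bsub>C x\<^esub>\<close> is a bounded operator.\<close>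

lemma block_row_exists:
  fixes T :: "('y, 'h::complex_hilbert) ell2 \<Rightarrow>\<^sub>L ('x, 'h) ell2"
  assumes T: "T \<in> bounded_ops"
    and disj: "\<And>x x'. x \<in> S \<Longrightarrow> x' \<in> S \<Longrightarrow> x \<noteq> x' \<Longrightarrow> C x \<inter> C x' = {}"
  obtains A where "A \<in> bounded_ops" "norm A \<le> norm T"
    "\<And>f x. ell2_apply (blinfun_apply A f) x = (if x \<in> S then ell2_apply (T (chi (C x) f)) x else 0)"
proof -
  define g where "g f x = (if x \<in> S then ell2_apply (T (chi (C x) f)) x else 0)" for f x
  have bound: "L2_set (\<lambda>x. norm (g f x)) F \<le> norm T * norm f" if F: "finite F" for f F
    unfolding L2_set_def
  proof (rule real_le_lsqrt)
    have "(\<Sum>x\<in>F. (norm (g f x))\<^sup>2) = (\<Sum>x\<in>F \<inter> S. (norm (g f x))\<^sup>2)"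
      by (rule sum.mono_neutral_right) (use F in \<open>auto simp: g_def\<close>)
    also have "\<dots> \<le> (\<Sum>x\<in>F \<inter> S. (norm T)\<^sup>2 * (norm (chi (C x) f))\<^sup>2)"
    proof (rule sum_mono)
      fix x
      have "norm (g f x) \<le> norm T * norm (chi (C x) f)"
        using norm_ell2_apply_le[of "T (chi (C x) f)" x] norm_blinfun[of T "chi (C x) f"] by (simp add: g_def)
      then show "(norm (g f x))\<^sup>2 \<le> (norm T)\<^sup>2 * (norm (chi (C x) f))\<^sup>2"
        unfolding power_mult_distrib[symmetric] by (intro power_mono) auto
    qed
    also have "\<dots> \<le> (norm T)\<^sup>2 * (norm f)\<^sup>2"
      unfolding sum_distrib_left[symmetric]
      by (intro mult_left_mono sum_norm_sq_chi_le) (use F disj in auto)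
    finally show "(\<Sum>x\<in>F. (norm (g f x))\<^sup>2) \<le> (norm T * norm f)\<^sup>2" by (simp add: power_mult_distrib)
  qed simp
  have app: "ell2_apply (Abs_ell2 (g f)) = g f" for f
    by (rule Abs_ell2_inverse) (use ell2_boundI(1)[OF bound[of _ f]] in auto)
  have "bounded_linear (\<lambda>f. Abs_ell2 (g f))"
  proof (rule bounded_linear_intro[where K = "norm T"])
    show "norm (Abs_ell2 (g f)) \<le> norm f * norm T" for f
      unfolding norm_ell2.rep_eq[of "Abs_ell2 (g f)"] app
      using ell2_boundI(2)[OF bound[of _ f]] by (simp add: mult.commute)
  qed (auto intro!: ell2_eqI simp: app g_def ell2_apply_add ell2_apply_scaleR blinfun.add_right blinfun.scaleR_right)
  then have A: "blinfun_apply (Blinfun (\<lambda>f. Abs_ell2 (g f))) = (\<lambda>f. Abs_ell2 (g f))"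
    by (rule bounded_linear_Blinfun_apply)
  show ?thesis
  proof (rule that[of "Blinfun (\<lambda>f. Abs_ell2 (g f))"])
    show "Blinfun (\<lambda>f. Abs_ell2 (g f)) \<in> bounded_ops"
      by (rule bounded_opsI, rule ell2_eqI)
        (simp add: A app g_def ell2_apply_scaleC bounded_ops_scaleC[OF T] bounded_ops_scaleC[OF bounded_ops_chi])
    show "norm (Blinfun (\<lambda>f. Abs_ell2 (g f))) \<le> norm T"
    proof (rule norm_blinfun_bound)
      show "norm (Blinfun (\<lambda>f. Abs_ell2 (g f)) f) \<le> norm T * norm f" for f
        unfolding A norm_ell2.rep_eq[of "Abs_ell2 (g f)"] app
        using ell2_boundI(2)[OF bound[of _ f]] by simp
    qed simp
    show "ell2_apply (blinfun_apply (Blinfun (\<lambda>f. Abs_ell2 (g f))) f) x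
        = (if x \<in> S then ell2_apply (T (chi (C x) f)) x else 0)" for f x
      by (simp add: A app g_def)
  qed
qed

lemma approximable_compose_prop_le_0:
  assumes "approximable s e a" "prop_le 0 m" "norm m \<le> 1" "e \<ge> 0"
  shows "approximable s e (a o\<^sub>L m)"
proof -
  obtain d where d: "prop_le s d" "norm (a - d) \<le> e" using assms by (auto simp: approximable_def)
  have "(a o\<^sub>L m) - (d o\<^sub>L m) = (a - d) o\<^sub>L m" by (rule blinfun_eqI) (simp add: blinfun.diff_left)
  then have "norm ((a o\<^sub>L m) - (d o\<^sub>L m)) \<le> norm (a - d) * norm m"
    using norm_blinfun_compose by metis
  also have "\<dots> \<le> e * 1" using d(2) assms by (intro mult_mono) auto
  finally show ?thesis using prop_le_compose[OF d(1) assms(2)] by (intro approximableI[of s "d o\<^sub>L m"]) auto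
qed

lemma chi_index_tendsto:
  fixes f :: "('x, 'h::complex_inner) ell2"
  shows "(\<lambda>n. chi {x. index x < n} f) \<longlonglongrightarrow> f"
proof (rule LIMSEQ_I)
  fix e :: real assume e: "e > 0"
  obtain F where F: "finite F" "\<And>G. F \<subseteq> G \<Longrightarrow> norm (f - chi G f) < e"
    by (rule finite_chi_approx[OF e, of f]) blast
  have "norm (chi {x. index x < n} f - f) < e" if n: "Suc (Max (insert 0 (index ` F))) \<le> n" for n
  proof -
    have "index x < n" if "x \<in> F" for x
    proof -
      have "index x \<le> Max (insert 0 (index ` F))" using F(1) that by (intro Max_ge) auto
      then show ?thesis using n by simp
    qed
    then show ?thesis using F(2)[of "{x. index x < n}"] by (auto simp: norm_minus_commute)
  qed
  then show "\<exists>N. \<forall>n\<ge>N. norm (chi {x. index x < n} f - f) < e" by blast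
qed

text \<open>For \<open>A = \<Sum>x\<in>S. \<chi>\<^sub>x u\<^sup>* \<chi>\<^bsub>C x\<^esub>\<close>, the operator \<open>u A\<close> is the average over all signs \<open>l\<close> of the products
  of \<open>u (\<Sum>x\<in>S. l x \<chi>\<^sub>x) u\<^sup>*\<close> and \<open>\<Sum>x\<in>S. l x \<chi>\<^bsub>C x\<^esub>\<close>. These are approximable uniformly in \<open>l\<close>, and so is
  their average.\<close>

lemma block_row_band_dominated:
  fixes u :: "('x::metric_space, 'h::complex_hilbert) ell2 \<Rightarrow>\<^sub>L ('y::metric_space, 'h) ell2"
  assumes u: "equi_unitary u" and cnt: "countable (UNIV :: 'x set)"
    and disj: "\<And>x x'. x \<in> S \<Longrightarrow> x' \<in> S \<Longrightarrow> x \<noteq> x' \<Longrightarrow> C x \<inter> C x' = {}"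
    and A: "A \<in> bounded_ops"
      "\<And>f x. ell2_apply (blinfun_apply A f) x = (if x \<in> S then ell2_apply (adj u (chi (C x) f)) x else 0)"
  shows "u o\<^sub>L A \<in> band_dominated"
  unfolding band_dominated_iff
proof (intro allI impI)
  fix e :: real assume e: "e > 0"
  note un = equi_unitary_unitary_map[OF u]
  obtain s where s: "\<And>b. b \<in> prop_ball 0 \<Longrightarrow> approximable s e (conjugate u b)"
    by (rule equi_unitaryE[OF u e]) blast
  have fin: "approximable s e (u o\<^sub>L (chi F o\<^sub>L A))" if F: "finite F" for F
  proof -
    define G where "G = F \<inter> S"
    have G: "finite G" using F by (simp add: G_def)
    have "approximable s e ((\<Sum>x\<in>G. conjugate u (chi {x}) o\<^sub>L chi (C x)) + (0 o\<^sub>L (0 :: ('y, 'h) ell2 \<Rightarrow>\<^sub>L ('y, 'h) ell2)))"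
    proof (rule sign_averaging[where
          K = "approximable s e :: (('y, 'h) ell2 \<Rightarrow>\<^sub>L ('y, 'h) ell2) \<Rightarrow> bool", OF approximable_midpoint G])
      fix l :: "'x \<Rightarrow> real" assume l: "\<And>x. l x = 1 \<or> l x = - 1"
      define m where "m = (\<Sum>x\<in>G. l x *\<^sub>R (chi {x} :: ('x, 'h) ell2 \<Rightarrow>\<^sub>L ('x, 'h) ell2))"
      define m' where "m' = (\<Sum>x\<in>G. l x *\<^sub>R (chi (C x) :: ('y, 'h) ell2 \<Rightarrow>\<^sub>L ('y, 'h) ell2))"
      have "supported (band 0) (r *\<^sub>R chi D)" for r and D :: "'z::metric_space set"
        by (auto simp: supported_def blinfun.scaleR_left ell2_apply_scaleR)
      then have p: "prop_le 0 m" "prop_le 0 m'"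
        unfolding prop_le_def m_def m'_def by (auto intro!: supported_sum)
      have "norm m \<le> 1" unfolding m_def by (rule norm_signed_sum_chi_le[OF G l]) auto
      then have "approximable s e (conjugate u m)" using s p by (simp add: prop_ball_def)
      moreover have "norm m' \<le> 1"
        unfolding m'_def by (rule norm_signed_sum_chi_le[OF G l]) (use disj in \<open>auto simp: G_def\<close>)
      ultimately have "approximable s e (conjugate u m o\<^sub>L m')"
        using p(2) e by (intro approximable_compose_prop_le_0) auto
      moreover have "conjugate u m = (\<Sum>x\<in>G. l x *\<^sub>R conjugate u (chi {x}))"
        unfolding m_def conjugate_sum
        by (intro sum.cong refl blinfun_eqI) (simp add: blinfun.scaleR_left blinfun.scaleR_right)
      ultimately show "approximable s e (((\<Sum>x\<in>G. l x *\<^sub>R conjugate u (chi {x})) + 0)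
          o\<^sub>L ((\<Sum>x\<in>G. l x *\<^sub>R chi (C x)) + 0))"
        by (simp add: m'_def)
    qed
    moreover have "(\<Sum>x\<in>G. conjugate u (chi {x}) o\<^sub>L chi (C x)) + (0 o\<^sub>L (0 :: ('y, 'h) ell2 \<Rightarrow>\<^sub>L ('y, 'h) ell2)) = u o\<^sub>L (chi F o\<^sub>L A)"
    proof (rule blinfun_eqI)
      fix f
      have "chi F (A f) = (\<Sum>x\<in>G. chi {x} (adj u (chi (C x) f)))"
      proof (rule ell2_eqI)
        fix x
        have "(\<Sum>z\<in>G. if x \<in> {z} then ell2_apply (adj u (chi (C z) f)) x else 0)
            = (\<Sum>z\<in>G. if z = x then ell2_apply (adj u (chi (C x) f)) x else 0)"
          by (intro sum.cong) auto
        then show "ell2_apply (chi F (A f)) x = ell2_apply (\<Sum>x\<in>G. chi {x} (adj u (chi (C x) f))) x"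
          using G by (simp add: ell2_apply_sum A(2) G_def)
      qed
      then show "((\<Sum>x\<in>G. conjugate u (chi {x}) o\<^sub>L chi (C x)) + (0 o\<^sub>L (0 :: ('y, 'h) ell2 \<Rightarrow>\<^sub>L ('y, 'h) ell2))) f = (u o\<^sub>L (chi F o\<^sub>L A)) f"
        by (simp add: blinfun.add_left blinfun.sum_left blinfun.sum_right)
    qed
    ultimately show ?thesis by simp
  qed
  have "approximable s e (u o\<^sub>L A)"
  proof (rule approximable_weak_limit)
    show "approximable s e (u o\<^sub>L (chi {x. index x < n} o\<^sub>L A))" for n
      by (rule fin[OF finite_index_less[OF cnt]])
    show "(\<lambda>n. cinner ((u o\<^sub>L (chi {x. index x < n} o\<^sub>L A)) f) g) \<longlonglongrightarrow> cinner ((u o\<^sub>L A) f) g" for f g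
      unfolding blinfun_apply_blinfun_compose
      by (intro tendsto_cinner tendsto_const blinfun.tendsto chi_index_tendsto)
    show "norm (u o\<^sub>L (chi {x. index x < n} o\<^sub>L A)) \<le> norm u * (1 * norm A)" for n
      by (rule order_trans[OF norm_blinfun_compose mult_left_mono[OF
            order_trans[OF norm_blinfun_compose mult_right_mono[OF norm_chi_le]]]]) auto
  qed
  then show "\<exists>s\<ge>0. approximable s e (u o\<^sub>L A)"
    by (intro exI[of _ "max s 0"]) (auto elim: approximable_mono)
qed

lemma block_row_adj:
  fixes u :: "('x, 'h::complex_hilbert) ell2 \<Rightarrow>\<^sub>L ('y, 'h) ell2"
  assumes u: "u \<in> bounded_ops"
    and disj: "\<And>x x'. x \<in> S \<Longrightarrow> x' \<in> S \<Longrightarrow> x \<noteq> x' \<Longrightarrow> C x \<inter> C x' = {}"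
    and A: "A \<in> bounded_ops"
      "\<And>f x. ell2_apply (blinfun_apply A f) x = (if x \<in> S then ell2_apply (adj u (chi (C x) f)) x else 0)"
    and x: "x \<in> S"
  shows "chi (C x) (adj A \<eta>) = chi (C x) (u (delta x (ell2_apply \<eta> x)))"
proof (rule cinner_eqI)
  fix \<theta>
  have "A (chi (C x) \<theta>) = delta x (ell2_apply (adj u (chi (C x) \<theta>)) x)"
  proof (rule ell2_eqI)
    fix z
    have "C z \<inter> C x = {}" if "z \<in> S" "z \<noteq> x" using disj[OF that(1) x that(2)] .
    then show "ell2_apply (A (chi (C x) \<theta>)) z = ell2_apply (delta x (ell2_apply (adj u (chi (C x) \<theta>)) x)) z"
      using x by (auto simp: A(2))
  qed
  then have "cinner (adj A \<eta>) (chi (C x) \<theta>) = cinner (ell2_apply \<eta> x) (ell2_apply (adj u (chi (C x) \<theta>)) x)"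
    by (simp add: cinner_adj_left[OF A(1)] cinner_delta_right)
  also have "\<dots> = cinner (u (delta x (ell2_apply \<eta> x))) (chi (C x) \<theta>)"
    using cinner_adj_right[OF u, of "delta x (ell2_apply \<eta> x)"] by (simp add: cinner_delta_left)
  finally show "cinner (chi (C x) (adj A \<eta>)) \<theta> = cinner (chi (C x) (u (delta x (ell2_apply \<eta> x)))) \<theta>"
    by (simp add: cinner_chi_left)
qed

text \<open>The points of \<open>X\<close> are coloured such that the balls carrying their fibres under \<open>u\<close> are disjoint within
  a colour \<open>i\<close>, and \<open>A\<^sub>i = \<Sum>x. \<chi>\<^sub>x u\<^sup>* \<chi>\<^bsub>C x\<^esub>\<close> over the points of that colour. By concentration, \<open>\<Sum>i. A\<^sub>i A\<^sub>i\<^sup>*\<close>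
  is close to the identity, so that \<open>w u\<^sup>*\<close> is close to \<open>\<Sum>i. (w A\<^sub>i) (u A\<^sub>i)\<^sup>*\<close>.\<close>

lemma correspondence_unitary_band_dominated:
  fixes u w :: "('x::metric_space, 'h::complex_hilbert) ell2 \<Rightarrow>\<^sub>L ('y::metric_space, 'h) ell2"
  assumes X: "uniformly_locally_finite TYPE('x)"
    and u: "equi_unitary u" and w: "unitary_map w" "supported E w"
    and f: "\<And>x. (x, f x) \<in> E"
    and up: "\<And>x y y'. (x, y) \<in> E \<Longrightarrow> (x, y') \<in> E \<Longrightarrow> dist y y' \<le> s0"
    and low: "\<And>r. \<exists>s. \<forall>x x'. dist (f x) (f x') \<le> r \<longrightarrow> dist x x' \<le> s"
    and conc: "\<And>e. e > 0 \<Longrightarrow> \<exists>R. \<forall>x \<xi>. norm (chi (- cball (f x) R) (u (delta x \<xi>))) \<le> e * norm \<xi>"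
  shows "w o\<^sub>L adj u \<in> band_dominated"
proof (rule band_dominated_limit)
  fix e :: real assume e: "e > 0"
  note un = equi_unitary_unitary_map[OF u]
  note cnt = ulf_countable[OF X]
  obtain R where R: "\<And>x \<xi>. norm (chi (- cball (f x) R) (u (delta x \<xi>))) \<le> e * norm \<xi>"
    using conc[OF e] by blast
  define C where "C x = cball (f x) R" for x
  obtain t where t: "\<And>x x'. dist (f x) (f x') \<le> 2 * R \<Longrightarrow> dist x x' \<le> t" using low by blast
  have "max t 1 > 0" by simp
  then obtain N where N: "\<And>x::'x. finite (cball x (max t 1)) \<and> card (cball x (max t 1)) \<le> N"
    using X unfolding uniformly_locally_finite_def by blast
  obtain c :: "'x \<Rightarrow> nat" where c: "\<And>x. c x \<le> N"
    "\<And>x x'. x \<noteq> x' \<Longrightarrow> dist (f x) (f x') \<le> 2 * R \<Longrightarrow> c x \<noteq> c x'"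
  proof (rule bounded_degree_colouring[OF cnt, of "\<lambda>x x'. dist (f x) (f x') \<le> 2 * R"])
    show "finite {x'. dist (f x) (f x') \<le> 2 * R} \<and> card {x'. dist (f x) (f x') \<le> 2 * R} \<le> N" for x
    proof -
      have "{x'. dist (f x) (f x') \<le> 2 * R} \<subseteq> cball x (max t 1)" using t by fastforce
      then show ?thesis using N[of x] by (meson card_mono finite_subset order_trans)
    qed
  qed (auto simp: dist_commute)
  have disj: "C x \<inter> C x' = {}" if "c x = i" "c x' = i" "x \<noteq> x'" for x x' i
  proof (rule ccontr)
    assume "C x \<inter> C x' \<noteq> {}"
    then obtain y where "dist (f x) y \<le> R" "dist (f x') y \<le> R" by (auto simp: C_def)
    then have "dist (f x) (f x') \<le> 2 * R" using dist_triangle2[of "f x" "f x'" y] by simp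
    then show False using c(2)[OF that(3)] that by simp
  qed
  have "\<exists>A. A \<in> bounded_ops \<and> (\<forall>g x. ell2_apply (blinfun_apply A g) x =
      (if x \<in> {x. c x = i} then ell2_apply (adj u (chi (C x) g)) x else 0))" for i
    by (rule block_row_exists[of "adj u" "{x. c x = i}" C]) (use un disj in auto)
  then obtain A where A: "\<And>i. A i \<in> bounded_ops"
    "\<And>i g x. ell2_apply (blinfun_apply (A i) g) x =
      (if x \<in> {x. c x = i} then ell2_apply (adj u (chi (C x) g)) x else 0)" by metis
  have uA: "u o\<^sub>L A i \<in> band_dominated" for i
    by (rule block_row_band_dominated[OF u cnt _ A(1) A(2)]) (use disj in auto)
  have wA: "w o\<^sub>L A i \<in> band_dominated" for i
  proof -
    have "supported {(y, x). dist (f x) y \<le> R} (A i)"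
      by (auto simp: supported_def A(2) C_def chi_delta)
    from supported_compose[OF this w(2)] have "supported (band (R + s0)) (w o\<^sub>L A i)"
    proof (rule supported_mono)
      show "{(y, x). dist (f x) y \<le> R} O E \<subseteq> band (R + s0)"
      proof (rule subrelI)
        fix y z assume "(y, z) \<in> {(y, x). dist (f x) y \<le> R} O E"
        then obtain x where "dist (f x) y \<le> R" "(x, z) \<in> E" by auto
        then show "(y, z) \<in> band (R + s0)"
          using up[OF f[of x], of z] dist_triangle[of y z "f x"] by (simp add: dist_commute)
      qed
    qed
    then have "prop_le (R + s0) (w o\<^sub>L A i)" using w(1) A(1) by (simp add: prop_le_def)
    then show ?thesis by (rule prop_le_band_dominated)
  qed
  define S where "S = (\<Sum>i\<le>N. A i o\<^sub>L adj (A i))"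
  have S: "ell2_apply (S \<eta>) x = ell2_apply (adj u (chi (C x) (u (delta x (ell2_apply \<eta> x))))) x" for \<eta> x
  proof -
    have "chi (C x) (adj (A (c x)) \<eta>) = chi (C x) (u (delta x (ell2_apply \<eta> x)))"
      by (rule block_row_adj[OF _ _ A(1) A(2)]) (use un disj in auto)
    then have "ell2_apply (A i (adj (A i) \<eta>)) x
        = (if i = c x then ell2_apply (adj u (chi (C x) (u (delta x (ell2_apply \<eta> x))))) x else 0)" for i
      by (auto simp: A(2))
    then show ?thesis using c(1)[of x] by (simp add: S_def blinfun.sum_left ell2_apply_sum)
  qed
  have S_near: "norm (id_blinfun - S) \<le> e"
  proof (rule norm_blinfun_bound)
    fix \<eta>
    have "norm (ell2_apply ((id_blinfun - S) \<eta>) x) \<le> e * norm (ell2_apply \<eta> x)" for x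
    proof -
      have "ell2_apply \<eta> x = ell2_apply (adj u (u (delta x (ell2_apply \<eta> x)))) x" using un by simp
      then have "ell2_apply ((id_blinfun - S) \<eta>) x
          = ell2_apply (adj u (chi (- C x) (u (delta x (ell2_apply \<eta> x))))) x"
        by (simp add: blinfun.diff_left ell2_apply_diff S chi_Compl blinfun.diff_right)
      also have "norm \<dots> \<le> norm (chi (- C x) (u (delta x (ell2_apply \<eta> x))))"
        using norm_ell2_apply_le[of "adj u (chi (- C x) (u (delta x (ell2_apply \<eta> x))))" x]
          norm_unitary_map_apply[OF unitary_map_adj[OF un]] by simp
      also have "\<dots> \<le> e * norm (ell2_apply \<eta> x)" unfolding C_def by (rule R)
      finally show ?thesis .
    qed
    then show "norm ((id_blinfun - S) \<eta>) \<le> e * norm \<eta>" by (rule norm_ell2_le) (use e in simp)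
  qed (use e in simp)
  define b where "b = (\<Sum>i\<le>N. (w o\<^sub>L A i) o\<^sub>L adj (u o\<^sub>L A i))"
  have "b \<in> band_dominated"
    unfolding b_def by (intro band_dominated_sum band_dominated_compose[OF wA band_dominated_adj[OF uA]])
  moreover have "norm ((w o\<^sub>L adj u) - b) \<le> e"
  proof -
    have "(w o\<^sub>L adj u) - b = w o\<^sub>L ((id_blinfun - S) o\<^sub>L adj u)"
      by (rule blinfun_eqI) (use un A(1) in \<open>simp add: b_def S_def blinfun.diff_left blinfun.diff_right
          blinfun.sum_left blinfun.sum_right adj_compose\<close>)
    then have "norm ((w o\<^sub>L adj u) - b) \<le> norm w * (norm (id_blinfun - S) * norm (adj u))"
      by (metis (no_types) mult_left_mono norm_blinfun_compose norm_ge_zero order_trans)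
    also have "\<dots> \<le> 1 * (e * 1)"
      using norm_unitary_map_le[OF w(1)] norm_unitary_map_le[OF unitary_map_adj[OF un]] S_near e
      by (intro mult_mono) auto
    finally show ?thesis by simp
  qed
  ultimately show "\<exists>b\<in>band_dominated. norm ((w o\<^sub>L adj u) - b) \<le> e" by blast
qed

section \<open>Diagonal algebras and the choice of the unitary\<close>

text \<open>The eigenvalues over \<open>y\<close> are drawn without repetition from finitely many null sequences, hence they
  form a null sequence.\<close>

lemma conjugate_index_map_ell_infty:
  fixes k :: "'x::metric_space \<times> nat \<Rightarrow> 'y::metric_space \<times> nat" and \<xi> \<zeta> :: "nat \<Rightarrow> 'h::complex_hilbert"
  assumes \<xi>: "orthonormal_basis \<xi>" and \<zeta>: "orthonormal_basis \<zeta>" and k: "bij k"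
    and fin: "\<And>y. finite {x. \<exists>n. fst (k (x, n)) = y}"
    and a: "a \<in> ell_infty \<xi>"
  shows "conjugate (index_map \<xi> \<zeta> k) a \<in> ell_infty \<zeta>"
  unfolding ell_infty_def
proof (intro CollectI conjI allI)
  let ?w = "index_map \<xi> \<zeta> k :: ('x, 'h) ell2 \<Rightarrow>\<^sub>L ('y, 'h) ell2"
  note w = index_map_bounded_ops[OF \<xi> \<zeta> bij_is_inj[OF k]]
  show "conjugate ?w a \<in> bounded_ops" using a by (simp add: w ell_infty_def)
  obtain l where l: "\<And>x. l x \<longlonglongrightarrow> 0" "\<And>x n. a (delta x (\<xi> n)) = l x n *\<^sub>C delta x (\<xi> n)"
    using a unfolding ell_infty_def by (auto simp: choice_iff)
  fix y
  define m where "m j = l (fst (inv k (y, j))) (snd (inv k (y, j)))" for j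
  have "m \<longlonglongrightarrow> 0"
  proof (rule tendstoI)
    fix e :: real assume e: "e > 0"
    define V where "V = Sigma {x. \<exists>n. fst (k (x, n)) = y} (\<lambda>x. {n. \<not> cmod (l x n) < e})"
    have "finite {n. \<not> cmod (l x n) < e}" for x
      using tendstoD[OF l(1)[of x] e] by (simp add: cofinite_eq_sequentially[symmetric] eventually_cofinite)
    then have "finite V" unfolding V_def using fin by (intro finite_SigmaI)
    then have "finite ((\<lambda>j. inv k (y, j)) -` V)"
    proof (rule finite_vimageI)
      show "inj (\<lambda>j. inv k (y, j))"
        using k by (intro injI) (metis bij_inv_eq_iff prod.inject)
    qed
    moreover have "{j. \<not> dist (m j) 0 < e} \<subseteq> (\<lambda>j. inv k (y, j)) -` V"
    proof
      fix j assume j: "j \<in> {j. \<not> dist (m j) 0 < e}"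
      obtain x n where xn: "inv k (y, j) = (x, n)" by (cases "inv k (y, j)")
      then have "k (x, n) = (y, j)" using k by (metis bij_inv_eq_iff)
      then have "\<exists>n. fst (k (x, n)) = y" by (metis fst_conv)
      then show "j \<in> (\<lambda>j. inv k (y, j)) -` V" using j by (simp add: V_def xn m_def)
    qed
    ultimately have "finite {j. \<not> dist (m j) 0 < e}" by (rule rev_finite_subset)
    then show "\<forall>\<^sub>F j in sequentially. dist (m j) 0 < e"
      by (simp add: cofinite_eq_sequentially[symmetric] eventually_cofinite)
  qed
  moreover have "conjugate ?w a (delta y (\<zeta> j)) = m j *\<^sub>C delta y (\<zeta> j)" for j
  proof -
    obtain x n where xn: "inv k (y, j) = (x, n)" by (cases "inv k (y, j)")
    then have kxn: "k (x, n) = (y, j)" using k by (metis bij_inv_eq_iff)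
    have "adj ?w (delta y (\<zeta> j)) = delta x (\<xi> n)" "?w (delta x (\<xi> n)) = delta y (\<zeta> j)"
      using adj_index_map_basis[OF \<xi> \<zeta> bij_is_inj[OF k], of "(x, n)"]
        index_map_basis[OF \<xi> \<zeta> bij_is_inj[OF k], of "(x, n)"]
      by (simp_all add: fibre_basis_def kxn)
    then show ?thesis by (simp add: l(2) bounded_ops_scaleC[OF w] m_def xn)
  qed
  ultimately show "\<exists>l. l \<longlonglongrightarrow> 0 \<and> (\<forall>j. conjugate ?w a (delta y (\<zeta> j)) = l j *\<^sub>C delta y (\<zeta> j))" by blast
qed

lemma adj_index_map:
  fixes k :: "'x \<times> nat \<Rightarrow> 'y \<times> nat" and \<xi> \<zeta> :: "nat \<Rightarrow> 'h::complex_hilbert"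
  assumes \<xi>: "orthonormal_basis \<xi>" and \<zeta>: "orthonormal_basis \<zeta>" and k: "bij k"
  shows "adj (index_map \<xi> \<zeta> k) = index_map \<zeta> \<xi> (inv k)"
proof (rule op_eq_on_basis[OF hilbert_basis_fibre_basis[OF \<zeta>]])
  note kk = bij_is_inj[OF k] bij_is_inj[OF bij_imp_bij_inv[OF k]]
  show "adj (index_map \<xi> \<zeta> k) \<in> bounded_ops" "index_map \<zeta> \<xi> (inv k) \<in> bounded_ops"
    by (simp_all add: index_map_bounded_ops[OF \<xi> \<zeta> kk(1)] index_map_bounded_ops[OF \<zeta> \<xi> kk(2)])
  fix q
  obtain p where q: "q = k p" using k by (metis bij_pointE)
  show "adj (index_map \<xi> \<zeta> k) (fibre_basis \<zeta> q) = index_map \<zeta> \<xi> (inv k) (fibre_basis \<zeta> q)"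
    unfolding index_map_basis[OF \<zeta> \<xi> kk(2)]
    by (simp add: q adj_index_map_basis[OF \<xi> \<zeta> kk(1)] inv_f_f[OF kk(1)])
qed

lemma overlap_fibre_finite:
  assumes X: "uniformly_locally_finite TYPE('x::metric_space)"
    and E: "\<And>x x' y. (x, y) \<in> E \<Longrightarrow> (x', y) \<in> E \<Longrightarrow> dist x x' \<le> s"
  shows "finite {x::'x. (x, y) \<in> E}"
proof (cases "{x. (x, y) \<in> E} = {}")
  case False
  then obtain x where "(x, y) \<in> E" by blast
  then have "{x. (x, y) \<in> E} \<subseteq> cball x s" using E by auto
  then show ?thesis using ulf_finite_cball[OF X] finite_subset by blast
qed simp

theorem theorem5p10:
  fixes \<Phi> :: "(('x::metric_space, 'h::complex_hilbert) ell2 \<Rightarrow>\<^sub>L ('x, 'h) ell2)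
      \<Rightarrow> (('y::metric_space, 'h) ell2 \<Rightarrow>\<^sub>L ('y, 'h) ell2)"
    and \<xi> \<zeta> :: "nat \<Rightarrow> 'h"
  assumes "separable_space (euclidean :: 'h topology)"
    and "infinite_dimensional TYPE('h)"
    and "uniformly_locally_finite TYPE('x)"
    and "uniformly_locally_finite TYPE('y)"
    and "property_A TYPE('y) TYPE('h)"
    and "star_isomorphism \<Phi> roe_algebra roe_algebra"
    and "orthonormal_basis \<xi>"
    and "orthonormal_basis \<zeta>"
  shows "\<exists>v \<in> band_dominated. unitary v \<and>
    (Ad v \<circ> \<Phi>) ` roe_algebra \<subseteq> roe_algebra \<and>
    strongly_coarse_like (Ad v \<circ> \<Phi>) \<and>
    (Ad v \<circ> \<Phi>) ` ell_infty \<xi> = ell_infty \<zeta>"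
proof -
  note X = assms(3) and Y = assms(4) and A = assms(5) and \<Phi> = assms(6) and \<xi> = assms(7) and \<zeta> = assms(8)
  note cntX = ulf_countable[OF X] and cntY = ulf_countable[OF Y]
  have h: "norm (\<xi> 0) = 1" by (rule norm_hilbert_basis[OF orthonormal_basis_hilbert_basis[OF \<xi>]])
  obtain u where un: "unitary_map u" and \<Phi>u: "\<And>a. a \<in> roe_algebra \<Longrightarrow> \<Phi> a = conjugate u a"
    by (rule star_isomorphism_spatial[OF \<Phi> h]) blast
  have img: "\<Phi> ` roe_algebra = roe_algebra"
    using \<Phi> by (auto simp: star_isomorphism_def bij_betw_def)
  have roe: "conjugate u a \<in> roe_algebra" if "a \<in> roe_algebra" for a
    using imageI[OF that, of \<Phi>] by (simp add: img \<Phi>u[OF that])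
  have roe': "conjugate (adj u) b \<in> roe_algebra" if "b \<in> roe_algebra" for b
  proof -
    have "b \<in> \<Phi> ` roe_algebra" by (simp add: img that)
    then obtain a where "a \<in> roe_algebra" "b = \<Phi> a" by (elim imageE)
    then show ?thesis by (simp add: \<Phi>u un)
  qed
  have u: "equi_unitary u"
    unfolding equi_unitary_def
    by (intro conjI allI un equi_approximable_conjugate[OF \<xi> cntX un] conjugate_band_dominated[OF \<xi> X Y un roe roe'])
  have un': "unitary_map (adj u)" by (rule unitary_map_adj[OF un])
  have u': "equi_unitary (adj u)"
  proof -
    have "conjugate (adj u) b \<in> band_dominated" if "b \<in> band_dominated" for b
      by (rule conjugate_band_dominated[OF \<xi> Y X un' roe' _ that]) (use un roe in simp_all)
    then show ?thesis
      unfolding equi_unitary_def by (intro conjI allI un' equi_approximable_conjugate[OF \<xi> cntY un'])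
  qed
  obtain \<delta>1 where \<delta>1: "\<delta>1 > 0" "\<And>x. \<exists>y. (x, y) \<in> overlap u \<delta>1"
    by (rule overlap_total[OF u Y A h]) blast
  have overlap_up: "\<exists>s. \<forall>x y x' y'. (x, y) \<in> overlap u \<delta> \<longrightarrow> (x', y') \<in> overlap u \<delta> \<longrightarrow>
      dist x x' \<le> r \<longrightarrow> dist y y' \<le> s" if "\<delta> > 0" for \<delta> r
    by (rule overlap_coarse[OF u that, of r]) blast
  have overlap_low: "\<exists>s. \<forall>x y x' y'. (x, y) \<in> overlap u \<delta> \<longrightarrow> (x', y') \<in> overlap u \<delta> \<longrightarrow>
      dist y y' \<le> r \<longrightarrow> dist x x' \<le> s" if "\<delta> > 0" for \<delta> r
  proof (rule overlap_coarse[OF u' that, of r])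
    fix s
    assume s: "\<And>y x y' x'. (y, x) \<in> overlap (adj u) \<delta> \<Longrightarrow> (y', x') \<in> overlap (adj u) \<delta> \<Longrightarrow>
      dist y y' \<le> r \<Longrightarrow> dist x x' \<le> s"
    have "(y, x) \<in> overlap (adj u) \<delta>" if "(x, y) \<in> overlap u \<delta>" for x y
      using that overlap_adj[of u \<delta>] un by simp
    then show ?thesis using s by blast
  qed
  obtain f where f: "\<And>x. (x, f x) \<in> overlap u \<delta>1" using \<delta>1(2) by metis
  \<comment> \<open>Totality of the correspondence on the other side needs localisation on the domain.\<close>
  have "property_A TYPE('x) TYPE('h)"
  proof (rule property_A_coarse_embedding[OF \<xi> cntX _ _ A])
    show "\<exists>s. \<forall>x x'. dist x x' \<le> r \<longrightarrow> dist (f x) (f x') \<le> s" for r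
      using overlap_up[OF \<delta>1(1), of r] f by meson
    show "\<exists>s. \<forall>x x'. dist (f x) (f x') \<le> r \<longrightarrow> dist x x' \<le> s" for r
      using overlap_low[OF \<delta>1(1), of r] f by meson
  qed
  then obtain \<delta>2 where \<delta>2: "\<delta>2 > 0" "\<And>y. \<exists>x. (y, x) \<in> overlap (adj u) \<delta>2"
    by (rule overlap_total[OF u' X _ h]) blast
  \<comment> \<open>Lowering the threshold enlarges the correspondence.\<close>
  define \<delta> where "\<delta> = min \<delta>1 \<delta>2"
  define E where "E = overlap u \<delta>"
  have \<delta>: "\<delta> > 0" using \<delta>1(1) \<delta>2(1) by (simp add: \<delta>_def)
  have sub: "overlap u \<delta>1 \<subseteq> E" "overlap u \<delta>2 \<subseteq> E" by (auto simp: E_def overlap_def \<delta>_def)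
  have fE: "(x, f x) \<in> E" for x using f sub by blast
  have totY: "\<exists>x. (x, y) \<in> E" for y
    using \<delta>2(2)[of y] overlap_adj[of u \<delta>2] un sub by auto
  obtain k :: "'x \<times> nat \<Rightarrow> 'y \<times> nat" where k: "bij k" "\<And>x n. (x, fst (k (x, n))) \<in> E"
    by (rule correspondence_bijection[OF cntX cntY, of E]) (use fE totY in blast)+
  define w where "w = (index_map \<xi> \<zeta> k :: ('x, 'h) ell2 \<Rightarrow>\<^sub>L ('y, 'h) ell2)"
  have w: "unitary_map w" unfolding w_def by (rule index_map_unitary[OF \<xi> \<zeta>]) (use k in \<open>auto simp: bij_def\<close>)
  have wE: "supported E w"
    unfolding w_def by (rule supported_index_map[OF \<xi> \<zeta> bij_is_inj[OF k(1)] k(2)])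
  define v where "v = w o\<^sub>L adj u"
  have v: "unitary_map v" unfolding v_def by (rule unitary_map_compose[OF w un'])
  have vBD: "v \<in> band_dominated"
  proof -
    obtain s0 where s0: "\<And>x y x' y'. (x, y) \<in> E \<Longrightarrow> (x', y') \<in> E \<Longrightarrow> dist x x' \<le> 0 \<Longrightarrow> dist y y' \<le> s0"
      using overlap_up[OF \<delta>, of 0] unfolding E_def by blast
    show ?thesis
      unfolding v_def
    proof (rule correspondence_unitary_band_dominated[OF X u w wE fE])
      show "dist y y' \<le> s0" if "(x, y) \<in> E" "(x, y') \<in> E" for x y y' using s0[OF that] by simp
      show "\<exists>s. \<forall>x x'. dist (f x) (f x') \<le> r \<longrightarrow> dist x x' \<le> s" for r
        using overlap_low[OF \<delta>, of r] fE unfolding E_def by meson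
      show "\<exists>R. \<forall>x \<xi>. norm (chi (- cball (f x) R) (u (delta x \<xi>))) \<le> e * norm \<xi>" if e: "e > 0" for e
        by (rule overlap_concentrated[OF u \<delta> e]) (use fE in \<open>unfold E_def, blast\<close>)
    qed
  qed
  have vv: "conjugate v (conjugate u a) = conjugate w a" for a
    by (rule blinfun_eqI) (use un w in \<open>simp add: v_def adj_compose\<close>)
  have Ad: "(Ad v \<circ> \<Phi>) a = conjugate w a" if "a \<in> roe_algebra" for a
    using vv[of a] \<Phi>u[OF that] by (simp add: Ad_def conjugate_def)
  have "(Ad v \<circ> \<Phi>) ` roe_algebra \<subseteq> roe_algebra"
  proof (rule image_subsetI)
    fix a :: "('x, 'h) ell2 \<Rightarrow>\<^sub>L ('x, 'h) ell2" assume a: "a \<in> roe_algebra"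
    have "v o\<^sub>L conjugate u a o\<^sub>L adj v \<in> roe_algebra"
      by (intro roe_algebra_compose_right[OF Y band_dominated_adj[OF vBD]]
          roe_algebra_compose_left[OF Y vBD] roe a)
    then show "(Ad v \<circ> \<Phi>) a \<in> roe_algebra" by (simp add: Ad_def \<Phi>u[OF a])
  qed
  moreover have "strongly_coarse_like (Ad v \<circ> \<Phi>)"
    unfolding strongly_coarse_like_def
  proof (intro allI impI)
    fix r :: real assume r: "r > 0"
    obtain s1 where s1: "\<And>x y x' y'. (x, y) \<in> E \<Longrightarrow> (x', y') \<in> E \<Longrightarrow> dist x x' \<le> r \<Longrightarrow> dist y y' \<le> s1"
      using overlap_up[OF \<delta>, of r] unfolding E_def by blast
    define s where "s = max s1 1"
    have s: "s > 0" by (simp add: s_def)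
    have "propagation ((Ad v \<circ> \<Phi>) a) \<le> ennreal s"
      if a: "a \<in> roe_algebra" "propagation a \<le> ennreal r" for a
    proof -
      have "supported (band r) a" using a(2) r by (simp add: propagation_le_iff)
      from supported_compose[OF supported_compose[OF supported_adj[OF _ wE] this] wE]
      have "supported ((E\<inverse> O band r) O E) (w o\<^sub>L (a o\<^sub>L adj w))" using w by simp
      then have "supported (band s) (w o\<^sub>L (a o\<^sub>L adj w))"
        by (rule supported_mono) (use s1 in \<open>force simp: s_def\<close>)
      then have "supported (band s) (conjugate w a)" by (simp add: conjugate_def blinfun_compose_assoc)
      then show ?thesis using s by (simp add: Ad[OF a(1), unfolded comp_def] propagation_le_iff comp_def)
    qed
    with s show "\<exists>s>0. \<forall>a\<in>roe_algebra. propagation a \<le> ennreal r \<longrightarrow> propagation ((Ad v \<circ> \<Phi>) a) \<le> ennreal s"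
      by (intro exI[of _ s] conjI ballI impI)
  qed
  moreover have "(Ad v \<circ> \<Phi>) ` ell_infty \<xi> = ell_infty \<zeta>"
  proof -
    have eq: "(Ad v \<circ> \<Phi>) a = conjugate w a" if "a \<in> ell_infty \<xi>" for a
      by (rule Ad[OF ell_infty_subset_roe_algebra(2)[OF \<xi> that]])
    obtain t where t: "\<And>x y x' y'. (x, y) \<in> E \<Longrightarrow> (x', y') \<in> E \<Longrightarrow> dist y y' \<le> 0 \<Longrightarrow> dist x x' \<le> t"
      using overlap_low[OF \<delta>, of 0] unfolding E_def by blast
    obtain t' where t': "\<And>x y x' y'. (x, y) \<in> E \<Longrightarrow> (x', y') \<in> E \<Longrightarrow> dist x x' \<le> 0 \<Longrightarrow> dist y y' \<le> t'"
      using overlap_up[OF \<delta>, of 0] unfolding E_def by blast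
    have finE: "finite {x. (x, y) \<in> E}" for y
      by (rule overlap_fibre_finite[OF X, of E t]) (use t in force)
    have fin: "finite {x. \<exists>n. fst (k (x, n)) = y}" for y
      by (rule rev_finite_subset[OF finE[of y]]) (use k(2) in auto)
    have "finite {y. (y, x) \<in> E\<inverse>}" for x
      by (rule overlap_fibre_finite[OF Y, of "E\<inverse>" t']) (use t' in force)
    then have fin': "finite {y. \<exists>n. fst (inv k (y, n)) = x}" for x
    proof (rule rev_finite_subset)
      show "{y. \<exists>n. fst (inv k (y, n)) = x} \<subseteq> {y. (y, x) \<in> E\<inverse>}"
      proof
        fix y assume "y \<in> {y. \<exists>n. fst (inv k (y, n)) = x}"
        then obtain n where "fst (inv k (y, n)) = x" by auto
        then obtain m where "inv k (y, n) = (x, m)" by (cases "inv k (y, n)") simp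
        then have "k (x, m) = (y, n)" using k(1) by (metis bij_inv_eq_iff)
        then show "y \<in> {y. (y, x) \<in> E\<inverse>}" using k(2)[of x m] by simp
      qed
    qed
    show ?thesis
    proof (intro equalityI subsetI)
      fix b assume "b \<in> (Ad v \<circ> \<Phi>) ` ell_infty \<xi>"
      then obtain a where a: "a \<in> ell_infty \<xi>" "b = (Ad v \<circ> \<Phi>) a" by (elim imageE)
      show "b \<in> ell_infty \<zeta>"
        unfolding a(2) eq[OF a(1)] w_def by (rule conjugate_index_map_ell_infty[OF \<xi> \<zeta> k(1) fin a(1)])
    next
      fix b :: "('y, 'h) ell2 \<Rightarrow>\<^sub>L ('y, 'h) ell2" assume b: "b \<in> ell_infty \<zeta>"
      have "conjugate (adj w) b \<in> ell_infty \<xi>"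
        unfolding w_def adj_index_map[OF \<xi> \<zeta> k(1)]
        by (rule conjugate_index_map_ell_infty[OF \<zeta> \<xi> bij_imp_bij_inv[OF k(1)] fin' b])
      moreover from this have "b = (Ad v \<circ> \<Phi>) (conjugate (adj w) b)" using eq w by simp
      ultimately show "b \<in> (Ad v \<circ> \<Phi>) ` ell_infty \<xi>" by (rule rev_image_eqI)
    qed
  qed
  moreover have "unitary v" using v by (simp add: unitary_def unitary_map_def)
  ultimately show ?thesis using vBD by (intro bexI[of _ v] conjI)
qed

end
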